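(* Let $\mathcal{V}$ be a locally presentable braided monoidal closed category and let $B$ be a monoid in $\mathcal{V}$. Then the functor $$[-,B]^{\mathrm{op}}\colon \mathbf{Comon}(\mathcal{V})\longrightarrow \mathbf{Mon}(\mathcal{V})^{\mathrm{op}},\qquad C\mapsto [C,B],$$ has a right adjoint $P(-,B)$; that is, there is an isomorphism $$\mathbf{Mon}(\mathcal{V})(A,[C,B])\cong \mathbf{Comon}(\mathcal{V})(C,P(A,B)),$$ natural in the comonoid $C$ and the monoid $A$.
   Context: "Locally presentable braided monoidal closed category" means a braided monoidal closed category $(\mathcal{V},\otimes,I,c)$ whose underlying category is locally presentable; $[X,-]$ denotes the right adjoint of $-\otimes X$. $\mathbf{Mon}(\mathcal{V})$ and $\mathbf{Comon}(\mathcal{V})$ are the categories of monoids and of comonoids in $\mathcal{V}$. For a comonoid $(C,\Delta,\varepsilon)$ and a monoid $(B,\mu,\iota)$, the object $[C,B]$ carries the convolution monoid structure, whose multiplication is the transpose of $$[C,B]\otimes[C,B]\otimes C\xrightarrow{1\otimes 1\otimes\Delta}[C,B]\otimes[C,B]\otimes C\otimes C\xrightarrow{1\otimes c\otimes 1}([C,B]\otimes C)^{\otimes 2}\xrightarrow{\mathrm{ev}\otimes\mathrm{ev}}B\otimes B\xrightarrow{\mu}B,$$ and whose unit is the transpose of $\iota\cdot\varepsilon\colon C\to B$; this makes $[-,-]$ a functor $\mathbf{Comon}(\mathcal{V})^{\mathrm{op}}\times\mathbf{Mon}(\mathcal{V})\to\mathbf{Mon}(\mathcal{V})$. *)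

theory Defs
  imports "HOL-Library.FuncSet"
begin

unbundle cardinal_syntax

section \<open>Universes and cardinals\<close>

text \<open>
  HOL has no proper classes, so the set/class distinction is made relative to a universe, given by
  an uncountable strongly inaccessible cardinal \<open>U\<close> (equivalently, a Grothendieck universe
  containing the natural numbers).  Small means of cardinality below \<open>U\<close>.  Every small set is
  equipotent to a subset of the type \<open>'u\<close> underlying \<open>U\<close>, so small index categories and small
  cardinals may be taken to live on \<open>'u\<close>.
\<close>

definition inaccessible :: "'u rel \<Rightarrow> bool" where
  "inaccessible U \<longleftrightarrow> Card_order U \<and> natLeq <o U \<and> regularCard U \<and>
     (\<forall>A :: 'u set. |A| <o U \<longrightarrow> |Pow A| <o U)"

definition small :: "'u rel \<Rightarrow> 'a set \<Rightarrow> bool" where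
  "small U A \<longleftrightarrow> |A| <o U"

definition small_regular_cardinal :: "'u rel \<Rightarrow> 'u rel \<Rightarrow> bool" where
  "small_regular_cardinal U l \<longleftrightarrow> Card_order l \<and> cinfinite l \<and> regularCard l \<and> l <o U"


section \<open>Categories and functors\<close>

record ('o, 'm) cat =
  ob :: "'o set"
  ar :: "'m set"
  src :: "'m \<Rightarrow> 'o"
  tgt :: "'m \<Rightarrow> 'o"
  idn :: "'o \<Rightarrow> 'm"
  cmp :: "'m \<Rightarrow> 'm \<Rightarrow> 'm"  (infixr "\<cdot>\<index>" 55)

definition homset :: "('o, 'm, 'z) cat_scheme \<Rightarrow> 'o \<Rightarrow> 'o \<Rightarrow> 'm set" where
  "homset C x y = {f \<in> ar C. src C f = x \<and> tgt C f = y}"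

locale category =
  fixes C :: "('o, 'm, 'z) cat_scheme" (structure)
  assumes src_ob: "f \<in> ar C \<Longrightarrow> src C f \<in> ob C"
    and tgt_ob: "f \<in> ar C \<Longrightarrow> tgt C f \<in> ob C"
    and idn_hom: "x \<in> ob C \<Longrightarrow> idn C x \<in> homset C x x"
    and cmp_hom: "f \<in> homset C x y \<Longrightarrow> g \<in> homset C y z \<Longrightarrow> g \<cdot> f \<in> homset C x z"
    and idn_left: "f \<in> homset C x y \<Longrightarrow> idn C y \<cdot> f = f"
    and idn_right: "f \<in> homset C x y \<Longrightarrow> f \<cdot> idn C x = f"
    and cmp_assoc: "f \<in> homset C w x \<Longrightarrow> g \<in> homset C x y \<Longrightarrow> h \<in> homset C y z \<Longrightarrow>
          (h \<cdot> g) \<cdot> f = h \<cdot> (g \<cdot> f)"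

definition opcat :: "('o, 'm, 'z) cat_scheme \<Rightarrow> ('o, 'm) cat" where
  "opcat C = \<lparr>ob = ob C, ar = ar C, src = tgt C, tgt = src C, idn = idn C, cmp = (\<lambda>g f. f \<cdot>\<^bsub>C\<^esub> g)\<rparr>"

definition prodcat ::
  "('a, 'f, 'y) cat_scheme \<Rightarrow> ('b, 'g, 'z) cat_scheme \<Rightarrow> ('a \<times> 'b, 'f \<times> 'g) cat" where
  "prodcat C D = \<lparr>ob = ob C \<times> ob D, ar = ar C \<times> ar D,
     src = map_prod (src C) (src D), tgt = map_prod (tgt C) (tgt D),
     idn = map_prod (idn C) (idn D),
     cmp = (\<lambda>(g, g') (f, f'). (g \<cdot>\<^bsub>C\<^esub> f, g' \<cdot>\<^bsub>D\<^esub> f'))\<rparr>"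

definition is_inverse :: "('o, 'm, 'z) cat_scheme \<Rightarrow> 'm \<Rightarrow> 'm \<Rightarrow> bool" where
  "is_inverse C f g \<longleftrightarrow> f \<in> ar C \<and> g \<in> homset C (tgt C f) (src C f) \<and>
     g \<cdot>\<^bsub>C\<^esub> f = idn C (src C f) \<and> f \<cdot>\<^bsub>C\<^esub> g = idn C (tgt C f)"

definition is_iso :: "('o, 'm, 'z) cat_scheme \<Rightarrow> 'm \<Rightarrow> bool" where
  "is_iso C f \<longleftrightarrow> (\<exists>g. is_inverse C f g)"

definition inv_ar :: "('o, 'm, 'z) cat_scheme \<Rightarrow> 'm \<Rightarrow> 'm" where
  "inv_ar C f = (THE g. is_inverse C f g)"

record ('a, 'f, 'b, 'g) func =
  omap :: "'a \<Rightarrow> 'b"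
  amap :: "'f \<Rightarrow> 'g"

definition is_functor ::
  "('a, 'f, 'y) cat_scheme \<Rightarrow> ('b, 'g, 'z) cat_scheme \<Rightarrow> ('a, 'f, 'b, 'g) func \<Rightarrow> bool" where
  "is_functor C D F \<longleftrightarrow> category C \<and> category D \<and>
     (\<forall>x\<in>ob C. omap F x \<in> ob D) \<and>
     (\<forall>f\<in>ar C. amap F f \<in> homset D (omap F (src C f)) (omap F (tgt C f))) \<and>
     (\<forall>x\<in>ob C. amap F (idn C x) = idn D (omap F x)) \<and>
     (\<forall>f\<in>ar C. \<forall>g\<in>ar C. src C g = tgt C f \<longrightarrow>
        amap F (g \<cdot>\<^bsub>C\<^esub> f) = amap F g \<cdot>\<^bsub>D\<^esub> amap F f)"

definition fcomp :: "('b, 'g, 'c, 'h) func \<Rightarrow> ('a, 'f, 'b, 'g) func \<Rightarrow> ('a, 'f, 'c, 'h) func" where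
  "fcomp G F = \<lparr>omap = omap G \<circ> omap F, amap = amap G \<circ> amap F\<rparr>"

text \<open>
  \<open>G\<close> is right adjoint to \<open>F\<close>, witnessed by bijections
  \<open>\<phi> x y : D(F x, y) \<rightarrow> C(x, G y)\<close> natural in \<open>x\<close> and \<open>y\<close>.
\<close>

definition adjunction ::
  "('a, 'f, 'y) cat_scheme \<Rightarrow> ('b, 'g, 'z) cat_scheme \<Rightarrow> ('a, 'f, 'b, 'g) func \<Rightarrow>
   ('b, 'g, 'a, 'f) func \<Rightarrow> ('a \<Rightarrow> 'b \<Rightarrow> 'g \<Rightarrow> 'f) \<Rightarrow> bool" where
  "adjunction C D F G \<phi> \<longleftrightarrow> is_functor C D F \<and> is_functor D C G \<and>
     (\<forall>x\<in>ob C. \<forall>y\<in>ob D. bij_betw (\<phi> x y) (homset D (omap F x) y) (homset C x (omap G y))) \<and>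
     (\<forall>x\<in>ob C. \<forall>x'\<in>ob C. \<forall>y\<in>ob D. \<forall>y'\<in>ob D.
        \<forall>h\<in>homset C x' x. \<forall>g\<in>homset D (omap F x) y. \<forall>k\<in>homset D y y'.
          \<phi> x' y' (k \<cdot>\<^bsub>D\<^esub> g \<cdot>\<^bsub>D\<^esub> amap F h) = amap G k \<cdot>\<^bsub>C\<^esub> \<phi> x y g \<cdot>\<^bsub>C\<^esub> h)"


section \<open>Colimits\<close>

definition is_cocone ::
  "('j, 'k, 'y) cat_scheme \<Rightarrow> ('o, 'm, 'z) cat_scheme \<Rightarrow> ('j, 'k, 'o, 'm) func \<Rightarrow>
   'o \<Rightarrow> ('j \<Rightarrow> 'm) \<Rightarrow> bool" where
  "is_cocone J C D z k \<longleftrightarrow> z \<in> ob C \<and> (\<forall>j\<in>ob J. k j \<in> homset C (omap D j) z) \<and>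
     (\<forall>a\<in>ar J. k (tgt J a) \<cdot>\<^bsub>C\<^esub> amap D a = k (src J a))"

definition is_colimit ::
  "('j, 'k, 'y) cat_scheme \<Rightarrow> ('o, 'm, 'z) cat_scheme \<Rightarrow> ('j, 'k, 'o, 'm) func \<Rightarrow>
   'o \<Rightarrow> ('j \<Rightarrow> 'm) \<Rightarrow> bool" where
  "is_colimit J C D z k \<longleftrightarrow> is_cocone J C D z k \<and>
     (\<forall>w c. is_cocone J C D w c \<longrightarrow>
        (\<exists>!u. u \<in> homset C z w \<and> (\<forall>j\<in>ob J. u \<cdot>\<^bsub>C\<^esub> k j = c j)))"

definition cocomplete :: "'u rel \<Rightarrow> ('o, 'm, 'z) cat_scheme \<Rightarrow> bool" where
  "cocomplete U C \<longleftrightarrow>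
     (\<forall>(J :: ('u, 'u) cat) D. small U (ob J) \<and> small U (ar J) \<and> is_functor J C D \<longrightarrow>
        (\<exists>z k. is_colimit J C D z k))"


section \<open>Locally presentable categories\<close>

text \<open>A poset as a category: the pair \<open>(i, j)\<close> with \<open>i \<le> j\<close> is the unique arrow \<open>i \<rightarrow> j\<close>.\<close>

definition posetcat :: "'i set \<Rightarrow> 'i rel \<Rightarrow> ('i, 'i \<times> 'i) cat" where
  "posetcat I r = \<lparr>ob = I, ar = r, src = fst, tgt = snd, idn = (\<lambda>i. (i, i)),
     cmp = (\<lambda>b a. (fst a, snd b))\<rparr>"

text \<open>The empty subset has an upper bound as well, so a directed poset is nonempty.\<close>

definition directed_poset :: "'l rel \<Rightarrow> 'i set \<Rightarrow> 'i rel \<Rightarrow> bool" where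
  "directed_poset l I r \<longleftrightarrow> partial_order_on I r \<and>
     (\<forall>A. A \<subseteq> I \<and> |A| <o l \<longrightarrow> (\<exists>b\<in>I. \<forall>a\<in>A. (a, b) \<in> r))"

text \<open>
  The category of small sets with elements in \<open>'a\<close>.  An arrow \<open>(A, f, B)\<close> is an extensional function
  together with its domain and codomain.
\<close>

definition setcat :: "'u rel \<Rightarrow> ('a set, 'a set \<times> ('a \<Rightarrow> 'a) \<times> 'a set) cat" where
  "setcat U = \<lparr>ob = {A. small U A},
     ar = {(A, f, B). small U A \<and> small U B \<and> f \<in> A \<rightarrow>\<^sub>E B},
     src = fst, tgt = snd \<circ> snd,
     idn = (\<lambda>A. (A, restrict (\<lambda>a. a) A, A)),
     cmp = (\<lambda>(B, g, E) (A, f, B'). (A, compose A g f, E))\<rparr>"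

definition hom_functor ::
  "('o, 'm, 'z) cat_scheme \<Rightarrow> 'o \<Rightarrow> ('o, 'm, 'm set, 'm set \<times> ('m \<Rightarrow> 'm) \<times> 'm set) func" where
  "hom_functor C x = \<lparr>omap = homset C x,
     amap = (\<lambda>f. (homset C x (src C f),
                   restrict (\<lambda>g. f \<cdot>\<^bsub>C\<^esub> g) (homset C x (src C f)),
                   homset C x (tgt C f)))\<rparr>"

definition locally_small :: "'u rel \<Rightarrow> ('o, 'm, 'z) cat_scheme \<Rightarrow> bool" where
  "locally_small U C \<longleftrightarrow> (\<forall>x\<in>ob C. \<forall>y\<in>ob C. small U (homset C x y))"

text \<open>\<open>x\<close> is \<open>l\<close>-presentable if \<open>C(x, -)\<close> preserves colimits indexed by small \<open>l\<close>-directed posets.\<close>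

definition presentable :: "'u rel \<Rightarrow> 'u rel \<Rightarrow> ('o, 'm, 'z) cat_scheme \<Rightarrow> 'o \<Rightarrow> bool" where
  "presentable U l C x \<longleftrightarrow> x \<in> ob C \<and>
     (\<forall>(I :: 'u set) r D z k.
        small U I \<and> directed_poset l I r \<and> is_functor (posetcat I r) C D \<and>
        is_colimit (posetcat I r) C D z k \<longrightarrow>
        is_colimit (posetcat I r) (setcat U) (fcomp (hom_functor C x) D)
          (omap (hom_functor C x) z) (\<lambda>i. amap (hom_functor C x) (k i)))"

definition locally_presentable :: "'u rel \<Rightarrow> ('o, 'm, 'z) cat_scheme \<Rightarrow> bool" where
  "locally_presentable U C \<longleftrightarrow> category C \<and> locally_small U C \<and> cocomplete U C \<and>
     (\<exists>l. small_regular_cardinal U l \<and>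
       (\<exists>G. small U G \<and> (\<forall>x\<in>G. presentable U l C x) \<and>
         (\<forall>y\<in>ob C. \<exists>(I :: 'u set) r D k.
            small U I \<and> directed_poset l I r \<and> is_functor (posetcat I r) C D \<and>
            (\<forall>i\<in>I. omap D i \<in> G) \<and> is_colimit (posetcat I r) C D y k)))"


section \<open>Braided monoidal closed categories\<close>

record ('o, 'm) moncat = "('o, 'm) cat" +
  tensor :: "('o \<times> 'o, 'm \<times> 'm, 'o, 'm) func"
  tunit :: 'o
  assoc :: "'o \<Rightarrow> 'o \<Rightarrow> 'o \<Rightarrow> 'm"
  lunit :: "'o \<Rightarrow> 'm"
  runit :: "'o \<Rightarrow> 'm"

abbreviation tensor_ob :: "('o, 'm, 'z) moncat_scheme \<Rightarrow> 'o \<Rightarrow> 'o \<Rightarrow> 'o"  (infixr "\<otimes>\<index>" 65) where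
  "tensor_ob V x y \<equiv> omap (tensor V) (x, y)"

abbreviation tensor_ar :: "('o, 'm, 'z) moncat_scheme \<Rightarrow> 'm \<Rightarrow> 'm \<Rightarrow> 'm"  (infixr "\<boxtimes>\<index>" 65) where
  "tensor_ar V f g \<equiv> amap (tensor V) (f, g)"

locale monoidal_category = category V for V :: "('o, 'm, 'z) moncat_scheme" (structure) +
  assumes tensor_functor: "is_functor (prodcat V V) V (tensor V)"
    and tunit_ob: "tunit V \<in> ob V"
    and assoc_hom: "\<lbrakk>x \<in> ob V; y \<in> ob V; z \<in> ob V\<rbrakk> \<Longrightarrow>
          assoc V x y z \<in> homset V ((x \<otimes> y) \<otimes> z) (x \<otimes> (y \<otimes> z))"
    and assoc_iso: "\<lbrakk>x \<in> ob V; y \<in> ob V; z \<in> ob V\<rbrakk> \<Longrightarrow> is_iso V (assoc V x y z)"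
    and assoc_natural: "\<lbrakk>f \<in> homset V x x'; g \<in> homset V y y'; h \<in> homset V z z'\<rbrakk> \<Longrightarrow>
          assoc V x' y' z' \<cdot> ((f \<boxtimes> g) \<boxtimes> h) = (f \<boxtimes> (g \<boxtimes> h)) \<cdot> assoc V x y z"
    and lunit_hom: "x \<in> ob V \<Longrightarrow> lunit V x \<in> homset V (tunit V \<otimes> x) x"
    and lunit_iso: "x \<in> ob V \<Longrightarrow> is_iso V (lunit V x)"
    and lunit_natural: "f \<in> homset V x y \<Longrightarrow>
          lunit V y \<cdot> (idn V (tunit V) \<boxtimes> f) = f \<cdot> lunit V x"
    and runit_hom: "x \<in> ob V \<Longrightarrow> runit V x \<in> homset V (x \<otimes> tunit V) x"
    and runit_iso: "x \<in> ob V \<Longrightarrow> is_iso V (runit V x)"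
    and runit_natural: "f \<in> homset V x y \<Longrightarrow>
          runit V y \<cdot> (f \<boxtimes> idn V (tunit V)) = f \<cdot> runit V x"
    and pentagon: "\<lbrakk>w \<in> ob V; x \<in> ob V; y \<in> ob V; z \<in> ob V\<rbrakk> \<Longrightarrow>
          assoc V w x (y \<otimes> z) \<cdot> assoc V (w \<otimes> x) y z =
          (idn V w \<boxtimes> assoc V x y z) \<cdot> assoc V w (x \<otimes> y) z \<cdot> (assoc V w x y \<boxtimes> idn V z)"
    and triangle: "\<lbrakk>x \<in> ob V; y \<in> ob V\<rbrakk> \<Longrightarrow>
          (idn V x \<boxtimes> lunit V y) \<cdot> assoc V x (tunit V) y = runit V x \<boxtimes> idn V y"

record ('o, 'm) brcat = "('o, 'm) moncat" +
  braid :: "'o \<Rightarrow> 'o \<Rightarrow> 'm"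

locale braided_monoidal_category = monoidal_category V
  for V :: "('o, 'm, 'z) brcat_scheme" (structure) +
  assumes braid_hom: "\<lbrakk>x \<in> ob V; y \<in> ob V\<rbrakk> \<Longrightarrow> braid V x y \<in> homset V (x \<otimes> y) (y \<otimes> x)"
    and braid_iso: "\<lbrakk>x \<in> ob V; y \<in> ob V\<rbrakk> \<Longrightarrow> is_iso V (braid V x y)"
    and braid_natural: "\<lbrakk>f \<in> homset V x x'; g \<in> homset V y y'\<rbrakk> \<Longrightarrow>
          braid V x' y' \<cdot> (f \<boxtimes> g) = (g \<boxtimes> f) \<cdot> braid V x y"
    and hexagon1: "\<lbrakk>x \<in> ob V; y \<in> ob V; z \<in> ob V\<rbrakk> \<Longrightarrow>
          assoc V y z x \<cdot> braid V x (y \<otimes> z) \<cdot> assoc V x y z =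
          (idn V y \<boxtimes> braid V x z) \<cdot> assoc V y x z \<cdot> (braid V x y \<boxtimes> idn V z)"
    and hexagon2: "\<lbrakk>x \<in> ob V; y \<in> ob V; z \<in> ob V\<rbrakk> \<Longrightarrow>
          inv_ar V (assoc V z x y) \<cdot> braid V (x \<otimes> y) z \<cdot> inv_ar V (assoc V x y z) =
          (braid V x z \<boxtimes> idn V y) \<cdot> inv_ar V (assoc V x z y) \<cdot> (idn V x \<boxtimes> braid V y z)"

definition tensor_right :: "('o, 'm, 'z) moncat_scheme \<Rightarrow> 'o \<Rightarrow> ('o, 'm, 'o, 'm) func" where
  "tensor_right V x = \<lparr>omap = (\<lambda>a. a \<otimes>\<^bsub>V\<^esub> x), amap = (\<lambda>f. f \<boxtimes>\<^bsub>V\<^esub> idn V x)\<rparr>"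

text \<open>
  \<open>ihom V x\<close> is the functor \<open>[x, -]\<close>, and \<open>transp V x a y\<close> is the bijection
  \<open>V(a \<otimes> x, y) \<rightarrow> V(a, [x, y])\<close>.
\<close>

record ('o, 'm) brccat = "('o, 'm) brcat" +
  ihom :: "'o \<Rightarrow> ('o, 'm, 'o, 'm) func"
  transp :: "'o \<Rightarrow> 'o \<Rightarrow> 'o \<Rightarrow> 'm \<Rightarrow> 'm"

locale braided_monoidal_closed_category = braided_monoidal_category V
  for V :: "('o, 'm, 'z) brccat_scheme" (structure) +
  assumes closed: "x \<in> ob V \<Longrightarrow> adjunction V V (tensor_right V x) (ihom V x) (transp V x)"

text \<open>The evaluation \<open>[x, y] \<otimes> x \<rightarrow> y\<close>, i.e. the counit of the adjunction.\<close>

definition ev :: "('o, 'm, 'z) brccat_scheme \<Rightarrow> 'o \<Rightarrow> 'o \<Rightarrow> 'm" where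
  "ev V x y = inv_into (homset V (omap (ihom V x) y \<otimes>\<^bsub>V\<^esub> x) y)
                (transp V x (omap (ihom V x) y) y) (idn V (omap (ihom V x) y))"


section \<open>Monoids and comonoids\<close>

text \<open>
  Monoids are triples \<open>(B, \<mu>, \<iota>)\<close> and comonoids triples \<open>(C, \<delta>, \<epsilon>)\<close>.  Arrows of the categories
  of (co)monoids carry their source and target.
\<close>

type_synonym ('o, 'm) structured = "'o \<times> 'm \<times> 'm"

definition is_monoid :: "('o, 'm, 'z) moncat_scheme \<Rightarrow> ('o, 'm) structured \<Rightarrow> bool" where
  "is_monoid V = (\<lambda>(B, \<mu>, \<iota>). B \<in> ob V \<and>
     \<mu> \<in> homset V (B \<otimes>\<^bsub>V\<^esub> B) B \<and> \<iota> \<in> homset V (tunit V) B \<and>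
     \<mu> \<cdot>\<^bsub>V\<^esub> (\<mu> \<boxtimes>\<^bsub>V\<^esub> idn V B) = \<mu> \<cdot>\<^bsub>V\<^esub> (idn V B \<boxtimes>\<^bsub>V\<^esub> \<mu>) \<cdot>\<^bsub>V\<^esub> assoc V B B B \<and>
     \<mu> \<cdot>\<^bsub>V\<^esub> (\<iota> \<boxtimes>\<^bsub>V\<^esub> idn V B) = lunit V B \<and>
     \<mu> \<cdot>\<^bsub>V\<^esub> (idn V B \<boxtimes>\<^bsub>V\<^esub> \<iota>) = runit V B)"

definition is_comonoid :: "('o, 'm, 'z) moncat_scheme \<Rightarrow> ('o, 'm) structured \<Rightarrow> bool" where
  "is_comonoid V = (\<lambda>(C, \<delta>, \<epsilon>). C \<in> ob V \<and>
     \<delta> \<in> homset V C (C \<otimes>\<^bsub>V\<^esub> C) \<and> \<epsilon> \<in> homset V C (tunit V) \<and>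
     assoc V C C C \<cdot>\<^bsub>V\<^esub> (\<delta> \<boxtimes>\<^bsub>V\<^esub> idn V C) \<cdot>\<^bsub>V\<^esub> \<delta> = (idn V C \<boxtimes>\<^bsub>V\<^esub> \<delta>) \<cdot>\<^bsub>V\<^esub> \<delta> \<and>
     lunit V C \<cdot>\<^bsub>V\<^esub> (\<epsilon> \<boxtimes>\<^bsub>V\<^esub> idn V C) \<cdot>\<^bsub>V\<^esub> \<delta> = idn V C \<and>
     runit V C \<cdot>\<^bsub>V\<^esub> (idn V C \<boxtimes>\<^bsub>V\<^esub> \<epsilon>) \<cdot>\<^bsub>V\<^esub> \<delta> = idn V C)"

definition is_monoid_hom ::
  "('o, 'm, 'z) moncat_scheme \<Rightarrow> ('o, 'm) structured \<Rightarrow> ('o, 'm) structured \<Rightarrow> 'm \<Rightarrow> bool" where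
  "is_monoid_hom V = (\<lambda>(A, \<mu>, \<iota>) (B, \<mu>', \<iota>') f. f \<in> homset V A B \<and>
     f \<cdot>\<^bsub>V\<^esub> \<mu> = \<mu>' \<cdot>\<^bsub>V\<^esub> (f \<boxtimes>\<^bsub>V\<^esub> f) \<and> f \<cdot>\<^bsub>V\<^esub> \<iota> = \<iota>')"

definition is_comonoid_hom ::
  "('o, 'm, 'z) moncat_scheme \<Rightarrow> ('o, 'm) structured \<Rightarrow> ('o, 'm) structured \<Rightarrow> 'm \<Rightarrow> bool" where
  "is_comonoid_hom V = (\<lambda>(C, \<delta>, \<epsilon>) (D, \<delta>', \<epsilon>') f. f \<in> homset V C D \<and>
     \<delta>' \<cdot>\<^bsub>V\<^esub> f = (f \<boxtimes>\<^bsub>V\<^esub> f) \<cdot>\<^bsub>V\<^esub> \<delta> \<and> \<epsilon>' \<cdot>\<^bsub>V\<^esub> f = \<epsilon>)"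

definition structured_cat ::
  "('o, 'm, 'z) cat_scheme \<Rightarrow> (('o, 'm) structured \<Rightarrow> bool) \<Rightarrow>
   (('o, 'm) structured \<Rightarrow> ('o, 'm) structured \<Rightarrow> 'm \<Rightarrow> bool) \<Rightarrow>
   (('o, 'm) structured, ('o, 'm) structured \<times> ('o, 'm) structured \<times> 'm) cat" where
  "structured_cat V P H = \<lparr>ob = {M. P M},
     ar = {(M, N, f). P M \<and> P N \<and> H M N f},
     src = (\<lambda>(M, N, f). M), tgt = (\<lambda>(M, N, f). N),
     idn = (\<lambda>M. (M, M, idn V (fst M))),
     cmp = (\<lambda>(N, L, g) (M, N', f). (M, L, g \<cdot>\<^bsub>V\<^esub> f))\<rparr>"

definition Mon ::
  "('o, 'm, 'z) moncat_scheme \<Rightarrow>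
   (('o, 'm) structured, ('o, 'm) structured \<times> ('o, 'm) structured \<times> 'm) cat" where
  "Mon V = structured_cat V (is_monoid V) (is_monoid_hom V)"

definition Comon ::
  "('o, 'm, 'z) moncat_scheme \<Rightarrow>
   (('o, 'm) structured, ('o, 'm) structured \<times> ('o, 'm) structured \<times> 'm) cat" where
  "Comon V = structured_cat V (is_comonoid V) (is_comonoid_hom V)"


section \<open>Convolution\<close>

text \<open>
  The interchange \<open>1 \<otimes> c \<otimes> 1\<close>, with associativity made explicit:
  \<open>(x \<otimes> y) \<otimes> (z \<otimes> w) \<cong> x \<otimes> ((y \<otimes> z) \<otimes> w) \<rightarrow> x \<otimes> ((z \<otimes> y) \<otimes> w) \<cong> (x \<otimes> z) \<otimes> (y \<otimes> w)\<close>.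
\<close>

definition interchange ::
  "('o, 'm, 'z) brcat_scheme \<Rightarrow> 'o \<Rightarrow> 'o \<Rightarrow> 'o \<Rightarrow> 'o \<Rightarrow> 'm" where
  "interchange V x y z w =
     inv_ar V (assoc V x z (y \<otimes>\<^bsub>V\<^esub> w)) \<cdot>\<^bsub>V\<^esub>
     (idn V x \<boxtimes>\<^bsub>V\<^esub> assoc V z y w) \<cdot>\<^bsub>V\<^esub>
     (idn V x \<boxtimes>\<^bsub>V\<^esub> (braid V y z \<boxtimes>\<^bsub>V\<^esub> idn V w)) \<cdot>\<^bsub>V\<^esub>
     (idn V x \<boxtimes>\<^bsub>V\<^esub> inv_ar V (assoc V y z w)) \<cdot>\<^bsub>V\<^esub>
     assoc V x y (z \<otimes>\<^bsub>V\<^esub> w)"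

fun convolution ::
  "('o, 'm, 'z) brccat_scheme \<Rightarrow> ('o, 'm) structured \<Rightarrow> ('o, 'm) structured \<Rightarrow>
   ('o, 'm) structured" where
  "convolution V (C, \<delta>, \<epsilon>) (B, \<mu>, \<iota>) =
     (let H = omap (ihom V C) B in
      (H,
       transp V C (H \<otimes>\<^bsub>V\<^esub> H) B
         (\<mu> \<cdot>\<^bsub>V\<^esub> (ev V C B \<boxtimes>\<^bsub>V\<^esub> ev V C B) \<cdot>\<^bsub>V\<^esub> interchange V H H C C \<cdot>\<^bsub>V\<^esub>
          (idn V (H \<otimes>\<^bsub>V\<^esub> H) \<boxtimes>\<^bsub>V\<^esub> \<delta>)),
       transp V C (tunit V) B (\<iota> \<cdot>\<^bsub>V\<^esub> \<epsilon> \<cdot>\<^bsub>V\<^esub> lunit V C)))"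

text \<open>
  \<open>[f, y] : [x', y] \<rightarrow> [x, y]\<close> for \<open>f : x \<rightarrow> x'\<close>, the transpose of
  \<open>[x', y] \<otimes> x \<rightarrow> [x', y] \<otimes> x' \<rightarrow> y\<close>.
\<close>

definition ihom_pre :: "('o, 'm, 'z) brccat_scheme \<Rightarrow> 'm \<Rightarrow> 'o \<Rightarrow> 'm" where
  "ihom_pre V f y =
     (let H = omap (ihom V (tgt V f)) y in
      transp V (src V f) H y (ev V (tgt V f) y \<cdot>\<^bsub>V\<^esub> (idn V H \<boxtimes>\<^bsub>V\<^esub> f)))"

text \<open>
  The functor \<open>[-, B]\<close>, as an assignment from \<open>Comon V\<close> to the opposite of \<open>Mon V\<close>.  An arrow
  \<open>C \<rightarrow> D\<close> is sent to the monoid arrow \<open>[D, B] \<rightarrow> [C, B]\<close>, whose source in the opposite category is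
  \<open>[C, B]\<close>.
\<close>

definition conv_functor ::
  "('o, 'm, 'z) brccat_scheme \<Rightarrow> ('o, 'm) structured \<Rightarrow>
   (('o, 'm) structured, ('o, 'm) structured \<times> ('o, 'm) structured \<times> 'm,
    ('o, 'm) structured, ('o, 'm) structured \<times> ('o, 'm) structured \<times> 'm) func" where
  "conv_functor V B = \<lparr>omap = (\<lambda>C. convolution V C B),
     amap = (\<lambda>(C, D, f). (convolution V D B, convolution V C B, ihom_pre V f (fst B)))\<rparr>"

end

theory Submission
  imports Defs "HOL-Library.Countable_Set"
begin

text \<open>
  Transposition identifies monoid arrows \<open>A \<rightarrow> [C, B]\<close> with measurings \<open>A \<otimes> C \<rightarrow> B\<close>, so \<open>P(A, B)\<close> is a terminal
  object of the category of comonoids \<open>C\<close> equipped with a measuring \<open>A \<otimes> C \<rightarrow> B\<close>.  This category has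
  small colimits, created in \<open>V\<close> because tensoring preserves colimits, so by Freyd's argument a weakly
  terminal object suffices.  Write a comonoid \<open>C\<close> as a directed colimit of presentable objects \<open>C i\<close>, \<open>i \<in> I\<close>,
  and choose for each \<open>i\<close> a lift \<open>C i \<rightarrow> C s \<otimes> C s\<close> of the comultiplication.  The
  comonoid axioms hold for these lifts at suitable later stages, so for every countable \<open>J \<subseteq> I\<close> that is closed under a
  choice of such stages the colimit over \<open>J\<close> is a comonoid, and these comonoids have underlying objects in
  a small set independent of \<open>C\<close>.  The colimit of all measuring comonoids on this small set is weakly
  terminal.
\<close>

section \<open>Categories\<close>

text \<open>What is sought is a representing object of C |-> Mon(A, [C, B]), so the real difficulty
  is one of size: comonoids need not form a small set, and nothing is known beforehand about
  presentability in the category of comonoids. Tensor products of presentable objects may fail to be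
  presentable. This does no harm, because only arrows out of a single \<open>C i\<close> are ever
  lifted or merged, while C \<otimes> C and C \<otimes> (C \<otimes> C) are directed colimits over
  the same index poset. The lifts are chosen independently of one another, so a single stage need
  not carry any coherent structure: each law asks for a later stage, which brings its own lift and
  its own laws. Iterating this demand omega times is what makes the approximations countable. Every
  stage lies in some closed countable \<open>J\<close>, so arrows out of the comonoids over these
  \<open>J\<close> can be glued to an arrow out of C, provided that they are compatible with
  inclusions of the sets \<open>J\<close>. This is why the weakly terminal object is a colimit along
  all morphisms and not a coproduct.\<close>

context category
begin

lemma homset_arD:
  assumes "f \<in> homset C x y"
  shows "f \<in> ar C" "src C f = x" "tgt C f = y" "x \<in> ob C" "y \<in> ob C"
  using assms src_ob tgt_ob by (auto simp: homset_def)

lemma ar_homset: "f \<in> ar C \<Longrightarrow> f \<in> homset C (src C f) (tgt C f)"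
  by (simp add: homset_def)

lemma idn_ar [simp]:
  assumes "x \<in> ob C"
  shows "idn C x \<in> ar C" "src C (idn C x) = x" "tgt C (idn C x) = x"
  using idn_hom[OF assms] by (auto simp: homset_def)

lemma cmp_ar [simp]:
  assumes "f \<in> ar C" "g \<in> ar C" "src C g = tgt C f"
  shows "g \<cdot> f \<in> ar C" "src C (g \<cdot> f) = src C f" "tgt C (g \<cdot> f) = tgt C g"
  using cmp_hom[of f "src C f" "tgt C f" g "tgt C g"] assms by (auto simp: homset_def)

lemma idn_cmp [simp]: "f \<in> ar C \<Longrightarrow> tgt C f = x \<Longrightarrow> idn C x \<cdot> f = f"
  by (rule idn_left) (simp add: homset_def)

lemma cmp_idn [simp]: "f \<in> ar C \<Longrightarrow> src C f = x \<Longrightarrow> f \<cdot> idn C x = f"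
  by (rule idn_right) (simp add: homset_def)

lemma cmp_cmp [simp]:
  "f \<in> ar C \<Longrightarrow> g \<in> ar C \<Longrightarrow> h \<in> ar C \<Longrightarrow> src C g = tgt C f \<Longrightarrow> src C h = tgt C g \<Longrightarrow>
    (h \<cdot> g) \<cdot> f = h \<cdot> g \<cdot> f"
  by (rule cmp_assoc[of f "src C f" "tgt C f" g "tgt C g" h "tgt C h"]) (simp_all add: homset_def)

text \<open>The simplifier nests composites to the right, so an equation for
  \<open>g \<cdot> f\<close> no longer matches once something is precomposed. This form is
  instantiated by hand with the remaining tail \<open>r\<close>, and drives most calculations
  below.\<close>

lemma cmp_tail:
  assumes "g \<cdot> f = k" "f \<in> ar C" "g \<in> ar C" "src C g = tgt C f" "r \<in> ar C" "tgt C r = src C f"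
  shows "g \<cdot> f \<cdot> r = k \<cdot> r"
  using assms cmp_cmp[of r f g] by simp

lemma is_inverse_unique:
  assumes "is_inverse C f g" "is_inverse C f h"
  shows "g = h"
proof -
  have "g = g \<cdot> f \<cdot> h" "g \<cdot> f \<cdot> h = h"
    using assms cmp_cmp[of h f g] by (auto simp: is_inverse_def homset_def)
  then show ?thesis by simp
qed

lemma inv_ar:
  assumes "is_iso C f"
  shows "is_inverse C f (inv_ar C f)"
  using assms is_inverse_unique unfolding is_iso_def inv_ar_def
  by (metis theI')

lemma inv_ar_simps:
  assumes "is_iso C f"
  shows "f \<in> ar C" "inv_ar C f \<in> ar C" "src C (inv_ar C f) = tgt C f" "tgt C (inv_ar C f) = src C f"
    "inv_ar C f \<cdot> f = idn C (src C f)" "f \<cdot> inv_ar C f = idn C (tgt C f)"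
    "r \<in> ar C \<Longrightarrow> tgt C r = src C f \<Longrightarrow> inv_ar C f \<cdot> f \<cdot> r = r"
    "s \<in> ar C \<Longrightarrow> tgt C s = tgt C f \<Longrightarrow> f \<cdot> inv_ar C f \<cdot> s = s"
  using inv_ar[OF assms] cmp_cmp[of r f "inv_ar C f"] cmp_cmp[of s "inv_ar C f" f]
  by (auto simp: is_inverse_def homset_def src_ob)

lemma iso_mono:
  assumes "is_iso C f" "f \<cdot> g = f \<cdot> h"
    and "g \<in> ar C" "tgt C g = src C f" "h \<in> ar C" "tgt C h = src C f"
  shows "g = h"
proof -
  have "g = inv_ar C f \<cdot> f \<cdot> g" "inv_ar C f \<cdot> f \<cdot> h = h"
    using assms(3-) inv_ar_simps(7)[OF assms(1)] by simp_all
  then show ?thesis using assms(2) by simp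
qed

lemma iso_epi:
  assumes iso: "is_iso C f" and eq: "g \<cdot> f = h \<cdot> f"
    and "g \<in> ar C" "src C g = tgt C f" "h \<in> ar C" "src C h = tgt C f"
  shows "g = h"
proof -
  have "(g \<cdot> f) \<cdot> inv_ar C f = (h \<cdot> f) \<cdot> inv_ar C f"
    using eq by simp
  then show ?thesis
    using assms(3-) by (simp add: inv_ar_simps[OF iso])
qed

lemma is_isoI:
  assumes "f \<in> ar C" "g \<in> ar C" "src C g = tgt C f" "tgt C g = src C f"
    and "g \<cdot> f = idn C (src C f)" "f \<cdot> g = idn C (tgt C f)"
  shows "is_iso C f"
  using assms unfolding is_iso_def is_inverse_def homset_def by blast

lemma is_iso_cmp:
  assumes "is_iso C f" "is_iso C g" "src C g = tgt C f"
  shows "is_iso C (g \<cdot> f)"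
  by (rule is_isoI[where g = "inv_ar C f \<cdot> inv_ar C g"])
    (use assms inv_ar_simps[OF assms(1)] inv_ar_simps[OF assms(2)] in \<open>simp_all\<close>)

end

section \<open>Monoidal categories\<close>

context monoidal_category
begin

lemma tensor_ob [simp]: "x \<in> ob V \<Longrightarrow> y \<in> ob V \<Longrightarrow> x \<otimes> y \<in> ob V"
  using tensor_functor by (auto simp: is_functor_def prodcat_def)

lemma tensor_ar [simp]:
  assumes "f \<in> ar V" "g \<in> ar V"
  shows "f \<boxtimes> g \<in> ar V" "src V (f \<boxtimes> g) = src V f \<otimes> src V g" "tgt V (f \<boxtimes> g) = tgt V f \<otimes> tgt V g"
  using tensor_functor assms by (force simp: is_functor_def prodcat_def homset_def)+

lemma tensor_idn [simp]: "x \<in> ob V \<Longrightarrow> y \<in> ob V \<Longrightarrow> idn V x \<boxtimes> idn V y = idn V (x \<otimes> y)"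
  using tensor_functor by (force simp: is_functor_def prodcat_def)

lemma tensor_cmp [simp]:
  assumes "f \<in> ar V" "g \<in> ar V" "f' \<in> ar V" "g' \<in> ar V" "src V g = tgt V f" "src V g' = tgt V f'"
  shows "(g \<boxtimes> g') \<cdot> (f \<boxtimes> f') = (g \<cdot> f) \<boxtimes> (g' \<cdot> f')"
  using tensor_functor assms by (force simp: is_functor_def prodcat_def)

lemma tensor_cmp_tail [simp]:
  assumes "f \<in> ar V" "g \<in> ar V" "f' \<in> ar V" "g' \<in> ar V" "src V g = tgt V f" "src V g' = tgt V f'"
    and "r \<in> ar V" "tgt V r = src V f \<otimes> src V f'"
  shows "(g \<boxtimes> g') \<cdot> (f \<boxtimes> f') \<cdot> r = ((g \<cdot> f) \<boxtimes> (g' \<cdot> f')) \<cdot> r"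
  using assms cmp_tail[OF tensor_cmp[of f g f' g'], of r] by simp

abbreviation unit_ob ("\<I>") where "\<I> \<equiv> tunit V"
abbreviation whisker_left (infixr "\<lhd>" 65) where "x \<lhd> f \<equiv> idn V x \<boxtimes> f"
abbreviation whisker_right (infixr "\<rhd>" 65) where "f \<rhd> x \<equiv> f \<boxtimes> idn V x"
abbreviation "\<alpha> x y z \<equiv> assoc V x y z"
abbreviation "\<alpha>' x y z \<equiv> inv_ar V (assoc V x y z)"

lemmas unit_in_ob [simp] = tunit_ob

lemma assoc_ar [simp]:
  assumes "x \<in> ob V" "y \<in> ob V" "z \<in> ob V"
  shows "\<alpha> x y z \<in> ar V" "src V (\<alpha> x y z) = (x \<otimes> y) \<otimes> z" "tgt V (\<alpha> x y z) = x \<otimes> (y \<otimes> z)"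
    "\<alpha>' x y z \<in> ar V" "src V (\<alpha>' x y z) = x \<otimes> (y \<otimes> z)" "tgt V (\<alpha>' x y z) = (x \<otimes> y) \<otimes> z"
    "\<alpha> x y z \<cdot> \<alpha>' x y z = idn V (x \<otimes> (y \<otimes> z))" "\<alpha>' x y z \<cdot> \<alpha> x y z = idn V ((x \<otimes> y) \<otimes> z)"
    "is_iso V (\<alpha> x y z)"
  using assoc_hom[OF assms] inv_ar_simps[OF assoc_iso[OF assms]] assoc_iso[OF assms]
  by (simp_all add: homset_def)

lemma assoc_tail [simp]:
  assumes "x \<in> ob V" "y \<in> ob V" "z \<in> ob V" "r \<in> ar V"
  shows "tgt V r = x \<otimes> (y \<otimes> z) \<Longrightarrow> \<alpha> x y z \<cdot> \<alpha>' x y z \<cdot> r = r"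
    "tgt V r = (x \<otimes> y) \<otimes> z \<Longrightarrow> \<alpha>' x y z \<cdot> \<alpha> x y z \<cdot> r = r"
  using assms inv_ar_simps(7,8)[OF assoc_iso[OF assms(1-3)], of r] by simp_all

lemma assoc_nat:
  assumes "f \<in> ar V" "g \<in> ar V" "h \<in> ar V" "tgt V f = x" "tgt V g = y" "tgt V h = z"
  shows "\<alpha> x y z \<cdot> ((f \<boxtimes> g) \<boxtimes> h) = (f \<boxtimes> (g \<boxtimes> h)) \<cdot> \<alpha> (src V f) (src V g) (src V h)"
  using assms by (intro assoc_natural) (auto simp: homset_def)

lemma lunit_ar [simp]:
  assumes "x \<in> ob V"
  shows "lunit V x \<in> ar V" "src V (lunit V x) = \<I> \<otimes> x" "tgt V (lunit V x) = x"
    "is_iso V (lunit V x)"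
    "inv_ar V (lunit V x) \<in> ar V" "src V (inv_ar V (lunit V x)) = x"
    "tgt V (inv_ar V (lunit V x)) = \<I> \<otimes> x"
    "inv_ar V (lunit V x) \<cdot> lunit V x = idn V (\<I> \<otimes> x)"
    "lunit V x \<cdot> inv_ar V (lunit V x) = idn V x"
  using lunit_hom[OF assms] inv_ar_simps[OF lunit_iso[OF assms]] lunit_iso[OF assms]
  by (simp_all add: homset_def)

lemma runit_ar [simp]:
  assumes "x \<in> ob V"
  shows "runit V x \<in> ar V" "src V (runit V x) = x \<otimes> \<I>" "tgt V (runit V x) = x"
    "is_iso V (runit V x)"
    "inv_ar V (runit V x) \<in> ar V" "src V (inv_ar V (runit V x)) = x"
    "tgt V (inv_ar V (runit V x)) = x \<otimes> \<I>"
    "inv_ar V (runit V x) \<cdot> runit V x = idn V (x \<otimes> \<I>)"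
    "runit V x \<cdot> inv_ar V (runit V x) = idn V x"
  using runit_hom[OF assms] inv_ar_simps[OF runit_iso[OF assms]] runit_iso[OF assms]
  by (simp_all add: homset_def)

lemma lunit_nat: "f \<in> ar V \<Longrightarrow> tgt V f = y \<Longrightarrow>
    lunit V y \<cdot> (\<I> \<lhd> f) = f \<cdot> lunit V (src V f)"
  by (rule lunit_natural) (auto simp: homset_def)

lemma runit_nat: "f \<in> ar V \<Longrightarrow> tgt V f = y \<Longrightarrow>
    runit V y \<cdot> (f \<rhd> \<I>) = f \<cdot> runit V (src V f)"
  by (rule runit_natural) (auto simp: homset_def)

lemma is_iso_tensor:
  assumes "is_iso V f" "is_iso V g"
  shows "is_iso V (f \<boxtimes> g)"
  by (rule is_isoI[where g = "inv_ar V f \<boxtimes> inv_ar V g"])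
    (use inv_ar_simps[OF assms(1)] inv_ar_simps[OF assms(2)] src_ob tgt_ob in \<open>simp_all\<close>)

lemma is_iso_idn: "x \<in> ob V \<Longrightarrow> is_iso V (idn V x)"
  by (rule is_isoI[where g = "idn V x"]) simp_all

text \<open>By naturality of \<open>runit\<close>, tensoring with \<I> is isomorphic to the identity
  functor. Coherence identities can therefore be checked after whiskering with \<I>, where the
  pentagon and the hexagons apply.\<close>

lemma tensor_unit_right_faithful:
  assumes "f \<rhd> \<I> = g \<rhd> \<I>" "f \<in> ar V" "g \<in> ar V"
    and "src V f = src V g" "tgt V f = tgt V g"
  shows "f = g"
proof -
  have "f \<cdot> runit V (src V f) = g \<cdot> runit V (src V f)"
    using runit_nat[of f "tgt V f"] runit_nat[of g "tgt V g"] assms by simp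
  then show ?thesis
    by (rule iso_epi[rotated]) (use assms src_ob in \<open>simp_all\<close>)
qed

lemma tensor_unit_left_faithful:
  assumes "\<I> \<lhd> f = \<I> \<lhd> g" "f \<in> ar V" "g \<in> ar V"
    and "src V f = src V g" "tgt V f = tgt V g"
  shows "f = g"
proof -
  have "f \<cdot> lunit V (src V f) = g \<cdot> lunit V (src V f)"
    using lunit_nat[of f "tgt V f"] lunit_nat[of g "tgt V g"] assms by simp
  then show ?thesis
    by (rule iso_epi[rotated]) (use assms src_ob in \<open>simp_all\<close>)
qed

lemma pentagon_tail:
  assumes "w \<in> ob V" "x \<in> ob V" "y \<in> ob V" "z \<in> ob V" "r \<in> ar V" "tgt V r = ((w \<otimes> x) \<otimes> y) \<otimes> z"
  shows "\<alpha> w x (y \<otimes> z) \<cdot> \<alpha> (w \<otimes> x) y z \<cdot> r =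
          (w \<lhd> \<alpha> x y z) \<cdot> \<alpha> w (x \<otimes> y) z \<cdot> (\<alpha> w x y \<rhd> z) \<cdot> r"
  using cmp_tail[OF pentagon[OF assms(1-4)], of r] assms by simp

lemma triangle_tail:
  assumes "x \<in> ob V" "y \<in> ob V" "r \<in> ar V" "tgt V r = (x \<otimes> \<I>) \<otimes> y"
  shows "(x \<lhd> lunit V y) \<cdot> \<alpha> x \<I> y \<cdot> r = (runit V x \<rhd> y) \<cdot> r"
  using cmp_tail[OF triangle[OF assms(1,2)], of r] assms by simp

text \<open>Kelly's lemmas: these identities already follow from the pentagon and the middle triangle.\<close>

lemma lunit_tensor:
  assumes [simp]: "x \<in> ob V" "y \<in> ob V"
  shows "lunit V (x \<otimes> y) \<cdot> \<alpha> \<I> x y = lunit V x \<rhd> y"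
proof (rule tensor_unit_left_faithful)
  show "\<I> \<lhd> (lunit V (x \<otimes> y) \<cdot> \<alpha> \<I> x y) = \<I> \<lhd> (lunit V x \<rhd> y)"
  proof (rule iso_epi)
    \<comment> \<open>Together with \<open>\<I> \<lhd> \<alpha> \<I> x y\<close>, this isomorphism
      forms the three-edge side of the pentagon at \<I>, \<I>, x, y; precomposing with it makes the
      pentagon applicable.\<close>
    let ?p = "\<alpha> \<I> (\<I> \<otimes> x) y \<cdot> (\<alpha> \<I> \<I> x \<rhd> y)"
    show "is_iso V ?p"
      by (intro is_iso_cmp is_iso_tensor is_iso_idn) simp_all
    have "(\<I> \<lhd> (lunit V (x \<otimes> y) \<cdot> \<alpha> \<I> x y)) \<cdot> ?p =
        (\<I> \<lhd> lunit V (x \<otimes> y)) \<cdot> (\<I> \<lhd> \<alpha> \<I> x y) \<cdot> ?p"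
      by simp
    also have "\<dots> = (\<I> \<lhd> lunit V (x \<otimes> y)) \<cdot> \<alpha> \<I> \<I> (x \<otimes> y) \<cdot> \<alpha> (\<I> \<otimes> \<I>) x y"
      by (simp add: pentagon del: tensor_cmp tensor_cmp_tail)
    also have "\<dots> = (runit V \<I> \<boxtimes> (x \<lhd> idn V y)) \<cdot> \<alpha> (\<I> \<otimes> \<I>) x y"
      by (simp add: triangle_tail)
    also have "\<dots> = \<alpha> \<I> x y \<cdot> ((runit V \<I> \<rhd> x) \<rhd> y)"
      by (simp add: assoc_nat del: tensor_idn)
    also have "\<dots> = \<alpha> \<I> x y \<cdot> ((\<I> \<lhd> lunit V x) \<rhd> y) \<cdot> (\<alpha> \<I> \<I> x \<rhd> y)"
      by (simp add: triangle)
    also have "\<dots> = (\<I> \<lhd> (lunit V x \<rhd> y)) \<cdot> ?p"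
      using cmp_tail[OF assoc_nat[of "idn V \<I>" "lunit V x" "idn V y" \<I> x y], of "\<alpha> \<I> \<I> x \<rhd> y"]
      by (simp del: tensor_cmp tensor_cmp_tail)
    finally show "(\<I> \<lhd> (lunit V (x \<otimes> y) \<cdot> \<alpha> \<I> x y)) \<cdot> ?p =
        (\<I> \<lhd> (lunit V x \<rhd> y)) \<cdot> ?p" .
  qed simp_all
qed simp_all

lemma runit_tensor:
  assumes [simp]: "x \<in> ob V" "y \<in> ob V"
  shows "(x \<lhd> runit V y) \<cdot> \<alpha> x y \<I> = runit V (x \<otimes> y)"
proof (rule tensor_unit_right_faithful)
  show "((x \<lhd> runit V y) \<cdot> \<alpha> x y \<I>) \<rhd> \<I> = runit V (x \<otimes> y) \<rhd> \<I>"
  proof (rule iso_mono)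
    show "is_iso V (\<alpha> x y \<I>)" by simp
    have "\<alpha> x y \<I> \<cdot> (runit V (x \<otimes> y) \<rhd> \<I>) =
        \<alpha> x y \<I> \<cdot> ((x \<lhd> idn V y) \<boxtimes> lunit V \<I>) \<cdot> \<alpha> (x \<otimes> y) \<I> \<I>"
      by (simp add: triangle)
    also have "\<dots> = (x \<lhd> (y \<lhd> lunit V \<I>)) \<cdot> \<alpha> x y (\<I> \<otimes> \<I>) \<cdot> \<alpha> (x \<otimes> y) \<I> \<I>"
      using cmp_tail[OF assoc_nat[of "idn V x" "idn V y" "lunit V \<I>" x y \<I>], of "\<alpha> (x \<otimes> y) \<I> \<I>"]
      by (simp del: tensor_cmp tensor_cmp_tail tensor_idn)
    also have "\<dots> = (x \<lhd> (runit V y \<rhd> \<I>)) \<cdot> \<alpha> x (y \<otimes> \<I>) \<I> \<cdot> (\<alpha> x y \<I> \<rhd> \<I>)"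
      by (simp add: pentagon triangle)
    also have "\<dots> = \<alpha> x y \<I> \<cdot> (((x \<lhd> runit V y) \<cdot> \<alpha> x y \<I>) \<rhd> \<I>)"
      using cmp_tail[OF assoc_nat[of "idn V x" "runit V y" "idn V \<I>" x y \<I>], of "\<alpha> x y \<I> \<rhd> \<I>"]
      by simp
    finally show "\<alpha> x y \<I> \<cdot> (((x \<lhd> runit V y) \<cdot> \<alpha> x y \<I>) \<rhd> \<I>) =
      \<alpha> x y \<I> \<cdot> (runit V (x \<otimes> y) \<rhd> \<I>)" by simp
  qed simp_all
qed simp_all

lemma lunit_unit: "lunit V \<I> = runit V \<I>"
proof (rule tensor_unit_right_faithful)
  \<comment> \<open>Naturality of \<open>lunit\<close> along \<open>lunit V \<I>\<close> itself;
    cancelling that isomorphism identifies the two ways of removing a unit from \<I> \<otimes> (\<I>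
    \<otimes> \<I>).\<close>
  have "lunit V \<I> \<cdot> (\<I> \<lhd> lunit V \<I>) = lunit V \<I> \<cdot> lunit V (\<I> \<otimes> \<I>)"
    by (simp add: lunit_nat)
  then have "\<I> \<lhd> lunit V \<I> = lunit V (\<I> \<otimes> \<I>)"
    by (rule iso_mono[rotated]) simp_all
  then show "lunit V \<I> \<rhd> \<I> = runit V \<I> \<rhd> \<I>"
    using lunit_tensor[of \<I> \<I>] triangle[of \<I> \<I>] by simp
qed simp_all

end

section \<open>The interchange in a braided monoidal category\<close>

context braided_monoidal_category
begin

lemma braid_ar [simp]:
  assumes "x \<in> ob V" "y \<in> ob V"
  shows "braid V x y \<in> ar V" "src V (braid V x y) = x \<otimes> y" "tgt V (braid V x y) = y \<otimes> x"
    "is_iso V (braid V x y)"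
  using braid_hom[OF assms] braid_iso[OF assms] by (simp_all add: homset_def)

lemma braid_nat:
  assumes "f \<in> ar V" "g \<in> ar V" "tgt V f = x" "tgt V g = y"
  shows "braid V x y \<cdot> (f \<boxtimes> g) = (g \<boxtimes> f) \<cdot> braid V (src V f) (src V g)"
  using assms by (intro braid_natural) (auto simp: homset_def)

text \<open>One side of the first hexagon at x, \<I>, \<I> contains \<open>braid V x \<I>\<close>
  twice. Kelly's identities and naturality remove everything else, one copy cancels as an
  isomorphism, and the other gives the claim whiskered with \<I>.\<close>

lemma lunit_braid:
  assumes [simp]: "x \<in> ob V"
  shows "lunit V x \<cdot> braid V x \<I> = runit V x"
proof (rule tensor_unit_right_faithful)
  show "(lunit V x \<cdot> braid V x \<I>) \<rhd> \<I> = runit V x \<rhd> \<I>"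
  proof (rule iso_mono)
    show "is_iso V (braid V x \<I>)" by simp
    have "braid V x \<I> \<cdot> (runit V x \<rhd> \<I>) =
        braid V x \<I> \<cdot> (x \<lhd> lunit V \<I>) \<cdot> \<alpha> x \<I> \<I>"
      by (simp add: triangle)
    also have "\<dots> = (lunit V \<I> \<rhd> x) \<cdot> braid V x (\<I> \<otimes> \<I>) \<cdot> \<alpha> x \<I> \<I>"
      using cmp_tail[OF braid_nat[of "idn V x" "lunit V \<I>"], of x \<I> "\<alpha> x \<I> \<I>"] by simp
    also have "\<dots> = lunit V (\<I> \<otimes> x) \<cdot> \<alpha> \<I> \<I> x \<cdot> braid V x (\<I> \<otimes> \<I>) \<cdot> \<alpha> x \<I> \<I>"
      using cmp_tail[OF lunit_tensor[of \<I> x], of "braid V x (\<I> \<otimes> \<I>) \<cdot> \<alpha> x \<I> \<I>"] by simp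
    also have "\<dots> = lunit V (\<I> \<otimes> x) \<cdot> (\<I> \<lhd> braid V x \<I>) \<cdot> \<alpha> \<I> x \<I> \<cdot> (braid V x \<I> \<rhd> \<I>)"
      by (simp add: hexagon1)
    also have "\<dots> = braid V x \<I> \<cdot> lunit V (x \<otimes> \<I>) \<cdot> \<alpha> \<I> x \<I> \<cdot> (braid V x \<I> \<rhd> \<I>)"
      using cmp_tail[OF lunit_nat[of "braid V x \<I>" "\<I> \<otimes> x"], of "\<alpha> \<I> x \<I> \<cdot> (braid V x \<I> \<rhd> \<I>)"]
      by simp
    also have "\<dots> = braid V x \<I> \<cdot> ((lunit V x \<cdot> braid V x \<I>) \<rhd> \<I>)"
      using cmp_tail[OF lunit_tensor[of x \<I>], of "braid V x \<I> \<rhd> \<I>"] by simp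
    finally show "braid V x \<I> \<cdot> ((lunit V x \<cdot> braid V x \<I>) \<rhd> \<I>) =
        braid V x \<I> \<cdot> (runit V x \<rhd> \<I>)" by simp
  qed simp_all
qed simp_all

text \<open>The mirror image of \<open>lunit_braid\<close>, from the second hexagon at \<I>, \<I>,
  x. The braiding need not be a symmetry, so inverting \<open>lunit_braid\<close> would only give
  the statement for the reversed braiding.\<close>

lemma runit_braid:
  assumes [simp]: "x \<in> ob V"
  shows "runit V x \<cdot> braid V \<I> x = lunit V x"
proof (rule tensor_unit_left_faithful)
  have r: "runit V (z \<otimes> y) \<cdot> \<alpha>' z y \<I> = z \<lhd> runit V y"
    if [simp]: "z \<in> ob V" "y \<in> ob V" for z y
    by (simp add: runit_tensor[symmetric])
  have t: "(runit V z \<rhd> y) \<cdot> \<alpha>' z \<I> y = z \<lhd> lunit V y"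
    if [simp]: "z \<in> ob V" "y \<in> ob V" for z y
    by (simp add: triangle[symmetric])
  show "\<I> \<lhd> (runit V x \<cdot> braid V \<I> x) = \<I> \<lhd> lunit V x"
  proof (rule iso_mono)
    show "is_iso V (braid V \<I> x)" by simp
    have "braid V \<I> x \<cdot> (\<I> \<lhd> lunit V x) = braid V \<I> x \<cdot> (runit V \<I> \<rhd> x) \<cdot> \<alpha>' \<I> \<I> x"
      by (simp add: t)
    also have "\<dots> = (x \<lhd> runit V \<I>) \<cdot> braid V (\<I> \<otimes> \<I>) x \<cdot> \<alpha>' \<I> \<I> x"
      using cmp_tail[OF braid_nat[of "runit V \<I>" "idn V x" \<I> x], of "\<alpha>' \<I> \<I> x"] by simp
    also have "\<dots> = runit V (x \<otimes> \<I>) \<cdot> \<alpha>' x \<I> \<I> \<cdot> braid V (\<I> \<otimes> \<I>) x \<cdot> \<alpha>' \<I> \<I> x"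
      using cmp_tail[OF r[of x \<I>], of "braid V (\<I> \<otimes> \<I>) x \<cdot> \<alpha>' \<I> \<I> x"] by simp
    also have "\<dots> = runit V (x \<otimes> \<I>) \<cdot> (braid V \<I> x \<rhd> \<I>) \<cdot> \<alpha>' \<I> x \<I> \<cdot> (\<I> \<lhd> braid V \<I> x)"
      by (simp add: hexagon2)
    also have "\<dots> = braid V \<I> x \<cdot> runit V (\<I> \<otimes> x) \<cdot> \<alpha>' \<I> x \<I> \<cdot> (\<I> \<lhd> braid V \<I> x)"
      using cmp_tail[OF runit_nat[of "braid V \<I> x" "x \<otimes> \<I>"], of "\<alpha>' \<I> x \<I> \<cdot> (\<I> \<lhd> braid V \<I> x)"]
      by simp
    also have "\<dots> = braid V \<I> x \<cdot> (\<I> \<lhd> (runit V x \<cdot> braid V \<I> x))"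
      using cmp_tail[OF r[of \<I> x], of "\<I> \<lhd> braid V \<I> x"] by simp
    finally show "braid V \<I> x \<cdot> (\<I> \<lhd> (runit V x \<cdot> braid V \<I> x)) =
        braid V \<I> x \<cdot> (\<I> \<lhd> lunit V x)" by simp
  qed simp_all
qed simp_all

text \<open>The braiding acting on the first two factors of \<open>x \<otimes> (y \<otimes> t)\<close>.  Written for these operators,
  the hexagons contain no associativity constraints between their braidings.\<close>

definition swap where
  "swap x y t = \<alpha> y x t \<cdot> (braid V x y \<rhd> t) \<cdot> \<alpha>' x y t"

lemma swap_ar [simp]:
  assumes "x \<in> ob V" "y \<in> ob V" "t \<in> ob V"
  shows "swap x y t \<in> ar V" "src V (swap x y t) = x \<otimes> (y \<otimes> t)" "tgt V (swap x y t) = y \<otimes> (x \<otimes> t)"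
  using assms by (simp_all add: swap_def)

lemma swap_assoc:
  assumes "x \<in> ob V" "y \<in> ob V" "t \<in> ob V"
  shows "swap x y t \<cdot> \<alpha> x y t = \<alpha> y x t \<cdot> (braid V x y \<rhd> t)"
  using assms by (simp add: swap_def)

lemma swap_nat:
  assumes [simp]: "f \<in> ar V" "g \<in> ar V" "h \<in> ar V" and t: "tgt V f = x" "tgt V g = y" "tgt V h = t"
  shows "swap x y t \<cdot> (f \<boxtimes> (g \<boxtimes> h)) = (g \<boxtimes> (f \<boxtimes> h)) \<cdot> swap (src V f) (src V g) (src V h)"
proof (rule iso_epi)
  note [simp] = t[symmetric] src_ob tgt_ob
  let ?a = "\<alpha> (src V f) (src V g) (src V h)"
  show "is_iso V ?a" by simp
  have "swap x y t \<cdot> (f \<boxtimes> (g \<boxtimes> h)) \<cdot> ?a = swap x y t \<cdot> \<alpha> x y t \<cdot> ((f \<boxtimes> g) \<boxtimes> h)"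
    by (simp add: assoc_nat)
  also have "\<dots> = \<alpha> y x t \<cdot> ((braid V x y \<cdot> (f \<boxtimes> g)) \<boxtimes> h)"
    using cmp_tail[OF swap_assoc[of x y t], of "(f \<boxtimes> g) \<boxtimes> h"] by simp
  also have "\<dots> = \<alpha> y x t \<cdot> ((g \<boxtimes> f) \<boxtimes> h) \<cdot> (braid V (src V f) (src V g) \<rhd> (src V h))"
    by (simp add: braid_nat)
  also have "\<dots> = (g \<boxtimes> (f \<boxtimes> h)) \<cdot> \<alpha> (src V g) (src V f) (src V h) \<cdot> (braid V (src V f) (src V g) \<rhd> (src V h))"
    using cmp_tail[OF assoc_nat[of g f h y x t], of "braid V (src V f) (src V g) \<rhd> (src V h)"] by simp
  also have "\<dots> = (g \<boxtimes> (f \<boxtimes> h)) \<cdot> swap (src V f) (src V g) (src V h) \<cdot> ?a"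
    by (simp add: swap_assoc)
  finally show "(swap x y t \<cdot> (f \<boxtimes> (g \<boxtimes> h))) \<cdot> ?a =
      ((g \<boxtimes> (f \<boxtimes> h)) \<cdot> swap (src V f) (src V g) (src V h)) \<cdot> ?a"
    by simp
qed (use assms src_ob tgt_ob in auto)

text \<open>The first hexagon whiskered with \<open>t\<close>: moving z past p \<otimes> q amounts
  to moving it past p and then past q. The pentagons only rearrange brackets.\<close>

lemma swap_tensor_right:
  assumes [simp]: "z \<in> ob V" "p \<in> ob V" "q \<in> ob V" "t \<in> ob V"
  shows "\<alpha> p q (z \<otimes> t) \<cdot> swap z (p \<otimes> q) t =
    (p \<lhd> swap z q t) \<cdot> swap z p (q \<otimes> t) \<cdot> (z \<lhd> \<alpha> p q t)"
proof (rule iso_epi)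
  let ?p = "\<alpha> z (p \<otimes> q) t \<cdot> (\<alpha> z p q \<rhd> t)"
  show "is_iso V ?p"
    by (intro is_iso_cmp is_iso_tensor is_iso_idn) simp_all
  have "(\<alpha> p q (z \<otimes> t) \<cdot> swap z (p \<otimes> q) t) \<cdot> ?p =
      \<alpha> p q (z \<otimes> t) \<cdot> \<alpha> (p \<otimes> q) z t \<cdot> ((braid V z (p \<otimes> q) \<cdot> \<alpha> z p q) \<rhd> t)"
    using cmp_tail[OF swap_assoc[of z "p \<otimes> q" t], of "\<alpha> z p q \<rhd> t"] by simp
  also have "\<dots> = (p \<lhd> \<alpha> q z t) \<cdot> \<alpha> p (q \<otimes> z) t \<cdot>
      ((\<alpha> p q z \<cdot> braid V z (p \<otimes> q) \<cdot> \<alpha> z p q) \<rhd> t)"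
    by (simp add: pentagon_tail)
  also have "\<dots> = (p \<lhd> \<alpha> q z t) \<cdot> \<alpha> p (q \<otimes> z) t \<cdot> ((p \<lhd> braid V z q) \<rhd> t) \<cdot>
      ((\<alpha> p z q \<cdot> (braid V z p \<rhd> q)) \<rhd> t)"
    by (simp add: hexagon1)
  also have "\<dots> = (p \<lhd> (\<alpha> q z t \<cdot> (braid V z q \<rhd> t))) \<cdot> \<alpha> p (z \<otimes> q) t \<cdot>
      ((\<alpha> p z q \<cdot> (braid V z p \<rhd> q)) \<rhd> t)"
    using cmp_tail[OF assoc_nat[of "idn V p" "braid V z q" "idn V t" p "q \<otimes> z" t],
        of "(\<alpha> p z q \<cdot> (braid V z p \<rhd> q)) \<rhd> t"] by simp
  also have "\<dots> = (p \<lhd> swap z q t) \<cdot> (p \<lhd> \<alpha> z q t) \<cdot> \<alpha> p (z \<otimes> q) t \<cdot>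
      (\<alpha> p z q \<rhd> t) \<cdot> ((braid V z p \<rhd> q) \<rhd> t)"
    by (simp add: swap_assoc)
  also have "\<dots> = (p \<lhd> swap z q t) \<cdot> \<alpha> p z (q \<otimes> t) \<cdot> \<alpha> (p \<otimes> z) q t \<cdot>
      ((braid V z p \<rhd> q) \<rhd> t)"
    using pentagon_tail[of p z q t "(braid V z p \<rhd> q) \<rhd> t"] by simp
  also have "\<dots> = (p \<lhd> swap z q t) \<cdot> \<alpha> p z (q \<otimes> t) \<cdot> (braid V z p \<boxtimes> (q \<lhd> idn V t)) \<cdot>
      \<alpha> (z \<otimes> p) q t"
    by (simp add: assoc_nat del: tensor_idn)
  also have "\<dots> = (p \<lhd> swap z q t) \<cdot> swap z p (q \<otimes> t) \<cdot> \<alpha> z p (q \<otimes> t) \<cdot> \<alpha> (z \<otimes> p) q t"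
    using cmp_tail[OF swap_assoc[of z p "q \<otimes> t"], of "\<alpha> (z \<otimes> p) q t"] by simp
  also have "\<dots> = ((p \<lhd> swap z q t) \<cdot> swap z p (q \<otimes> t) \<cdot> (z \<lhd> \<alpha> p q t)) \<cdot> ?p"
    by (simp add: pentagon)
  finally show "(\<alpha> p q (z \<otimes> t) \<cdot> swap z (p \<otimes> q) t) \<cdot> ?p =
    ((p \<lhd> swap z q t) \<cdot> swap z p (q \<otimes> t) \<cdot> (z \<lhd> \<alpha> p q t)) \<cdot> ?p" .
qed simp_all

lemma braid_tensor_left:
  assumes [simp]: "x \<in> ob V" "y \<in> ob V" "z \<in> ob V"
  shows "braid V (x \<otimes> y) z =
    \<alpha> z x y \<cdot> (braid V x z \<rhd> y) \<cdot> \<alpha>' x z y \<cdot> (x \<lhd> braid V y z) \<cdot> \<alpha> x y z"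
proof -
  have "braid V (x \<otimes> y) z = \<alpha> z x y \<cdot> (\<alpha>' z x y \<cdot> braid V (x \<otimes> y) z \<cdot> \<alpha>' x y z) \<cdot> \<alpha> x y z"
    by simp
  then show ?thesis
    unfolding hexagon2[OF assms] by simp
qed

text \<open>The counterpart for the second hexagon: x \<otimes> y moves past p by moving y first and
  x afterwards.\<close>

lemma swap_tensor_left:
  assumes [simp]: "x \<in> ob V" "y \<in> ob V" "p \<in> ob V" "t \<in> ob V"
  shows "(p \<lhd> \<alpha> x y t) \<cdot> swap (x \<otimes> y) p t =
    swap x p (y \<otimes> t) \<cdot> (x \<lhd> swap y p t) \<cdot> \<alpha> x y (p \<otimes> t)"
proof (rule iso_epi)
  let ?a = "\<alpha> (x \<otimes> y) p t"
  show "is_iso V ?a" by simp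
  let ?r = "\<alpha>' x p y \<cdot> (x \<lhd> braid V y p) \<cdot> \<alpha> x y p"
  have "((p \<lhd> \<alpha> x y t) \<cdot> swap (x \<otimes> y) p t) \<cdot> ?a =
      (p \<lhd> \<alpha> x y t) \<cdot> \<alpha> p (x \<otimes> y) t \<cdot> (\<alpha> p x y \<rhd> t) \<cdot> ((braid V x p \<rhd> y) \<rhd> t)
        \<cdot> (?r \<rhd> t)"
    by (simp add: swap_assoc braid_tensor_left)
  also have "\<dots> = \<alpha> p x (y \<otimes> t) \<cdot> \<alpha> (p \<otimes> x) y t \<cdot> ((braid V x p \<rhd> y) \<rhd> t) \<cdot> (?r \<rhd> t)"
    using pentagon_tail[of p x y t "((braid V x p \<rhd> y) \<rhd> t) \<cdot> (?r \<rhd> t)"]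
    by (simp del: tensor_cmp tensor_cmp_tail)
  also have "\<dots> = \<alpha> p x (y \<otimes> t) \<cdot> (braid V x p \<boxtimes> (y \<lhd> idn V t)) \<cdot> \<alpha> (x \<otimes> p) y t \<cdot> (?r \<rhd> t)"
    using cmp_tail[OF assoc_nat[of "braid V x p" "idn V y" "idn V t" "p \<otimes> x" y t], of "?r \<rhd> t"]
    by (simp del: tensor_idn tensor_cmp tensor_cmp_tail)
  also have "\<dots> = swap x p (y \<otimes> t) \<cdot> \<alpha> x p (y \<otimes> t) \<cdot> \<alpha> (x \<otimes> p) y t \<cdot> (?r \<rhd> t)"
    using cmp_tail[OF swap_assoc[of x p "y \<otimes> t"], of "\<alpha> (x \<otimes> p) y t \<cdot> (?r \<rhd> t)"] by simp
  also have "\<dots> = swap x p (y \<otimes> t) \<cdot> (x \<lhd> \<alpha> p y t) \<cdot> \<alpha> x (p \<otimes> y) t \<cdot>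
      ((x \<lhd> braid V y p) \<rhd> t) \<cdot> (\<alpha> x y p \<rhd> t)"
    by (simp add: pentagon_tail)
  also have "\<dots> = swap x p (y \<otimes> t) \<cdot> (x \<lhd> (\<alpha> p y t \<cdot> (braid V y p \<rhd> t))) \<cdot>
      \<alpha> x (y \<otimes> p) t \<cdot> (\<alpha> x y p \<rhd> t)"
    using cmp_tail[OF assoc_nat[of "idn V x" "braid V y p" "idn V t" x "p \<otimes> y" t], of "\<alpha> x y p \<rhd> t"]
    by simp
  also have "\<dots> = swap x p (y \<otimes> t) \<cdot> (x \<lhd> swap y p t) \<cdot> (x \<lhd> \<alpha> y p t) \<cdot>
      \<alpha> x (y \<otimes> p) t \<cdot> (\<alpha> x y p \<rhd> t)"
    by (simp add: swap_assoc)
  also have "\<dots> = (swap x p (y \<otimes> t) \<cdot> (x \<lhd> swap y p t) \<cdot> \<alpha> x y (p \<otimes> t)) \<cdot> ?a"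
    by (simp add: pentagon)
  finally show "((p \<lhd> \<alpha> x y t) \<cdot> swap (x \<otimes> y) p t) \<cdot> ?a =
      (swap x p (y \<otimes> t) \<cdot> (x \<lhd> swap y p t) \<cdot> \<alpha> x y (p \<otimes> t)) \<cdot> ?a" .
qed simp_all

text \<open>A factor \<open>w\<close> on the right can be absorbed into the passive tail
  \<open>t\<close> of a swap. No hexagon enters, only the pentagon and naturality of the
  associator.\<close>

lemma swap_whisker:
  assumes [simp]: "x \<in> ob V" "y \<in> ob V" "t \<in> ob V" "w \<in> ob V"
  shows "(y \<lhd> \<alpha> x t w) \<cdot> \<alpha> y (x \<otimes> t) w \<cdot> (swap x y t \<rhd> w) =
    swap x y (t \<otimes> w) \<cdot> (x \<lhd> \<alpha> y t w) \<cdot> \<alpha> x (y \<otimes> t) w"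
proof (rule iso_epi)
  let ?a = "\<alpha> x y t \<rhd> w"
  show "is_iso V ?a"
    by (intro is_iso_tensor is_iso_idn) simp_all
  have "((y \<lhd> \<alpha> x t w) \<cdot> \<alpha> y (x \<otimes> t) w \<cdot> (swap x y t \<rhd> w)) \<cdot> ?a =
      (y \<lhd> \<alpha> x t w) \<cdot> \<alpha> y (x \<otimes> t) w \<cdot> (\<alpha> y x t \<rhd> w) \<cdot> ((braid V x y \<rhd> t) \<rhd> w)"
    by (simp add: swap_assoc)
  also have "\<dots> = \<alpha> y x (t \<otimes> w) \<cdot> \<alpha> (y \<otimes> x) t w \<cdot> ((braid V x y \<rhd> t) \<rhd> w)"
    using pentagon_tail[of y x t w "(braid V x y \<rhd> t) \<rhd> w"] by simp
  also have "\<dots> = \<alpha> y x (t \<otimes> w) \<cdot> (braid V x y \<boxtimes> (t \<lhd> idn V w)) \<cdot> \<alpha> (x \<otimes> y) t w"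
    by (simp add: assoc_nat del: tensor_idn)
  also have "\<dots> = swap x y (t \<otimes> w) \<cdot> \<alpha> x y (t \<otimes> w) \<cdot> \<alpha> (x \<otimes> y) t w"
    using cmp_tail[OF swap_assoc[of x y "t \<otimes> w"], of "\<alpha> (x \<otimes> y) t w"] by simp
  also have "\<dots> = (swap x y (t \<otimes> w) \<cdot> (x \<lhd> \<alpha> y t w) \<cdot> \<alpha> x (y \<otimes> t) w) \<cdot> ?a"
    by (simp add: pentagon)
  finally show "((y \<lhd> \<alpha> x t w) \<cdot> \<alpha> y (x \<otimes> t) w \<cdot> (swap x y t \<rhd> w)) \<cdot> ?a =
      (swap x y (t \<otimes> w) \<cdot> (x \<lhd> \<alpha> y t w) \<cdot> \<alpha> x (y \<otimes> t) w) \<cdot> ?a" .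
qed simp_all

section \<open>The interchange: naturality, associativity and unit laws\<close>

lemma interchange_ar [simp]:
  assumes "x \<in> ob V" "y \<in> ob V" "z \<in> ob V" "w \<in> ob V"
  shows "interchange V x y z w \<in> ar V" "src V (interchange V x y z w) = (x \<otimes> y) \<otimes> (z \<otimes> w)"
    "tgt V (interchange V x y z w) = (x \<otimes> z) \<otimes> (y \<otimes> w)"
  using assms by (simp_all add: interchange_def)

lemma interchange_swap:
  assumes "x \<in> ob V" "y \<in> ob V" "z \<in> ob V" "w \<in> ob V"
  shows "interchange V x y z w = \<alpha>' x z (y \<otimes> w) \<cdot> (x \<lhd> swap y z w) \<cdot> \<alpha> x y (z \<otimes> w)"
  using assms by (simp add: interchange_def swap_def)

lemma assoc_interchange:
  assumes "x \<in> ob V" "y \<in> ob V" "z \<in> ob V" "w \<in> ob V"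
  shows "\<alpha> x z (y \<otimes> w) \<cdot> interchange V x y z w = (x \<lhd> swap y z w) \<cdot> \<alpha> x y (z \<otimes> w)"
  using assms by (simp add: interchange_swap)

lemma interchange_nat:
  assumes [simp]: "f \<in> ar V" "g \<in> ar V" "h \<in> ar V" "k \<in> ar V"
    and t: "tgt V f = x" "tgt V g = y" "tgt V h = z" "tgt V k = w"
  shows "interchange V x y z w \<cdot> ((f \<boxtimes> g) \<boxtimes> (h \<boxtimes> k)) =
    ((f \<boxtimes> h) \<boxtimes> (g \<boxtimes> k)) \<cdot> interchange V (src V f) (src V g) (src V h) (src V k)"
proof (rule iso_mono)
  note [simp] = t[symmetric] src_ob tgt_ob
  let ?a = "\<alpha> x z (y \<otimes> w)"
  let ?I = "interchange V (src V f) (src V g) (src V h) (src V k)"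
  show "is_iso V ?a" by simp
  have "?a \<cdot> interchange V x y z w \<cdot> ((f \<boxtimes> g) \<boxtimes> (h \<boxtimes> k)) =
      (x \<lhd> swap y z w) \<cdot> \<alpha> x y (z \<otimes> w) \<cdot> ((f \<boxtimes> g) \<boxtimes> (h \<boxtimes> k))"
    using cmp_tail[OF assoc_interchange[of x y z w], of "(f \<boxtimes> g) \<boxtimes> (h \<boxtimes> k)"] by simp
  also have "\<dots> = (x \<lhd> swap y z w) \<cdot> (f \<boxtimes> (g \<boxtimes> (h \<boxtimes> k))) \<cdot> \<alpha> (src V f) (src V g) (src V h \<otimes> src V k)"
    by (simp add: assoc_nat del: tensor_cmp_tail)
  also have "\<dots> = (f \<boxtimes> (h \<boxtimes> (g \<boxtimes> k))) \<cdot> ((src V f) \<lhd> swap (src V g) (src V h) (src V k)) \<cdot>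
      \<alpha> (src V f) (src V g) (src V h \<otimes> src V k)"
    by (simp add: swap_nat)
  also have "\<dots> = (f \<boxtimes> (h \<boxtimes> (g \<boxtimes> k))) \<cdot> \<alpha> (src V f) (src V h) (src V g \<otimes> src V k) \<cdot> ?I"
    by (simp add: assoc_interchange del: tensor_cmp_tail)
  also have "\<dots> = ?a \<cdot> ((f \<boxtimes> h) \<boxtimes> (g \<boxtimes> k)) \<cdot> ?I"
    using cmp_tail[OF assoc_nat[of f h "g \<boxtimes> k" x z "y \<otimes> w"], of ?I] by simp
  finally show "?a \<cdot> interchange V x y z w \<cdot> ((f \<boxtimes> g) \<boxtimes> (h \<boxtimes> k)) = ?a \<cdot> ((f \<boxtimes> h) \<boxtimes> (g \<boxtimes> k)) \<cdot> ?I" .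
qed (use assms src_ob tgt_ob in auto)

text \<open>This is the associativity law that makes the tensor product of a braided category a
  monoidal functor. Composing with \<open>?f\<close> brings the target into the right-nested form of
  x, p, y, q, z, r. There both sides become the same word \<open>?c\<close> in swaps: z past p, then
  y past p, then z past q.\<close>

lemma interchange_assoc:
  assumes [simp]: "x \<in> ob V" "y \<in> ob V" "z \<in> ob V" "p \<in> ob V" "q \<in> ob V" "r \<in> ob V"
  shows "\<alpha> (x \<otimes> p) (y \<otimes> q) (z \<otimes> r) \<cdot> (interchange V x y p q \<rhd> (z \<otimes> r)) \<cdot>
      interchange V (x \<otimes> y) z (p \<otimes> q) r =
    ((x \<otimes> p) \<lhd> interchange V y z q r) \<cdot> interchange V x (y \<otimes> z) p (q \<otimes> r) \<cdot>
      (\<alpha> x y z \<boxtimes> \<alpha> p q r)"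
    (is "?L = ?R")
proof (rule iso_mono)
  let ?s = "z \<otimes> r"
  let ?k = "x \<lhd> (p \<lhd> \<alpha> y q ?s)"
  let ?f = "?k \<cdot> \<alpha> x p ((y \<otimes> q) \<otimes> ?s)"
  let ?J = "interchange V (x \<otimes> y) z (p \<otimes> q) r"
  let ?c = "(p \<lhd> (y \<lhd> swap z q r)) \<cdot> swap y p (z \<otimes> q \<otimes> r) \<cdot> (y \<lhd> swap z p (q \<otimes> r))"
  show "is_iso V ?f"
    by (intro is_iso_cmp is_iso_tensor is_iso_idn) simp_all
  have "?f \<cdot> ?R =
      ?k \<cdot> (x \<lhd> (p \<lhd> interchange V y z q r)) \<cdot> \<alpha> x p ((y \<otimes> z) \<otimes> (q \<otimes> r)) \<cdot>
        interchange V x (y \<otimes> z) p (q \<otimes> r) \<cdot> (\<alpha> x y z \<boxtimes> \<alpha> p q r)"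
    using cmp_tail[OF assoc_nat[of "idn V x" "idn V p" "interchange V y z q r" x p "(y \<otimes> q) \<otimes> ?s"],
        of "interchange V x (y \<otimes> z) p (q \<otimes> r) \<cdot> (\<alpha> x y z \<boxtimes> \<alpha> p q r)"]
    by (simp del: tensor_cmp tensor_cmp_tail)
  also have "\<dots> = (x \<lhd> (p \<lhd> (\<alpha> y q ?s \<cdot> interchange V y z q r))) \<cdot>
      (x \<lhd> swap (y \<otimes> z) p (q \<otimes> r)) \<cdot> \<alpha> x (y \<otimes> z) (p \<otimes> (q \<otimes> r)) \<cdot> (\<alpha> x y z \<boxtimes> \<alpha> p q r)"
    using cmp_tail[OF assoc_interchange[of x "y \<otimes> z" p "q \<otimes> r"], of "\<alpha> x y z \<boxtimes> \<alpha> p q r"] by simp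
  also have "\<dots> = (x \<lhd> ((p \<lhd> (y \<lhd> swap z q r)) \<cdot> 
      (p \<lhd> \<alpha> y z (q \<otimes> r)) \<cdot> swap (y \<otimes> z) p (q \<otimes> r))) \<cdot>
      \<alpha> x (y \<otimes> z) (p \<otimes> (q \<otimes> r)) \<cdot> (\<alpha> x y z \<boxtimes> \<alpha> p q r)"
    by (simp add: assoc_interchange)
  also have "\<dots> = (x \<lhd> ?c) \<cdot> (x \<lhd> \<alpha> y z (p \<otimes> (q \<otimes> r))) \<cdot>
      \<alpha> x (y \<otimes> z) (p \<otimes> (q \<otimes> r)) \<cdot> (\<alpha> x y z \<boxtimes> \<alpha> p q r)"
    by (simp add: swap_tensor_left del: tensor_cmp_tail) simp
  finally have R: "?f \<cdot> ?R = (x \<lhd> ?c) \<cdot> (x \<lhd> \<alpha> y z (p \<otimes> (q \<otimes> r))) \<cdot>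
      \<alpha> x (y \<otimes> z) (p \<otimes> (q \<otimes> r)) \<cdot> (\<alpha> x y z \<boxtimes> \<alpha> p q r)" .
  have "?f \<cdot> ?L = ?k \<cdot> \<alpha> x p ((y \<otimes> q) \<otimes> ?s) \<cdot> \<alpha> (x \<otimes> p) (y \<otimes> q) ?s \<cdot>
      (interchange V x y p q \<rhd> ?s) \<cdot> ?J"
    by simp
  also have "\<dots> = ?k \<cdot> (x \<lhd> \<alpha> p (y \<otimes> q) ?s) \<cdot> \<alpha> x (p \<otimes> (y \<otimes> q)) ?s \<cdot>
      ((\<alpha> x p (y \<otimes> q) \<cdot> interchange V x y p q) \<rhd> ?s) \<cdot> ?J"
    by (simp add: pentagon_tail)
  also have "\<dots> = ?k \<cdot> (x \<lhd> \<alpha> p (y \<otimes> q) ?s) \<cdot> \<alpha> x (p \<otimes> (y \<otimes> q)) ?s \<cdot>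
      ((x \<lhd> swap y p q) \<rhd> ?s) \<cdot> (\<alpha> x y (p \<otimes> q) \<rhd> ?s) \<cdot> ?J"
    by (simp add: assoc_interchange)
  also have "\<dots> = ?k \<cdot> (x \<lhd> \<alpha> p (y \<otimes> q) ?s) \<cdot> (x \<lhd> (swap y p q \<rhd> ?s)) \<cdot>
      \<alpha> x (y \<otimes> (p \<otimes> q)) ?s \<cdot> (\<alpha> x y (p \<otimes> q) \<rhd> ?s) \<cdot> ?J"
    using cmp_tail[OF assoc_nat[of "idn V x" "swap y p q" "idn V ?s" x "p \<otimes> (y \<otimes> q)" ?s],
        of "(\<alpha> x y (p \<otimes> q) \<rhd> ?s) \<cdot> ?J"]
    by (simp del: tensor_cmp tensor_cmp_tail)
  also have "\<dots> = (x \<lhd> ((p \<lhd> \<alpha> y q ?s) \<cdot> \<alpha> p (y \<otimes> q) ?s \<cdot> (swap y p q \<rhd> ?s))) \<cdot>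
      \<alpha> x (y \<otimes> (p \<otimes> q)) ?s \<cdot> (\<alpha> x y (p \<otimes> q) \<rhd> ?s) \<cdot> ?J"
    by simp
  also have "\<dots> = (x \<lhd> (swap y p (q \<otimes> ?s) \<cdot> (y \<lhd> \<alpha> p q ?s))) \<cdot>
      (x \<lhd> \<alpha> y (p \<otimes> q) ?s) \<cdot>
      \<alpha> x (y \<otimes> (p \<otimes> q)) ?s \<cdot> (\<alpha> x y (p \<otimes> q) \<rhd> ?s) \<cdot> ?J"
    by (simp add: swap_whisker)
  also have "\<dots> = (x \<lhd> (swap y p (q \<otimes> ?s) \<cdot> (y \<lhd> \<alpha> p q ?s))) \<cdot>
      \<alpha> x y ((p \<otimes> q) \<otimes> ?s) \<cdot> \<alpha> (x \<otimes> y) (p \<otimes> q) ?s \<cdot> ?J"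
    using pentagon_tail[of x y "p \<otimes> q" ?s ?J] by simp
  also have "\<dots> = (x \<lhd> (swap y p (q \<otimes> ?s) \<cdot> (y \<lhd> \<alpha> p q ?s))) \<cdot>
      \<alpha> x y ((p \<otimes> q) \<otimes> ?s) \<cdot> ((x \<lhd> idn V y) \<boxtimes> swap z (p \<otimes> q) r) \<cdot> \<alpha> (x \<otimes> y) z ((p \<otimes> q) \<otimes> r)"
    by (simp add: assoc_interchange)
  also have "\<dots> = (x \<lhd> (swap y p (q \<otimes> ?s) \<cdot> (y \<lhd> (\<alpha> p q ?s \<cdot> swap z (p \<otimes> q) r)))) \<cdot>
      \<alpha> x y (z \<otimes> ((p \<otimes> q) \<otimes> r)) \<cdot> \<alpha> (x \<otimes> y) z ((p \<otimes> q) \<otimes> r)"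
    using cmp_tail[OF assoc_nat[of "idn V x" "idn V y" "swap z (p \<otimes> q) r" x y "(p \<otimes> q) \<otimes> ?s"],
        of "\<alpha> (x \<otimes> y) z ((p \<otimes> q) \<otimes> r)"]
    by (simp del: tensor_idn)
  also have "\<dots> = (x \<lhd> (swap y p (q \<otimes> ?s) \<cdot> (y \<lhd> (p \<lhd> swap z q r)) \<cdot>
      (y \<lhd> (swap z p (q \<otimes> r) \<cdot> (z \<lhd> \<alpha> p q r))))) \<cdot>
      \<alpha> x y (z \<otimes> ((p \<otimes> q) \<otimes> r)) \<cdot> \<alpha> (x \<otimes> y) z ((p \<otimes> q) \<otimes> r)"
    by (simp add: swap_tensor_right)
  \<comment> \<open>Swapping y with p and swapping z with q act on disjoint factors, so naturality
    of \<open>swap\<close> exchanges them. No Yang-Baxter relation enters.\<close>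
  also have "\<dots> = (x \<lhd> ((p \<lhd> (y \<lhd> swap z q r)) \<cdot> swap y p (z \<otimes> q \<otimes> r) \<cdot> 
      (y \<lhd> (swap z p (q \<otimes> r) \<cdot> (z \<lhd> \<alpha> p q r))))) \<cdot>
      \<alpha> x y (z \<otimes> ((p \<otimes> q) \<otimes> r)) \<cdot> \<alpha> (x \<otimes> y) z ((p \<otimes> q) \<otimes> r)"
    using cmp_tail[OF swap_nat[of "idn V y" "idn V p" "swap z q r" y p "q \<otimes> ?s"],
        of "y \<lhd> (swap z p (q \<otimes> r) \<cdot> (z \<lhd> \<alpha> p q r))"] 
    by (simp del: tensor_cmp tensor_cmp_tail)
  also have "\<dots> = (x \<lhd> ?c) \<cdot> (x \<lhd> (y \<lhd> (z \<lhd> \<alpha> p q r))) \<cdot>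
      \<alpha> x y (z \<otimes> ((p \<otimes> q) \<otimes> r)) \<cdot> \<alpha> (x \<otimes> y) z ((p \<otimes> q) \<otimes> r)"
    by simp
  also have "\<dots> = (x \<lhd> ?c) \<cdot> \<alpha> x y (z \<otimes> (p \<otimes> (q \<otimes> r))) \<cdot>
      ((x \<lhd> idn V y) \<boxtimes> (z \<lhd> \<alpha> p q r)) \<cdot> \<alpha> (x \<otimes> y) z ((p \<otimes> q) \<otimes> r)"
    using cmp_tail[OF assoc_nat[of "idn V x" "idn V y" "z \<lhd> \<alpha> p q r" x y "z \<otimes> (p \<otimes> (q \<otimes> r))"],
        of "\<alpha> (x \<otimes> y) z ((p \<otimes> q) \<otimes> r)"]
    by (simp del: tensor_cmp tensor_cmp_tail tensor_idn)
  also have "\<dots> = (x \<lhd> ?c) \<cdot> \<alpha> x y (z \<otimes> (p \<otimes> (q \<otimes> r))) \<cdot> \<alpha> (x \<otimes> y) z (p \<otimes> (q \<otimes> r)) \<cdot>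
      (((x \<otimes> y) \<otimes> z) \<lhd> \<alpha> p q r)"
    using assoc_nat[of "idn V (x \<otimes> y)" "idn V z" "\<alpha> p q r" "x \<otimes> y" z "p \<otimes> (q \<otimes> r)"] by simp
  also have "\<dots> = ?f \<cdot> ?R"
    unfolding R
    using pentagon_tail[of x y z "p \<otimes> (q \<otimes> r)" "((x \<otimes> y) \<otimes> z) \<lhd> \<alpha> p q r"] by simp
  finally show "?f \<cdot> ?L = ?f \<cdot> ?R" .
qed simp_all

text \<open>The interchange moves x past \<I>; by \<open>lunit_braid\<close> this crossing is
  absorbed by the left unitor, and what remains is coherence in the underlying monoidal
  category.\<close>

lemma interchange_lunit:
  assumes [simp]: "x \<in> ob V" "c \<in> ob V"
  shows "(lunit V \<I> \<rhd> (x \<otimes> c)) \<cdot> interchange V \<I> x \<I> c \<cdot> ((\<I> \<otimes> x) \<lhd> inv_ar V (lunit V c)) =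
    inv_ar V (lunit V (x \<otimes> c)) \<cdot> (lunit V x \<rhd> c)"
proof -
  have "lunit V (x \<otimes> c) \<cdot> swap x \<I> c = x \<lhd> lunit V c"
  proof (rule iso_epi)
    show "is_iso V (\<alpha> x \<I> c)" by simp
    show "(lunit V (x \<otimes> c) \<cdot> swap x \<I> c) \<cdot> \<alpha> x \<I> c = (x \<lhd> lunit V c) \<cdot> \<alpha> x \<I> c"
      using cmp_tail[OF lunit_tensor[of x c], of "braid V x \<I> \<rhd> c"]
      by (simp add: swap_assoc triangle lunit_braid)
  qed simp_all
  note s = this
  let ?r = "\<alpha> \<I> x c \<cdot> ((\<I> \<otimes> x) \<lhd> lunit V c) \<cdot> ((\<I> \<otimes> x) \<lhd> inv_ar V (lunit V c))"
  have t: "(lunit V \<I> \<rhd> (x \<otimes> c)) \<cdot> \<alpha>' \<I> \<I> (x \<otimes> c) = \<I> \<lhd> lunit V (x \<otimes> c)"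
    unfolding lunit_unit triangle[of \<I> "x \<otimes> c", OF unit_in_ob tensor_ob[OF assms], symmetric] by simp
  have "(lunit V \<I> \<rhd> (x \<otimes> c)) \<cdot> interchange V \<I> x \<I> c \<cdot> ((\<I> \<otimes> x) \<lhd> inv_ar V (lunit V c)) =
      (\<I> \<lhd> (lunit V (x \<otimes> c) \<cdot> swap x \<I> c)) \<cdot> \<alpha> \<I> x (\<I> \<otimes> c) \<cdot> ((\<I> \<otimes> x) \<lhd> inv_ar V (lunit V c))"
    using cmp_tail[OF t, of "(\<I> \<lhd> swap x \<I> c) \<cdot> \<alpha> \<I> x (\<I> \<otimes> c) \<cdot> ((\<I> \<otimes> x) \<lhd> inv_ar V (lunit V c))"]
    by (simp add: interchange_swap)
  also have "\<dots> = ?r"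
    using cmp_tail[OF assoc_nat[of "idn V \<I>" "idn V x" "lunit V c" \<I> x c],
        of "(\<I> \<otimes> x) \<lhd> inv_ar V (lunit V c)"]
    unfolding s by (simp del: tensor_cmp tensor_cmp_tail)
  also have "\<dots> = \<alpha> \<I> x c"
    by simp
  also have "\<dots> = inv_ar V (lunit V (x \<otimes> c)) \<cdot> lunit V (x \<otimes> c) \<cdot> \<alpha> \<I> x c"
    by (simp add: inv_ar_simps(7))
  finally show ?thesis
    by (simp add: lunit_tensor)
qed

text \<open>Here \<I> is moved past c, in the other direction than in
  \<open>interchange_lunit\<close>, and the crossing is removed by
  \<open>runit_braid\<close>.\<close>

lemma interchange_runit:
  assumes [simp]: "x \<in> ob V" "c \<in> ob V"
  shows "((x \<otimes> c) \<lhd> lunit V \<I>) \<cdot> interchange V x \<I> c \<I> \<cdot> ((x \<otimes> \<I>) \<lhd> inv_ar V (runit V c)) =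
    inv_ar V (runit V (x \<otimes> c)) \<cdot> (runit V x \<rhd> c)"
proof -
  have "(c \<lhd> lunit V \<I>) \<cdot> swap \<I> c \<I> = lunit V (c \<otimes> \<I>)"
  proof (rule iso_epi)
    show "is_iso V (\<alpha> \<I> c \<I>)" by simp
    show "((c \<lhd> lunit V \<I>) \<cdot> swap \<I> c \<I>) \<cdot> \<alpha> \<I> c \<I> = lunit V (c \<otimes> \<I>) \<cdot> \<alpha> \<I> c \<I>"
      by (simp add: swap_assoc triangle_tail runit_braid lunit_tensor)
  qed simp_all
  note s = this
  have t: "((x \<otimes> c) \<lhd> lunit V \<I>) \<cdot> \<alpha>' x c (\<I> \<otimes> \<I>) = \<alpha>' x c \<I> \<cdot> (x \<lhd> (c \<lhd> lunit V \<I>))"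
  proof (rule iso_mono)
    show "is_iso V (\<alpha> x c \<I>)" by simp
    show "\<alpha> x c \<I> \<cdot> ((x \<otimes> c) \<lhd> lunit V \<I>) \<cdot> \<alpha>' x c (\<I> \<otimes> \<I>) =
        \<alpha> x c \<I> \<cdot> \<alpha>' x c \<I> \<cdot> (x \<lhd> (c \<lhd> lunit V \<I>))"
      using cmp_tail[OF assoc_nat[of "idn V x" "idn V c" "lunit V \<I>" x c \<I>], of "\<alpha>' x c (\<I> \<otimes> \<I>)"] by simp
  qed simp_all
  have u: "\<alpha>' x c \<I> \<cdot> (x \<lhd> inv_ar V (runit V c)) = inv_ar V (runit V (x \<otimes> c))"
  proof (rule iso_mono)
    show "is_iso V (runit V (x \<otimes> c))" by simp
    show "runit V (x \<otimes> c) \<cdot> \<alpha>' x c \<I> \<cdot> (x \<lhd> inv_ar V (runit V c)) =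
        runit V (x \<otimes> c) \<cdot> inv_ar V (runit V (x \<otimes> c))"
      by (simp add: runit_tensor[symmetric])
        (simp add: runit_tensor)
  qed simp_all
  let ?r = "(x \<otimes> \<I>) \<lhd> inv_ar V (runit V c)"
  have "((x \<otimes> c) \<lhd> lunit V \<I>) \<cdot> interchange V x \<I> c \<I> \<cdot> ?r =
      \<alpha>' x c \<I> \<cdot> (x \<lhd> ((c \<lhd> lunit V \<I>) \<cdot> swap \<I> c \<I>)) \<cdot> \<alpha> x \<I> (c \<otimes> \<I>) \<cdot> ?r"
    using cmp_tail[OF t, of "(x \<lhd> swap \<I> c \<I>) \<cdot> \<alpha> x \<I> (c \<otimes> \<I>) \<cdot> ?r"]
    by (simp add: interchange_swap)
  also have "\<dots> = \<alpha>' x c \<I> \<cdot> (x \<lhd> inv_ar V (runit V c)) \<cdot> (runit V x \<rhd> c)"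
    unfolding s by (simp add: triangle_tail)
  also have "\<dots> = inv_ar V (runit V (x \<otimes> c)) \<cdot> (runit V x \<rhd> c)"
    using cmp_tail[OF u, of "runit V x \<rhd> c"] by simp
  finally show ?thesis .
qed

end

section \<open>Categories of monoids and comonoids\<close>

lemma category_opcat:
  assumes "category C"
  shows "category (opcat C)"
proof -
  interpret category C by fact
  show ?thesis
    by unfold_locales (auto simp: opcat_def homset_def src_ob tgt_ob)
qed

lemma homset_opcat: "homset (opcat C) x y = homset C y x"
  by (auto simp: opcat_def homset_def)

lemma (in category) category_structured_cat:
  assumes P: "\<And>M. P M \<Longrightarrow> fst M \<in> ob C"
    and H: "\<And>M N f. H M N f \<Longrightarrow> f \<in> homset C (fst M) (fst N)"
    and H_idn: "\<And>M. P M \<Longrightarrow> H M M (idn C (fst M))"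
    and H_cmp: "\<And>M N L f g. P M \<Longrightarrow> P N \<Longrightarrow> P L \<Longrightarrow> H M N f \<Longrightarrow> H N L g \<Longrightarrow> H M L (g \<cdot> f)"
  shows "category (structured_cat C P H)"
proof unfold_locales
  let ?S = "structured_cat C P H"
  have hom: "homset ?S M N = {(M, N, f) |f. P M \<and> P N \<and> H M N f}" for M N
    by (auto simp: structured_cat_def homset_def)
  fix M N L K f g h
  show "f \<in> ar ?S \<Longrightarrow> src ?S f \<in> ob ?S" "f \<in> ar ?S \<Longrightarrow> tgt ?S f \<in> ob ?S"
    by (auto simp: structured_cat_def)
  show "M \<in> ob ?S \<Longrightarrow> idn ?S M \<in> homset ?S M M"
    unfolding hom using H_idn by (auto simp: structured_cat_def)
  show "f \<in> homset ?S M N \<Longrightarrow> g \<in> homset ?S N L \<Longrightarrow> g \<cdot>\<^bsub>?S\<^esub> f \<in> homset ?S M L"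
    unfolding hom by (auto simp: structured_cat_def intro: H_cmp)
  show "f \<in> homset ?S M N \<Longrightarrow> idn ?S N \<cdot>\<^bsub>?S\<^esub> f = f"
    unfolding hom by (auto simp: structured_cat_def intro: idn_left[OF H])
  show "f \<in> homset ?S M N \<Longrightarrow> f \<cdot>\<^bsub>?S\<^esub> idn ?S M = f"
    unfolding hom by (auto simp: structured_cat_def intro: idn_right[OF H])
  show "f \<in> homset ?S M N \<Longrightarrow> g \<in> homset ?S N L \<Longrightarrow> h \<in> homset ?S L K \<Longrightarrow>
      (h \<cdot>\<^bsub>?S\<^esub> g) \<cdot>\<^bsub>?S\<^esub> f = h \<cdot>\<^bsub>?S\<^esub> g \<cdot>\<^bsub>?S\<^esub> f"
    unfolding hom by (auto simp: structured_cat_def intro: cmp_assoc[OF H H H])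
qed

context monoidal_category
begin

lemma monoidD:
  assumes "is_monoid V (b, m, i)"
  shows "b \<in> ob V" "m \<in> ar V" "src V m = b \<otimes> b" "tgt V m = b" "i \<in> ar V" "src V i = \<I>" "tgt V i = b"
    "m \<cdot> (m \<rhd> b) = m \<cdot> (b \<lhd> m) \<cdot> \<alpha> b b b"
    "m \<cdot> (i \<rhd> b) = lunit V b" "m \<cdot> (b \<lhd> i) = runit V b"
  using assms by (auto simp: is_monoid_def homset_def)

lemma monoidI:
  assumes "b \<in> ob V" "m \<in> ar V" "src V m = b \<otimes> b" "tgt V m = b" "i \<in> ar V" "src V i = \<I>" "tgt V i = b"
    "m \<cdot> (m \<rhd> b) = m \<cdot> (b \<lhd> m) \<cdot> \<alpha> b b b"
    "m \<cdot> (i \<rhd> b) = lunit V b" "m \<cdot> (b \<lhd> i) = runit V b"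
  shows "is_monoid V (b, m, i)"
  using assms by (auto simp: is_monoid_def homset_def)

lemma comonoidD:
  assumes "is_comonoid V (c, d, e)"
  shows "c \<in> ob V" "d \<in> ar V" "src V d = c" "tgt V d = c \<otimes> c" "e \<in> ar V" "src V e = c" "tgt V e = \<I>"
    "\<alpha> c c c \<cdot> (d \<rhd> c) \<cdot> d = (c \<lhd> d) \<cdot> d"
    "lunit V c \<cdot> (e \<rhd> c) \<cdot> d = idn V c" "runit V c \<cdot> (c \<lhd> e) \<cdot> d = idn V c"
  using assms by (auto simp: is_comonoid_def homset_def)

lemma comonoidI:
  assumes "c \<in> ob V" "d \<in> ar V" "src V d = c" "tgt V d = c \<otimes> c" "e \<in> ar V" "src V e = c" "tgt V e = \<I>"
    "\<alpha> c c c \<cdot> (d \<rhd> c) \<cdot> d = (c \<lhd> d) \<cdot> d"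
    "lunit V c \<cdot> (e \<rhd> c) \<cdot> d = idn V c" "runit V c \<cdot> (c \<lhd> e) \<cdot> d = idn V c"
  shows "is_comonoid V (c, d, e)"
  using assms by (auto simp: is_comonoid_def homset_def)

lemma comonoid_homD:
  assumes "is_comonoid_hom V (c, d, e) (c', d', e') h"
  shows "h \<in> ar V" "src V h = c" "tgt V h = c'" "d' \<cdot> h = (h \<boxtimes> h) \<cdot> d" "e' \<cdot> h = e"
  using assms by (auto simp: is_comonoid_hom_def homset_def)

lemma comonoid_homI:
  assumes "h \<in> ar V" "src V h = c" "tgt V h = c'" "d' \<cdot> h = (h \<boxtimes> h) \<cdot> d" "e' \<cdot> h = e"
  shows "is_comonoid_hom V (c, d, e) (c', d', e') h"
  using assms by (auto simp: is_comonoid_hom_def homset_def)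

lemma comonoid_hom_cmp:
  assumes "is_comonoid V (c, d, e)" "is_comonoid V (c', d', e')" "is_comonoid V (c'', d'', e'')"
    and f: "is_comonoid_hom V (c, d, e) (c', d', e') f"
    and g: "is_comonoid_hom V (c', d', e') (c'', d'', e'') g"
  shows "is_comonoid_hom V (c, d, e) (c'', d'', e'') (g \<cdot> f)"
proof (rule comonoid_homI)
  note [simp] = comonoidD(1-7)[OF assms(1)] comonoidD(1-7)[OF assms(2)] comonoidD(1-7)[OF assms(3)]
    comonoid_homD(1-3)[OF f] comonoid_homD(1-3)[OF g]
  show "d'' \<cdot> g \<cdot> f = ((g \<cdot> f) \<boxtimes> (g \<cdot> f)) \<cdot> d"
    using cmp_tail[OF comonoid_homD(4)[OF g], of f] comonoid_homD(4)[OF f] by simp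
  show "e'' \<cdot> g \<cdot> f = e"
    using cmp_tail[OF comonoid_homD(5)[OF g], of f] comonoid_homD(5)[OF f] by simp
qed (use comonoid_homD[OF f] comonoid_homD[OF g] in simp_all)

lemma category_Mon: "category (Mon V)"
  unfolding Mon_def
proof (rule category_structured_cat)
  fix M N L f g assume M: "is_monoid V M" "is_monoid V N" "is_monoid V L"
    and h: "is_monoid_hom V M N f" "is_monoid_hom V N L g"
  obtain a ma ia b mb ib c mc ic where e: "M = (a, ma, ia)" "N = (b, mb, ib)" "L = (c, mc, ic)"
    by (metis prod_cases3)
  note [simp] = monoidD(1-7)[OF M(1)[unfolded e]] monoidD(1-7)[OF M(2)[unfolded e]]
    monoidD(1-7)[OF M(3)[unfolded e]]
  have f: "f \<in> ar V" "src V f = a" "tgt V f = b" "f \<cdot> ma = mb \<cdot> (f \<boxtimes> f)" "f \<cdot> ia = ib"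
    and g: "g \<in> ar V" "src V g = b" "tgt V g = c" "g \<cdot> mb = mc \<cdot> (g \<boxtimes> g)" "g \<cdot> ib = ic"
    using h by (auto simp: e is_monoid_hom_def homset_def)
  show "is_monoid_hom V M L (g \<cdot> f)"
    using f g cmp_tail[OF g(4), of "f \<boxtimes> f"] by (simp add: e is_monoid_hom_def homset_def)
qed (auto simp: is_monoid_def is_monoid_hom_def homset_def)

lemma category_Comon: "category (Comon V)"
  unfolding Comon_def
proof (rule category_structured_cat)
  fix M N L f g assume M: "is_comonoid V M" "is_comonoid V N" "is_comonoid V L"
    and h: "is_comonoid_hom V M N f" "is_comonoid_hom V N L g"
  then show "is_comonoid_hom V M L (g \<cdot> f)"
    using comonoid_hom_cmp by (metis prod_cases3)
qed (auto simp: is_comonoid_def is_comonoid_hom_def homset_def)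

end

section \<open>Convolution\<close>

context braided_monoidal_category
begin

text \<open>The convolution product of generalized elements f : x \<otimes> c \<rightarrow> b and g
  : y \<otimes> c \<rightarrow> b. The multiplication of [c, b] is the transpose of the case where
  both are the evaluation. With varying x and y, the monoid laws become statements that involve no
  internal hom.\<close>

definition conv where
  "conv m d c x y f g = m \<cdot> (f \<boxtimes> g) \<cdot> interchange V x y c c \<cdot> ((x \<otimes> y) \<lhd> d)"

context
  fixes b m i c d e
  assumes monoid: "is_monoid V (b, m, i)" and comonoid: "is_comonoid V (c, d, e)"
begin

private lemmas [simp] = monoidD(1-7)[OF monoid] comonoidD(1-7)[OF comonoid]

lemma conv_ar:
  assumes "x \<in> ob V" "y \<in> ob V"
    and "f \<in> ar V" "src V f = x \<otimes> c" "tgt V f = b" "g \<in> ar V" "src V g = y \<otimes> c" "tgt V g = b"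
  shows "conv m d c x y f g \<in> ar V" "src V (conv m d c x y f g) = (x \<otimes> y) \<otimes> c"
    "tgt V (conv m d c x y f g) = b"
  using assms by (simp_all add: conv_def)

lemma conv_nat:
  assumes f: "f \<in> ar V" "src V f = x \<otimes> c" "tgt V f = b" and g: "g \<in> ar V" "src V g = y \<otimes> c" "tgt V g = b"
    and u: "u \<in> ar V" "src V u = x'" "tgt V u = x" and v: "v \<in> ar V" "src V v = y'" "tgt V v = y"
  shows "conv m d c x y f g \<cdot> ((u \<boxtimes> v) \<rhd> c) =
    conv m d c x' y' (f \<cdot> (u \<rhd> c)) (g \<cdot> (v \<rhd> c))"
proof -
  have [simp]: "x \<in> ob V" "y \<in> ob V" "x' \<in> ob V" "y' \<in> ob V"
    using u v src_ob tgt_ob by auto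
  note [simp] = f g u v
  have "conv m d c x y f g \<cdot> ((u \<boxtimes> v) \<rhd> c) =
      m \<cdot> (f \<boxtimes> g) \<cdot> interchange V x y c c \<cdot> ((u \<boxtimes> v) \<boxtimes> (c \<lhd> idn V c)) \<cdot> ((x' \<otimes> y') \<lhd> d)"
    by (simp add: conv_def)
  also have "\<dots> = m \<cdot> (f \<boxtimes> g) \<cdot> ((u \<rhd> c) \<boxtimes> (v \<rhd> c)) \<cdot> interchange V x' y' c c \<cdot> ((x' \<otimes> y') \<lhd> d)"
    using cmp_tail[OF interchange_nat[of u v "idn V c" "idn V c" x y c c], of "(x' \<otimes> y') \<lhd> d"]
    by (simp del: tensor_cmp tensor_cmp_tail tensor_idn)
  finally show ?thesis by (simp add: conv_def)
qed

text \<open>By the counit law, \<open>(e \<rhd> c) \<cdot> d\<close> is the inverse of the left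
  unitor. The interchange carries this inverse over to x \<otimes> c, where the unit law of
  \<open>b\<close> consumes it.\<close>

lemma conv_lunit:
  assumes f: "f \<in> ar V" "src V f = x \<otimes> c" "tgt V f = b" and [simp]: "x \<in> ob V"
  shows "conv m d c \<I> x (i \<cdot> e \<cdot> lunit V c) f = f \<cdot> (lunit V x \<rhd> c)"
proof -
  note [simp] = f
  have el: "e \<cdot> lunit V c = lunit V \<I> \<cdot> (\<I> \<lhd> e)"
    by (simp add: lunit_nat)
  have ed: "(e \<rhd> c) \<cdot> d = inv_ar V (lunit V c)"
    by (rule iso_mono[of "lunit V c"]) (simp_all add: comonoidD(9)[OF comonoid])
  have "conv m d c \<I> x (i \<cdot> e \<cdot> lunit V c) f =
      m \<cdot> (i \<boxtimes> f) \<cdot> (lunit V \<I> \<rhd> (x \<otimes> c)) \<cdot> ((\<I> \<lhd> e) \<boxtimes> (x \<lhd> idn V c)) \<cdot> interchange V \<I> x c c \<cdot>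
        ((\<I> \<otimes> x) \<lhd> d)"
    by (simp add: conv_def el)
  also have "\<dots> = m \<cdot> (i \<boxtimes> f) \<cdot> (lunit V \<I> \<rhd> (x \<otimes> c)) \<cdot> interchange V \<I> x \<I> c \<cdot>
        ((\<I> \<otimes> x) \<lhd> inv_ar V (lunit V c))"
    using cmp_tail[OF interchange_nat[of "idn V \<I>" "idn V x" e "idn V c" \<I> x \<I> c], of "(\<I> \<otimes> x) \<lhd> d"]
    by (simp add: ed[symmetric] del: tensor_cmp_tail)
  also have "\<dots> = m \<cdot> (i \<boxtimes> f) \<cdot> inv_ar V (lunit V (x \<otimes> c)) \<cdot> (lunit V x \<rhd> c)"
    by (simp add: interchange_lunit)
  also have "\<dots> = m \<cdot> (i \<rhd> b) \<cdot> (\<I> \<lhd> f) \<cdot> inv_ar V (lunit V (x \<otimes> c)) \<cdot> (lunit V x \<rhd> c)"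
    by simp
  also have "\<dots> = lunit V b \<cdot> (\<I> \<lhd> f) \<cdot> inv_ar V (lunit V (x \<otimes> c)) \<cdot> (lunit V x \<rhd> c)"
    using cmp_tail[OF monoidD(9)[OF monoid],
        of "(\<I> \<lhd> f) \<cdot> inv_ar V (lunit V (x \<otimes> c)) \<cdot> (lunit V x \<rhd> c)"] by simp
  also have "\<dots> = f \<cdot> lunit V (x \<otimes> c) \<cdot> inv_ar V (lunit V (x \<otimes> c)) \<cdot> (lunit V x \<rhd> c)"
    using cmp_tail[OF lunit_nat[of f b], of "inv_ar V (lunit V (x \<otimes> c)) \<cdot> (lunit V x \<rhd> c)"] by simp
  finally show ?thesis
    by (simp add: inv_ar_simps(8))
qed

lemma conv_runit:
  assumes f: "f \<in> ar V" "src V f = x \<otimes> c" "tgt V f = b" and [simp]: "x \<in> ob V"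
  shows "conv m d c x \<I> f (i \<cdot> e \<cdot> lunit V c) = f \<cdot> (runit V x \<rhd> c)"
proof -
  note [simp] = f
  have el: "e \<cdot> lunit V c = lunit V \<I> \<cdot> (\<I> \<lhd> e)"
    by (simp add: lunit_nat)
  have ed: "(c \<lhd> e) \<cdot> d = inv_ar V (runit V c)"
    by (rule iso_mono[of "runit V c"]) (simp_all add: comonoidD(10)[OF comonoid])
  have "conv m d c x \<I> f (i \<cdot> e \<cdot> lunit V c) =
      m \<cdot> (f \<boxtimes> i) \<cdot> ((x \<otimes> c) \<lhd> lunit V \<I>) \<cdot> ((x \<lhd> idn V c) \<boxtimes> (\<I> \<lhd> e)) \<cdot> interchange V x \<I> c c \<cdot>
        ((x \<otimes> \<I>) \<lhd> d)"
    by (simp add: conv_def el)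
  also have "\<dots> = m \<cdot> (f \<boxtimes> i) \<cdot> ((x \<otimes> c) \<lhd> lunit V \<I>) \<cdot> interchange V x \<I> c \<I> \<cdot>
        ((x \<otimes> \<I>) \<lhd> inv_ar V (runit V c))"
    using cmp_tail[OF interchange_nat[of "idn V x" "idn V \<I>" "idn V c" e x \<I> c \<I>], of "(x \<otimes> \<I>) \<lhd> d"]
    by (simp add: ed[symmetric] del: tensor_cmp_tail)
  also have "\<dots> = m \<cdot> (f \<boxtimes> i) \<cdot> inv_ar V (runit V (x \<otimes> c)) \<cdot> (runit V x \<rhd> c)"
    by (simp add: interchange_runit)
  also have "\<dots> = m \<cdot> (b \<lhd> i) \<cdot> (f \<rhd> \<I>) \<cdot> inv_ar V (runit V (x \<otimes> c)) \<cdot> (runit V x \<rhd> c)"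
    by simp
  also have "\<dots> = runit V b \<cdot> (f \<rhd> \<I>) \<cdot> inv_ar V (runit V (x \<otimes> c)) \<cdot> (runit V x \<rhd> c)"
    using cmp_tail[OF monoidD(10)[OF monoid],
        of "(f \<rhd> \<I>) \<cdot> inv_ar V (runit V (x \<otimes> c)) \<cdot> (runit V x \<rhd> c)"] by simp
  also have "\<dots> = f \<cdot> runit V (x \<otimes> c) \<cdot> inv_ar V (runit V (x \<otimes> c)) \<cdot> (runit V x \<rhd> c)"
    using cmp_tail[OF runit_nat[of f b], of "inv_ar V (runit V (x \<otimes> c)) \<cdot> (runit V x \<rhd> c)"] by simp
  finally show ?thesis
    by (simp add: inv_ar_simps(8))
qed

text \<open>Associativity of \<open>m\<close> acts at the target end, coassociativity of
  \<open>d\<close> at the source end, and \<open>interchange_assoc\<close> with all three comonoid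
  factors equal to \<open>c\<close> connects the two.\<close>

lemma conv_assoc:
  assumes f: "f \<in> ar V" "src V f = x \<otimes> c" "tgt V f = b" and g: "g \<in> ar V" "src V g = y \<otimes> c" "tgt V g = b"
    and h: "h \<in> ar V" "src V h = z \<otimes> c" "tgt V h = b"
    and [simp]: "x \<in> ob V" "y \<in> ob V" "z \<in> ob V"
  shows "conv m d c (x \<otimes> y) z (conv m d c x y f g) h =
    conv m d c x (y \<otimes> z) f (conv m d c y z g h) \<cdot> (\<alpha> x y z \<rhd> c)"
proof -
  note [simp] = f g h
  let ?d = "((x \<otimes> y) \<otimes> z) \<lhd> d"
  let ?r = "interchange V (x \<otimes> y) z (c \<otimes> c) c \<cdot> (((x \<otimes> y) \<otimes> z) \<lhd> ((d \<rhd> c) \<cdot> d))"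
  let ?r' = "((x \<otimes> c) \<lhd> interchange V y z c c) \<cdot> interchange V x (y \<otimes> z) c (c \<otimes> c) \<cdot>
      (\<alpha> x y z \<boxtimes> ((c \<lhd> d) \<cdot> d))"
  have "conv m d c (x \<otimes> y) z (conv m d c x y f g) h =
      m \<cdot> (m \<rhd> b) \<cdot> ((f \<boxtimes> g) \<boxtimes> h) \<cdot> (interchange V x y c c \<rhd> (z \<otimes> c)) \<cdot>
        (((x \<otimes> y) \<lhd> d) \<boxtimes> (z \<lhd> idn V c)) \<cdot> interchange V (x \<otimes> y) z c c \<cdot> ?d"
    by (simp add: conv_def)
  also have "\<dots> = m \<cdot> (m \<rhd> b) \<cdot> ((f \<boxtimes> g) \<boxtimes> h) \<cdot> (interchange V x y c c \<rhd> (z \<otimes> c)) \<cdot> ?r"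
    using cmp_tail[OF interchange_nat[of "idn V (x \<otimes> y)" "idn V z" d "idn V c" "x \<otimes> y" z "c \<otimes> c" c], of ?d]
    by simp
  also have "\<dots> = m \<cdot> (b \<lhd> m) \<cdot> \<alpha> b b b \<cdot> ((f \<boxtimes> g) \<boxtimes> h) \<cdot> (interchange V x y c c \<rhd> (z \<otimes> c)) \<cdot> ?r"
    using cmp_tail[OF monoidD(8)[OF monoid],
        of "((f \<boxtimes> g) \<boxtimes> h) \<cdot> (interchange V x y c c \<rhd> (z \<otimes> c)) \<cdot> ?r"]
    by (simp del: tensor_cmp tensor_cmp_tail)
  also have "\<dots> = m \<cdot> (b \<lhd> m) \<cdot> (f \<boxtimes> (g \<boxtimes> h)) \<cdot> \<alpha> (x \<otimes> c) (y \<otimes> c) (z \<otimes> c) \<cdot>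
      (interchange V x y c c \<rhd> (z \<otimes> c)) \<cdot> ?r"
    using cmp_tail[OF assoc_nat[of f g h b b b],
        of "(interchange V x y c c \<rhd> (z \<otimes> c)) \<cdot> ?r"]
    by (simp del: tensor_cmp tensor_cmp_tail)
  also have "\<alpha> (x \<otimes> c) (y \<otimes> c) (z \<otimes> c) \<cdot> (interchange V x y c c \<rhd> (z \<otimes> c)) \<cdot> ?r =
      ((x \<otimes> c) \<lhd> interchange V y z c c) \<cdot> interchange V x (y \<otimes> z) c (c \<otimes> c) \<cdot>
      (\<alpha> x y z \<boxtimes> \<alpha> c c c) \<cdot> (((x \<otimes> y) \<otimes> z) \<lhd> ((d \<rhd> c) \<cdot> d))"
    using cmp_tail[OF interchange_assoc[of x y z c c c],
        of "((x \<otimes> y) \<otimes> z) \<lhd> ((d \<rhd> c) \<cdot> d)"]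
    by (simp del: tensor_cmp tensor_cmp_tail)
  also have "\<dots> = ?r'"
    by (simp add: comonoidD(8)[OF comonoid])
  also have "m \<cdot> (b \<lhd> m) \<cdot> (f \<boxtimes> (g \<boxtimes> h)) \<cdot> ?r' =
      m \<cdot> (f \<boxtimes> (m \<cdot> (g \<boxtimes> h) \<cdot> interchange V y z c c)) \<cdot>
       interchange V x (y \<otimes> z) c (c \<otimes> c) \<cdot> ((x \<lhd> idn V (y \<otimes> z)) \<boxtimes> (c \<lhd> d)) \<cdot> (\<alpha> x y z \<boxtimes> d)"
    by simp
  also have "\<dots> = m \<cdot> (f \<boxtimes> (m \<cdot> (g \<boxtimes> h) \<cdot> interchange V y z c c)) \<cdot>
       ((x \<lhd> idn V c) \<boxtimes> ((y \<otimes> z) \<lhd> d)) \<cdot> interchange V x (y \<otimes> z) c c \<cdot> (\<alpha> x y z \<boxtimes> d)"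
    using cmp_tail[OF interchange_nat[of "idn V x" "idn V (y \<otimes> z)" "idn V c" d x "y \<otimes> z" c "c \<otimes> c"],
        of "\<alpha> x y z \<boxtimes> d"]
    by (simp del: tensor_cmp tensor_cmp_tail tensor_idn)
  also have "\<dots> = conv m d c x (y \<otimes> z) f (conv m d c y z g h) \<cdot> (\<alpha> x y z \<rhd> c)"
    by (simp add: conv_def)
  finally show ?thesis .
qed

end

section \<open>Measurings and their restriction along comonoid morphisms\<close>

lemma conv_comonoid_hom:
  assumes M: "is_monoid V (b, m, i)" and C: "is_comonoid V (c, d, e)" and C': "is_comonoid V (c', d', e')"
    and k: "is_comonoid_hom V (c', d', e') (c, d, e) k"
    and f: "f \<in> ar V" "src V f = x \<otimes> c" "tgt V f = b" and g: "g \<in> ar V" "src V g = y \<otimes> c" "tgt V g = b"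
    and [simp]: "x \<in> ob V" "y \<in> ob V"
  shows "conv m d c x y f g \<cdot> ((x \<otimes> y) \<lhd> k) =
    conv m d' c' x y (f \<cdot> (x \<lhd> k)) (g \<cdot> (y \<lhd> k))"
proof -
  note [simp] = f g monoidD(1-7)[OF M] comonoidD(1-7)[OF C] comonoidD(1-7)[OF C'] comonoid_homD(1-3)[OF k]
  have "conv m d c x y f g \<cdot> ((x \<otimes> y) \<lhd> k) =
      m \<cdot> (f \<boxtimes> g) \<cdot> interchange V x y c c \<cdot> ((x \<lhd> idn V y) \<boxtimes> (k \<boxtimes> k)) \<cdot> ((x \<otimes> y) \<lhd> d')"
    by (simp add: conv_def comonoid_homD(4)[OF k])
  also have "\<dots> = m \<cdot> (f \<boxtimes> g) \<cdot> ((x \<lhd> k) \<boxtimes> (y \<lhd> k)) \<cdot> interchange V x y c' c' \<cdot> ((x \<otimes> y) \<lhd> d')"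
    using cmp_tail[OF interchange_nat[of "idn V x" "idn V y" k k x y c c], of "(x \<otimes> y) \<lhd> d'"]
    by (simp del: tensor_cmp tensor_cmp_tail tensor_idn)
  finally show ?thesis by (simp add: conv_def)
qed

text \<open>Measurings in the sense of Sweedler. They are monoid morphisms a \<rightarrow> [c, b]
  written without the internal hom, with \<open>c\<close> occurring as a tensor factor of a source;
  in this form they can be glued along colimits in \<open>c\<close>.\<close>

definition measuring where
  "measuring A B C f \<longleftrightarrow> (case A of (a, ma, ia) \<Rightarrow> case B of (b, m, i) \<Rightarrow> case C of (c, d, e) \<Rightarrow>
    f \<in> homset V (a \<otimes> c) b \<and> f \<cdot> (ma \<rhd> c) = conv m d c a a f f \<and>
    f \<cdot> (ia \<rhd> c) = i \<cdot> e \<cdot> lunit V c)"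

lemma measuringD:
  assumes "measuring (a, ma, ia) (b, m, i) (c, d, e) f"
  shows "f \<in> ar V" "src V f = a \<otimes> c" "tgt V f = b" "f \<cdot> (ma \<rhd> c) = conv m d c a a f f"
    "f \<cdot> (ia \<rhd> c) = i \<cdot> e \<cdot> lunit V c"
  using assms by (auto simp: measuring_def homset_def)

lemma measuringI:
  assumes "f \<in> ar V" "src V f = a \<otimes> c" "tgt V f = b" "f \<cdot> (ma \<rhd> c) = conv m d c a a f f"
    "f \<cdot> (ia \<rhd> c) = i \<cdot> e \<cdot> lunit V c"
  shows "measuring (a, ma, ia) (b, m, i) (c, d, e) f"
  using assms by (auto simp: measuring_def homset_def)

lemma measuring_comonoid_hom:
  assumes A: "is_monoid V (a, ma, ia)" and B: "is_monoid V (b, m, i)"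
    and C: "is_comonoid V (c, d, e)" and C': "is_comonoid V (c', d', e')"
    and k: "is_comonoid_hom V (c', d', e') (c, d, e) k"
    and f: "measuring (a, ma, ia) (b, m, i) (c, d, e) f"
  shows "measuring (a, ma, ia) (b, m, i) (c', d', e') (f \<cdot> (a \<lhd> k))"
proof (rule measuringI)
  note [simp] = measuringD(1-3)[OF f] monoidD(1-7)[OF A] monoidD(1-7)[OF B] comonoidD(1-7)[OF C] 
    comonoidD(1-7)[OF C'] comonoid_homD(1-3)[OF k]
  have "(f \<cdot> (a \<lhd> k)) \<cdot> (ma \<rhd> c') = f \<cdot> (ma \<rhd> c) \<cdot> ((a \<otimes> a) \<lhd> k)"
    by simp
  also have "\<dots> = conv m d c a a f f \<cdot> ((a \<otimes> a) \<lhd> k)"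
    using cmp_tail[OF measuringD(4)[OF f], of "(a \<otimes> a) \<lhd> k"] by simp
  also have "\<dots> = conv m d' c' a a (f \<cdot> (a \<lhd> k)) (f \<cdot> (a \<lhd> k))"
    by (rule conv_comonoid_hom[OF B C C' k]) simp_all
  finally show "(f \<cdot> (a \<lhd> k)) \<cdot> (ma \<rhd> c') = \<dots>" .
  have "(f \<cdot> (a \<lhd> k)) \<cdot> (ia \<rhd> c') = f \<cdot> (ia \<rhd> c) \<cdot> (\<I> \<lhd> k)"
    by simp
  also have "\<dots> = i \<cdot> e \<cdot> lunit V c \<cdot> (\<I> \<lhd> k)"
    using cmp_tail[OF measuringD(5)[OF f], of "\<I> \<lhd> k"] by simp
  also have "\<dots> = i \<cdot> e' \<cdot> lunit V c'"
    using cmp_tail[OF comonoid_homD(5)[OF k], of "lunit V c'"] by (simp add: lunit_nat)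
  finally show "(f \<cdot> (a \<lhd> k)) \<cdot> (ia \<rhd> c') = i \<cdot> e' \<cdot> lunit V c'" .
qed (use measuringD[OF f] comonoid_homD[OF k] comonoidD[OF C'] comonoidD[OF C] monoidD[OF A] in simp_all)

end

section \<open>Evaluation, transposition and the convolution monoid\<close>

context braided_monoidal_closed_category
begin

abbreviation "hm x y \<equiv> omap (ihom V x) y"

context
  fixes x assumes x: "x \<in> ob V"
begin

private lemmas adj = closed[OF x, unfolded adjunction_def]

lemma hm_ob [simp]: "y \<in> ob V \<Longrightarrow> hm x y \<in> ob V"
  using adj by (auto simp: is_functor_def)

lemma transp_bij:
  assumes "a \<in> ob V" "y \<in> ob V"
  shows "bij_betw (transp V x a y) (homset V (a \<otimes> x) y) (homset V a (hm x y))"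
  using adj assms by (auto simp: tensor_right_def)

lemma transp_ar [simp]:
  assumes "a \<in> ob V" "f \<in> ar V" "src V f = a \<otimes> x" "tgt V f = y"
  shows "transp V x a y f \<in> ar V" "src V (transp V x a y f) = a" "tgt V (transp V x a y f) = hm x y"
proof -
  have "transp V x a y f \<in> homset V a (hm x y)"
    using transp_bij[of a y] assms tgt_ob by (auto simp: bij_betw_def homset_def)
  then show "transp V x a y f \<in> ar V" "src V (transp V x a y f) = a" "tgt V (transp V x a y f) = hm x y"
    by (auto simp: homset_def)
qed

lemma ev_ar [simp]:
  assumes "y \<in> ob V"
  shows "ev V x y \<in> ar V" "src V (ev V x y) = hm x y \<otimes> x" "tgt V (ev V x y) = y"
proof -
  have "idn V (hm x y) \<in> transp V x (hm x y) y ` homset V (hm x y \<otimes> x) y"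
    using transp_bij[of "hm x y" y] assms by (simp add: bij_betw_def idn_hom)
  then have "ev V x y \<in> homset V (hm x y \<otimes> x) y"
    unfolding ev_def by (rule inv_into_into)
  then show "ev V x y \<in> ar V" "src V (ev V x y) = hm x y \<otimes> x" "tgt V (ev V x y) = y"
    by (auto simp: homset_def)
qed

text \<open>Since \<open>ev\<close> is the preimage of the identity, naturality of the adjunction
  along \<open>g\<close> shows that evaluating is inverse to transposing.\<close>

lemma transp_ev:
  assumes y: "y \<in> ob V" and g: "g \<in> ar V" "tgt V g = hm x y" "src V g = a"
  shows "transp V x a y (ev V x y \<cdot> (g \<rhd> x)) = g"
proof -
  have a: "a \<in> ob V" using src_ob[OF g(1)] g(3) by simp
  have "idn V (hm x y) \<in> transp V x (hm x y) y ` homset V (hm x y \<otimes> x) y"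
    using transp_bij[of "hm x y" y] y by (simp add: bij_betw_def idn_hom)
  then have ev: "transp V x (hm x y) y (ev V x y) = idn V (hm x y)"
    unfolding ev_def by (rule f_inv_into_f)
  have nat: "\<forall>h\<in>homset V a (hm x y). \<forall>g'\<in>homset V (hm x y \<otimes> x) y. \<forall>k\<in>homset V y y.
      transp V x a y (k \<cdot> g' \<cdot> (h \<rhd> x)) = amap (ihom V x) k \<cdot> transp V x (hm x y) y g' \<cdot> h"
    using adj a y by (auto simp: tensor_right_def)
  have "transp V x a y (idn V y \<cdot> ev V x y \<cdot> (g \<rhd> x)) =
      amap (ihom V x) (idn V y) \<cdot> transp V x (hm x y) y (ev V x y) \<cdot> g"
    using g y x by (intro nat[rule_format]) (auto simp: homset_def)
  moreover have "amap (ihom V x) (idn V y) = idn V (hm x y)"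
    using adj y by (auto simp: is_functor_def)
  ultimately show ?thesis
    using g y x by (simp add: ev)
qed

lemma ev_transp:
  assumes a: "a \<in> ob V" and f: "f \<in> ar V" "src V f = a \<otimes> x" "tgt V f = y"
  shows "ev V x y \<cdot> (transp V x a y f \<rhd> x) = f"
proof -
  have y: "y \<in> ob V" using tgt_ob[OF f(1)] f(3) by simp
  have "inj_on (transp V x a y) (homset V (a \<otimes> x) y)"
    using transp_bij[OF a y] by (simp add: bij_betw_def)
  moreover have "transp V x a y (ev V x y \<cdot> (transp V x a y f \<rhd> x)) = transp V x a y f"
    using a f y by (intro transp_ev) simp_all
  ultimately show ?thesis
    using a f y x by (auto simp: homset_def dest!: inj_onD)
qed

text \<open>Arrows into [x, y] are determined by their evaluations. All equations between such
  arrows below are proved through this lemma.\<close>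

lemma ev_cancel:
  assumes eq: "ev V x y \<cdot> (f \<rhd> x) = ev V x y \<cdot> (g \<rhd> x)" and y: "y \<in> ob V"
    and f: "f \<in> ar V" "tgt V f = hm x y" and g: "g \<in> ar V" "tgt V g = hm x y" "src V f = src V g"
  shows "f = g"
proof -
  have "f = transp V x (src V f) y (ev V x y \<cdot> (f \<rhd> x))"
    by (rule transp_ev[OF y f refl, symmetric])
  also have "\<dots> = g"
    unfolding eq using transp_ev[OF y g(1,2) refl] g(3) by simp
  finally show ?thesis .
qed

end

text \<open>Both conditions on a monoid morphism compare arrows into [c, b]. Evaluating them is
  reversible by \<open>ev_cancel\<close>, and \<open>conv_nat\<close> turns the evaluated product
  into the convolution of the transposed arrow with itself.\<close>

lemma measuring_transp:
  assumes A: "is_monoid V (a, ma, ia)" and B: "is_monoid V (b, m, i)" and C: "is_comonoid V (c, d, e)"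
    and g: "g \<in> ar V" "src V g = a" "tgt V g = hm c b"
  shows "is_monoid_hom V (a, ma, ia) (convolution V (c, d, e) (b, m, i)) g \<longleftrightarrow>
    measuring (a, ma, ia) (b, m, i) (c, d, e) (ev V c b \<cdot> (g \<rhd> c))"
proof -
  note [simp] = monoidD(1-7)[OF A] monoidD(1-7)[OF B] comonoidD(1-7)[OF C] g
  let ?H = "hm c b"
  let ?f = "ev V c b \<cdot> (g \<rhd> c)"
  let ?M = "conv m d c ?H ?H (ev V c b) (ev V c b)"
  let ?m = "transp V c (?H \<otimes> ?H) b ?M"
  let ?i = "transp V c \<I> b (i \<cdot> e \<cdot> lunit V c)"
  have [simp]: "?M \<in> ar V" "src V ?M = (?H \<otimes> ?H) \<otimes> c" "tgt V ?M = b"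
    using conv_ar[OF B C, of ?H ?H "ev V c b" "ev V c b"] by simp_all
  have H: "convolution V (c, d, e) (b, m, i) = (?H, ?m, ?i)"
    by (simp add: conv_def Let_def)
  have "g \<cdot> ma = ?m \<cdot> (g \<boxtimes> g) \<longleftrightarrow>
      ev V c b \<cdot> ((g \<cdot> ma) \<rhd> c) = ev V c b \<cdot> ((?m \<cdot> (g \<boxtimes> g)) \<rhd> c)"
    by (auto intro: ev_cancel[of c b])
  also have "ev V c b \<cdot> ((g \<cdot> ma) \<rhd> c) = ?f \<cdot> (ma \<rhd> c)"
    by simp
  also have "ev V c b \<cdot> ((?m \<cdot> (g \<boxtimes> g)) \<rhd> c) = ?M \<cdot> ((g \<boxtimes> g) \<rhd> c)"
    using cmp_tail[OF ev_transp[of c "?H \<otimes> ?H" ?M b], of "(g \<boxtimes> g) \<rhd> c"] by simp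
  also have "\<dots> = conv m d c a a ?f ?f"
    by (rule conv_nat[OF B C]) simp_all
  finally have mult: "g \<cdot> ma = ?m \<cdot> (g \<boxtimes> g) \<longleftrightarrow> ?f \<cdot> (ma \<rhd> c) = conv m d c a a ?f ?f" .
  have "g \<cdot> ia = ?i \<longleftrightarrow> ev V c b \<cdot> ((g \<cdot> ia) \<rhd> c) = ev V c b \<cdot> (?i \<rhd> c)"
    by (auto intro: ev_cancel[of c b])
  also have "ev V c b \<cdot> ((g \<cdot> ia) \<rhd> c) = ?f \<cdot> (ia \<rhd> c)"
    by simp
  also have "ev V c b \<cdot> (?i \<rhd> c) = i \<cdot> e \<cdot> lunit V c"
    by (rule ev_transp) simp_all
  finally have unit: "g \<cdot> ia = ?i \<longleftrightarrow> ?f \<cdot> (ia \<rhd> c) = i \<cdot> e \<cdot> lunit V c" .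
  show ?thesis
    unfolding H using mult unit by (auto simp: is_monoid_hom_def measuring_def homset_def)
qed

text \<open>Each monoid law is tested after evaluation, where it becomes one of
  \<open>conv_assoc\<close>, \<open>conv_lunit\<close> and \<open>conv_runit\<close> for the
  evaluation arrow.\<close>

lemma is_monoid_convolution:
  assumes B: "is_monoid V (b, m, i)" and C: "is_comonoid V (c, d, e)"
  shows "is_monoid V (convolution V (c, d, e) (b, m, i))"
proof -
  note [simp] = monoidD(1-7)[OF B] comonoidD(1-7)[OF C]
  let ?H = "hm c b"
  let ?e = "ev V c b"
  let ?I = "i \<cdot> e \<cdot> lunit V c"
  let ?M = "conv m d c ?H ?H ?e ?e"
  let ?m = "transp V c (?H \<otimes> ?H) b ?M"
  let ?i = "transp V c \<I> b ?I"
  have M [simp]: "?M \<in> ar V" "src V ?M = (?H \<otimes> ?H) \<otimes> c" "tgt V ?M = b"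
    using conv_ar[OF B C, of ?H ?H ?e ?e] by simp_all
  have H: "convolution V (c, d, e) (b, m, i) = (?H, ?m, ?i)"
    by (simp add: conv_def Let_def)
  have em: "?e \<cdot> (?m \<rhd> c) = ?M" and ei: "?e \<cdot> (?i \<rhd> c) = ?I"
    by (rule ev_transp; simp)+
  \<comment> \<open>The evaluated product of arbitrary arrows into [c, b] is the convolution of
    their evaluations. This is what lets the laws for \<open>conv\<close> be read as laws for
    \<open>?m\<close>.\<close>
  have prod: "?e \<cdot> ((?m \<cdot> (u \<boxtimes> v)) \<rhd> c) = conv m d c x y (?e \<cdot> (u \<rhd> c)) (?e \<cdot> (v \<rhd> c))"
    if [simp]: "u \<in> ar V" "src V u = x" "tgt V u = ?H" "v \<in> ar V" "src V v = y" "tgt V v = ?H" for u v x y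
  proof -
    have [simp]: "x \<in> ob V" "y \<in> ob V"
      using src_ob[of u] src_ob[of v] by simp_all
    have "?e \<cdot> ((?m \<cdot> (u \<boxtimes> v)) \<rhd> c) = ?M \<cdot> ((u \<boxtimes> v) \<rhd> c)"
      using cmp_tail[OF em, of "(u \<boxtimes> v) \<rhd> c"] by simp
    also have "\<dots> = conv m d c x y (?e \<cdot> (u \<rhd> c)) (?e \<cdot> (v \<rhd> c))"
      by (rule conv_nat[OF B C]) simp_all
    finally show ?thesis .
  qed
  show ?thesis
    unfolding H
  proof (rule monoidI)
    show "?m \<cdot> (?m \<rhd> ?H) = ?m \<cdot> (?H \<lhd> ?m) \<cdot> \<alpha> ?H ?H ?H"
    proof (rule ev_cancel[of c b])
      have "?e \<cdot> ((?m \<cdot> (?H \<lhd> ?m) \<cdot> \<alpha> ?H ?H ?H) \<rhd> c) =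
          ?e \<cdot> ((?m \<cdot> (?H \<lhd> ?m)) \<rhd> c) \<cdot> (\<alpha> ?H ?H ?H \<rhd> c)"
        by simp
      also have "\<dots> = conv m d c ?H (?H \<otimes> ?H) ?e ?M \<cdot> (\<alpha> ?H ?H ?H \<rhd> c)"
        using cmp_tail[OF prod[of "idn V ?H" ?H ?m "?H \<otimes> ?H"], of "\<alpha> ?H ?H ?H \<rhd> c"]
        by (simp add: em)
      also have "\<dots> = conv m d c (?H \<otimes> ?H) ?H ?M ?e"
        by (rule conv_assoc[OF B C, symmetric]) simp_all
      also have "\<dots> = ?e \<cdot> ((?m \<cdot> (?m \<rhd> ?H)) \<rhd> c)"
        using prod[of ?m "?H \<otimes> ?H" "idn V ?H" ?H] by (simp add: em)
      finally show "?e \<cdot> ((?m \<cdot> (?m \<rhd> ?H)) \<rhd> c) =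
          ?e \<cdot> ((?m \<cdot> (?H \<lhd> ?m) \<cdot> \<alpha> ?H ?H ?H) \<rhd> c)" by simp
    qed simp_all
    show "?m \<cdot> (?i \<rhd> ?H) = lunit V ?H"
    proof (rule ev_cancel[of c b])
      show "?e \<cdot> ((?m \<cdot> (?i \<rhd> ?H)) \<rhd> c) = ?e \<cdot> (lunit V ?H \<rhd> c)"
        using prod[of ?i \<I> "idn V ?H" ?H] conv_lunit[OF B C, of ?e ?H] by (simp add: ei)
    qed simp_all
    show "?m \<cdot> (?H \<lhd> ?i) = runit V ?H"
    proof (rule ev_cancel[of c b])
      show "?e \<cdot> ((?m \<cdot> (?H \<lhd> ?i)) \<rhd> c) = ?e \<cdot> (runit V ?H \<rhd> c)"
        using prod[of "idn V ?H" ?H ?i \<I>] conv_runit[OF B C, of ?e ?H] by (simp add: ei)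
    qed simp_all
  qed simp_all
qed

section \<open>Contravariance of [-, b] and functoriality of convolution\<close>

lemma ihom_pre_ar:
  assumes "k \<in> ar V" "y \<in> ob V"
  shows "ihom_pre V k y \<in> ar V" "src V (ihom_pre V k y) = hm (tgt V k) y"
    "tgt V (ihom_pre V k y) = hm (src V k) y"
    "ev V (src V k) y \<cdot> (ihom_pre V k y \<rhd> (src V k)) =
      ev V (tgt V k) y \<cdot> ((hm (tgt V k) y) \<lhd> k)"
  using assms src_ob[of k] tgt_ob[of k] ev_transp[of "src V k" "hm (tgt V k) y"
      "ev V (tgt V k) y \<cdot> ((hm (tgt V k) y) \<lhd> k)" y]
  by (simp_all add: ihom_pre_def Let_def)

text \<open>No calculation with the transposed multiplications is made. The identity of [c, b] is a
  monoid morphism, so the evaluation is a measuring; its restriction along \<open>k\<close> is again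
  a measuring, and the transpose of that restriction is \<open>ihom_pre V k b\<close>.\<close>

lemma is_monoid_hom_ihom_pre:
  assumes B: "is_monoid V (b, m, i)" and C: "is_comonoid V (c, d, e)" and C': "is_comonoid V (c', d', e')"
    and k: "is_comonoid_hom V (c', d', e') (c, d, e) k"
  shows "is_monoid_hom V (convolution V (c, d, e) (b, m, i)) (convolution V (c', d', e') (b, m, i))
    (ihom_pre V k b)"
proof -
  note [simp] = comonoidD(1-7)[OF C] comonoidD(1-7)[OF C'] monoidD(1-7)[OF B] comonoid_homD(1-3)[OF k]
  let ?H = "convolution V (c, d, e) (b, m, i)"
  obtain h mh ih where H: "?H = (h, mh, ih)" by (metis prod_cases3)
  then have [simp]: "h = hm c b" by (simp add: Let_def)
  have mon: "is_monoid V (h, mh, ih)"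
    by (rule is_monoid_convolution[OF B C, unfolded H])
  have "is_monoid_hom V (h, mh, ih) ?H (idn V h)"
    using monoidD[OF mon] unfolding H by (simp add: is_monoid_hom_def homset_def)
  then have "measuring (h, mh, ih) (b, m, i) (c, d, e) (ev V c b)"
    using measuring_transp[OF mon B C, of "idn V h"] by simp
  then have "measuring (h, mh, ih) (b, m, i) (c', d', e') (ev V c b \<cdot> (h \<lhd> k))"
    by (rule measuring_comonoid_hom[OF mon B C C' k])
  then show ?thesis
    unfolding H using ihom_pre_ar[of k b] measuring_transp[OF mon B C', of "ihom_pre V k b"] by simp
qed

lemma is_functor_conv:
  assumes B: "is_monoid V B"
  shows "is_functor (Comon V) (opcat (Mon V)) (conv_functor V B)"
proof -
  obtain b m i where e: "B = (b, m, i)" by (metis prod_cases3)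
  note B = B[unfolded e]
  note [simp] = monoidD(1-7)[OF B]
  have ob: "is_monoid V (convolution V C B)" if "is_comonoid V C" for C
    using is_monoid_convolution[OF B] that unfolding e by (metis prod_cases3)
  have ar: "is_monoid_hom V (convolution V D B) (convolution V C B) (ihom_pre V k (fst B))"
    if "is_comonoid V C" "is_comonoid V D" "is_comonoid_hom V C D k" for C D k
    using is_monoid_hom_ihom_pre[OF B] that unfolding e by (metis fst_conv prod_cases3)
  have idn: "ihom_pre V (idn V (fst C)) b = idn V (fst (convolution V C B))" if C: "is_comonoid V C" for C
  proof -
    obtain c d f where C': "C = (c, d, f)" by (metis prod_cases3)
    have [simp]: "c \<in> ob V" using C unfolding C' by (rule comonoidD)
    have "ihom_pre V (idn V c) b = idn V (hm c b)"
      using ihom_pre_ar[of "idn V c" b] by - (rule ev_cancel[of c b], simp_all)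
    then show ?thesis
      by (simp add: C' e Let_def)
  qed
  have cmp: "ihom_pre V (g \<cdot> f) b = ihom_pre V f b \<cdot> ihom_pre V g b"
    if [simp]: "f \<in> ar V" "g \<in> ar V" "src V g = tgt V f" for f g
  proof (rule ev_cancel[of "src V f" b])
    note [simp] = ihom_pre_ar(1-3) src_ob tgt_ob
    have "ev V (src V f) b \<cdot> ((ihom_pre V f b \<cdot> ihom_pre V g b) \<rhd> (src V f)) =
        ev V (src V f) b \<cdot> (ihom_pre V f b \<rhd> (src V f)) \<cdot> (ihom_pre V g b \<rhd> (src V f))"
      by simp
    also have "\<dots> = ev V (tgt V f) b \<cdot> ((hm (tgt V f) b) \<lhd> f) \<cdot> (ihom_pre V g b \<rhd> (src V f))"
      using cmp_tail[OF ihom_pre_ar(4)[of f b], of "ihom_pre V g b \<rhd> (src V f)"] by simp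
    also have "\<dots> = ev V (tgt V f) b \<cdot> (ihom_pre V g b \<rhd> (tgt V f)) \<cdot> ((hm (tgt V g) b) \<lhd> f)"
      by simp
    also have "\<dots> = ev V (tgt V g) b \<cdot> ((hm (tgt V g) b) \<lhd> (g \<cdot> f))"
      using cmp_tail[OF ihom_pre_ar(4)[of g b], of "(hm (tgt V g) b) \<lhd> f"] by simp
    also have "\<dots> = ev V (src V f) b \<cdot> (ihom_pre V (g \<cdot> f) b \<rhd> (src V f))"
      using ihom_pre_ar(4)[of "g \<cdot> f" b] by simp
    finally show "ev V (src V f) b \<cdot> (ihom_pre V (g \<cdot> f) b \<rhd> (src V f)) =
      ev V (src V f) b \<cdot> ((ihom_pre V f b \<cdot> ihom_pre V g b) \<rhd> (src V f))" by simp
  qed (use ihom_pre_ar(1-3) src_ob tgt_ob in simp_all)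
  have comon: "Comon V = structured_cat V (is_comonoid V) (is_comonoid_hom V)"
    by (simp add: Comon_def)
  show ?thesis
    unfolding is_functor_def
  proof (intro conjI ballI impI)
    show "category (Comon V)" by (rule category_Comon)
    show "category (opcat (Mon V))" by (rule category_opcat[OF category_Mon])
    show "\<And>C. C \<in> ob (Comon V) \<Longrightarrow> omap (conv_functor V B) C \<in> ob (opcat (Mon V))"
      using ob by (auto simp: comon Mon_def structured_cat_def opcat_def conv_functor_def simp del: convolution.simps)
    show "\<And>f. f \<in> ar (Comon V) \<Longrightarrow> amap (conv_functor V B) f \<in> homset (opcat (Mon V))
        (omap (conv_functor V B) (src (Comon V) f)) (omap (conv_functor V B) (tgt (Comon V) f))"
      unfolding homset_opcat using ob ar
      by (auto simp: comon Mon_def structured_cat_def homset_def conv_functor_def simp del: convolution.simps)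
    show "\<And>C. C \<in> ob (Comon V) \<Longrightarrow> amap (conv_functor V B) (idn (Comon V) C) =
        idn (opcat (Mon V)) (omap (conv_functor V B) C)"
      using idn by (auto simp: comon Mon_def structured_cat_def opcat_def conv_functor_def e simp del: convolution.simps)
    show "\<And>f g. f \<in> ar (Comon V) \<Longrightarrow> g \<in> ar (Comon V) \<Longrightarrow> src (Comon V) g = tgt (Comon V) f \<Longrightarrow>
        amap (conv_functor V B) (g \<cdot>\<^bsub>Comon V\<^esub> f) =
        amap (conv_functor V B) g \<cdot>\<^bsub>opcat (Mon V)\<^esub> amap (conv_functor V B) f"
      using cmp by (auto simp: comon Mon_def structured_cat_def opcat_def conv_functor_def e is_comonoid_hom_def
          homset_def simp del: convolution.simps)
  qed
qed

end

section \<open>Small sets\<close>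

lemma small_subset: "small U B \<Longrightarrow> A \<subseteq> B \<Longrightarrow> small U A"
  unfolding small_def by (metis card_of_mono1 ordLeq_ordLess_trans)

lemma small_image: "small U A \<Longrightarrow> small U (f ` A)"
  unfolding small_def by (metis card_of_image ordLeq_ordLess_trans)

lemma small_inj:
  assumes "small U (f ` A)" "inj_on f A"
  shows "small U A"
proof -
  have "|A| \<le>o |f ` A|"
    using assms(2) card_of_ordLeq by blast
  then show ?thesis
    using assms(1) unfolding small_def by (metis ordLeq_ordLess_trans)
qed

context
  fixes U :: "'u rel"
  assumes U: "inaccessible U"
begin

private lemma U_infinite_regular: "Cinfinite U" "regularCard U"
  using U cinfinite_mono[OF ordLess_imp_ordLeq natLeq_cinfinite] by (auto simp: inaccessible_def)

lemma small_UN: "small U I \<Longrightarrow> (\<And>i. i \<in> I \<Longrightarrow> small U (A i)) \<Longrightarrow> small U (\<Union>i\<in>I. A i)"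
  unfolding small_def
  by (intro card_of_UNION_ordLess_infinite_Field_regularCard U_infinite_regular) auto

lemma small_countable:
  assumes "countable A"
  shows "small U A"
proof -
  obtain f :: "_ \<Rightarrow> nat" where "inj_on f A"
    using assms by (rule countableE)
  moreover have "small U (UNIV :: nat set)"
    using U card_of_nat unfolding small_def inaccessible_def by (metis ordIso_ordLess_trans)
  ultimately show ?thesis
    using small_inj small_subset subset_UNIV by metis
qed

lemma small_Un: "small U A \<Longrightarrow> small U B \<Longrightarrow> small U (A \<union> B)"
  using small_UN[of "UNIV :: bool set" "\<lambda>b. if b then A else B"] small_countable[of "UNIV :: bool set"]
  by (auto simp: UNIV_bool Un_commute)

lemma small_Sigma:
  assumes "small U A" "\<And>a. a \<in> A \<Longrightarrow> small U (B a)"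
  shows "small U (Sigma A B)"
proof -
  have "small U (\<Union>a\<in>A. Pair a ` B a)"
    by (intro small_UN small_image assms)
  then show ?thesis
    by (rule small_subset) auto
qed

text \<open>This moves small index sets of arbitrary types onto the type underlying the universe,
  the only type for which cocompleteness and closure under power sets are postulated.\<close>

lemma small_embedding:
  assumes "small U A"
  obtains k :: "'a \<Rightarrow> 'u" where "inj_on k A"
proof -
  have "Card_order U"
    using U by (simp add: inaccessible_def)
  then have "|A| \<le>o |Field U|"
    using assms card_of_Field_ordIso unfolding small_def
    by (metis ordIso_symmetric ordLess_imp_ordLeq ordLeq_ordIso_trans)
  then show ?thesis
    using that by (metis card_of_ordLeq)
qed

text \<open>Inaccessibility speaks only of subsets of the type of \<open>U\<close>, so the power set
  is first transported along an embedding into that type.\<close>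

lemma small_Pow:
  assumes "small U A"
  shows "small U (Pow A)"
proof -
  obtain k :: "_ \<Rightarrow> 'u" where k: "inj_on k A"
    using assms by (rule small_embedding)
  have "small U (Pow (k ` A))"
    using small_image[OF assms, of k] U unfolding small_def inaccessible_def by blast
  moreover have "(`) k ` Pow A \<subseteq> Pow (k ` A)"
    by auto
  ultimately show ?thesis
    using small_inj[OF small_subset inj_on_image_Pow[OF k]] by metis
qed

text \<open>A function is replaced by its graph, an element of the power set of a small
  product.\<close>

lemma small_funs:
  assumes "small U (UNIV :: 'i set)" "small U A"
  shows "small U {f :: 'i \<Rightarrow> 'a. range f \<subseteq> A}"
proof (rule small_inj)
  let ?g = "\<lambda>f :: 'i \<Rightarrow> 'a. (\<lambda>i. (i, f i)) ` UNIV"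
  show "inj_on ?g {f. range f \<subseteq> A}"
    by (rule inj_onI) (auto simp: fun_eq_iff set_eq_iff image_iff)
  have "?g ` {f. range f \<subseteq> A} \<subseteq> Pow (UNIV \<times> A)"
    by auto
  then show "small U (?g ` {f. range f \<subseteq> A})"
    by (rule small_subset[OF small_Pow[OF small_Sigma[OF assms]]])
qed

end

section \<open>Colimits of graphs\<close>

text \<open>The definitions of cocones and colimits do not mention the composition of the index category,
  so they make sense for an arbitrary index graph.\<close>

definition diagram ::
  "('j, 'k, 'y) cat_scheme \<Rightarrow> ('o, 'm, 'z) cat_scheme \<Rightarrow> ('j, 'k, 'o, 'm) func \<Rightarrow> bool" where
  "diagram J C D \<longleftrightarrow> (\<forall>j\<in>ob J. omap D j \<in> ob C) \<and>
    (\<forall>a\<in>ar J. src J a \<in> ob J \<and> tgt J a \<in> ob J \<and>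
      amap D a \<in> homset C (omap D (src J a)) (omap D (tgt J a)))"

definition graph :: "'j set \<Rightarrow> 'k set \<Rightarrow> ('k \<Rightarrow> 'j) \<Rightarrow> ('k \<Rightarrow> 'j) \<Rightarrow> ('j, 'k) cat" where
  "graph A E s t = \<lparr>ob = A, ar = E, src = s, tgt = t, idn = (\<lambda>_. undefined), cmp = (\<lambda>_ _. undefined)\<rparr>"

lemma graph_simps [simp]:
  "ob (graph A E s t) = A" "ar (graph A E s t) = E" "src (graph A E s t) = s" "tgt (graph A E s t) = t"
  by (simp_all add: graph_def)

lemma is_functor_diagram: "is_functor J C D \<Longrightarrow> diagram J C D"
  by (auto simp: is_functor_def diagram_def category.src_ob category.tgt_ob)

lemma is_coconeD:
  assumes "is_cocone J C D z k"
  shows "z \<in> ob C" "j \<in> ob J \<Longrightarrow> k j \<in> homset C (omap D j) z"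
    "a \<in> ar J \<Longrightarrow> k (tgt J a) \<cdot>\<^bsub>C\<^esub> amap D a = k (src J a)"
  using assms by (auto simp: is_cocone_def)

lemma colimit_cocone: "is_colimit J C D z k \<Longrightarrow> is_cocone J C D z k"
  by (simp add: is_colimit_def)

lemma colimit_eqI:
  assumes "is_colimit J C D z k" "category C" "diagram J C D" "u \<in> homset C z w" "v \<in> homset C z w"
    and "\<And>j. j \<in> ob J \<Longrightarrow> u \<cdot>\<^bsub>C\<^esub> k j = v \<cdot>\<^bsub>C\<^esub> k j"
  shows "u = v"
proof -
  interpret category C by fact
  have k: "is_cocone J C D z k"
    using assms(1) by (simp add: is_colimit_def)
  have "is_cocone J C D w (\<lambda>j. u \<cdot>\<^bsub>C\<^esub> k j)"
    unfolding is_cocone_def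
  proof (intro conjI ballI)
    show "w \<in> ob C"
      using homset_arD[OF assms(4)] by simp
    show "u \<cdot>\<^bsub>C\<^esub> k j \<in> homset C (omap D j) w" if "j \<in> ob J" for j
      using cmp_hom[OF is_coconeD(2)[OF k that] assms(4)] .
    fix a assume a: "a \<in> ar J"
    then have "src J a \<in> ob J" "tgt J a \<in> ob J" and D: "amap D a \<in> homset C (omap D (src J a)) (omap D (tgt J a))"
      using assms(3) by (auto simp: diagram_def)
    then show "(u \<cdot>\<^bsub>C\<^esub> k (tgt J a)) \<cdot>\<^bsub>C\<^esub> amap D a = u \<cdot>\<^bsub>C\<^esub> k (src J a)"
      using cmp_assoc[OF D is_coconeD(2)[OF k] assms(4)] is_coconeD(3)[OF k a] by simp
  qed
  then have "\<exists>!u'. u' \<in> homset C z w \<and> (\<forall>j\<in>ob J. u' \<cdot>\<^bsub>C\<^esub> k j = u \<cdot>\<^bsub>C\<^esub> k j)"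
    using assms(1) by (simp add: is_colimit_def)
  then show ?thesis
    using assms(4,5,6) by metis
qed

lemma colimit_desc:
  assumes "is_colimit J C D z k" "is_cocone J C D w c"
  obtains u where "u \<in> homset C z w" "\<And>j. j \<in> ob J \<Longrightarrow> u \<cdot>\<^bsub>C\<^esub> k j = c j"
  using assms unfolding is_colimit_def by metis

text \<open>Used to replace an index type by another one. Legs live on the vertices, so these must
  correspond bijectively. Edges only impose equations, so it is enough that every edge of
  \<open>J'\<close> comes from an edge of \<open>J\<close>.\<close>

lemma is_colimit_reindex:
  assumes p: "inj_on p (ob J)" "ob J' = p ` ob J" and q: "ar J' = q ` ar J"
    and J: "\<And>a. a \<in> ar J \<Longrightarrow> src J a \<in> ob J \<and> src J' (q a) = p (src J a)"
      "\<And>a. a \<in> ar J \<Longrightarrow> tgt J a \<in> ob J \<and> tgt J' (q a) = p (tgt J a)"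
    and D: "\<And>j. j \<in> ob J \<Longrightarrow> omap D' (p j) = omap D j" "\<And>a. a \<in> ar J \<Longrightarrow> amap D' (q a) = amap D a"
    and colim: "is_colimit J' C D' z k"
  shows "is_colimit J C D z (k \<circ> p)"
proof -
  have cocone: "is_cocone J' C D' w c \<longleftrightarrow> is_cocone J C D w (c \<circ> p)" for w c
    using J D by (auto simp: is_cocone_def p q)
  show ?thesis
    unfolding is_colimit_def
  proof (intro conjI allI impI)
    show "is_cocone J C D z (k \<circ> p)"
      using colim by (simp add: cocone[symmetric] is_colimit_def)
    fix w c assume c: "is_cocone J C D w c"
    let ?c = "c \<circ> inv_into (ob J) p"
    have "is_cocone J C D w (?c \<circ> p)"
      using c J p(1) by (auto simp: is_cocone_def)
    then have "\<exists>!u. u \<in> homset C z w \<and> (\<forall>j\<in>ob J'. u \<cdot>\<^bsub>C\<^esub> k j = ?c j)"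
      using colim unfolding cocone[symmetric] is_colimit_def by blast
    then show "\<exists>!u. u \<in> homset C z w \<and> (\<forall>j\<in>ob J. u \<cdot>\<^bsub>C\<^esub> (k \<circ> p) j = c j)"
      using p by simp
  qed
qed

text \<open>Cocompleteness is postulated for index categories on the type of \<open>U\<close>; a
  small category on any other types is copied there and the colimit is carried back.\<close>

lemma small_category_colimit:
  fixes J :: "('j, 'k, 'y) cat_scheme"
  assumes U: "inaccessible U" and C: "cocomplete U C" and J: "small U (ob J)" "small U (ar J)"
    and D: "is_functor J C D"
  shows "\<exists>z k. is_colimit J C D z k"
proof -
  interpret J: category J using D by (simp add: is_functor_def)
  obtain p :: "'j \<Rightarrow> 'a" where p: "inj_on p (ob J)" using small_embedding[OF U J(1)] .
  obtain q :: "'k \<Rightarrow> 'a" where q: "inj_on q (ar J)" using small_embedding[OF U J(2)] .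
  define p' where "p' = inv_into (ob J) p"
  define q' where "q' = inv_into (ar J) q"
  have p' [simp]: "j \<in> ob J \<Longrightarrow> p' (p j) = j" for j
    using p by (simp add: p'_def)
  have q' [simp]: "a \<in> ar J \<Longrightarrow> q' (q a) = a" for a
    using q by (simp add: q'_def)
  define J' where "J' = \<lparr>ob = p ` ob J, ar = q ` ar J, src = p \<circ> src J \<circ> q', tgt = p \<circ> tgt J \<circ> q',
    idn = q \<circ> idn J \<circ> p', cmp = (\<lambda>g f. q (q' g \<cdot>\<^bsub>J\<^esub> q' f))\<rparr>"
  define D' where "D' = \<lparr>omap = omap D \<circ> p', amap = amap D \<circ> q'\<rparr>"
  have eq: "p x = p y \<longleftrightarrow> x = y" if "x \<in> ob J" "y \<in> ob J" for x y
    using p that by (auto dest: inj_onD)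
  have hom: "homset J' x y = {q a |a. a \<in> ar J \<and> p (src J a) = x \<and> p (tgt J a) = y}" for x y
    by (auto simp: J'_def homset_def)
  note [simp] = eq J.src_ob J.tgt_ob
  have "category J'"
    by unfold_locales (auto simp: hom, auto simp: J'_def)
  then have "is_functor J' C D'"
    using D by (auto simp: is_functor_def J'_def D'_def homset_def)
  moreover have "small U (ob J')" "small U (ar J')"
    using J by (simp_all add: J'_def small_image)
  ultimately obtain z k where zk: "is_colimit J' C D' z k"
    using C unfolding cocomplete_def by blast
  have "is_colimit J C D z (k \<circ> p)"
    by (rule is_colimit_reindex[OF p _ _ _ _ _ _ zk, where q = q]) (simp_all add: J'_def D'_def)
  then show ?thesis by blast
qed

text \<open>The colimit of a graph is the colimit over the category whose objects are the vertices and the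
  edges, and whose arrows other than identities lead from each edge to its source and to its target.\<close>

lemma graph_colimit:
  fixes J :: "('j, 'k, 'y) cat_scheme"
  assumes U: "inaccessible U" and "category C" and C: "cocomplete U C"
    and J: "small U (ob J)" "small U (ar J)" and D: "diagram J C D"
  shows "\<exists>z k. is_colimit J C D z k"
proof -
  interpret category C by fact
  define ob' where "ob' = Inl ` ob J \<union> Inr ` ar J"
  define s where "s x = (case x of Inl y \<Rightarrow> y | Inr (a, b) \<Rightarrow> Inr a)" for x :: "('j + 'k) + ('k \<times> bool)"
  define t where "t x = (case x of Inl y \<Rightarrow> y | Inr (a, b) \<Rightarrow> Inl (if b then src J a else tgt J a))"
    for x :: "('j + 'k) + ('k \<times> bool)"
  define J' where "J' = \<lparr>ob = ob', ar = Inl ` ob' \<union> Inr ` (ar J \<times> UNIV), src = s, tgt = t,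
    idn = Inl, cmp = (\<lambda>g f. case g of Inl _ \<Rightarrow> f | Inr _ \<Rightarrow> g)\<rparr>"
  \<comment> \<open>An edge vertex carries the value of \<open>D\<close> at the source of the edge.
    Its leg marked \<open>True\<close> leads to the source and is sent to an identity, the one
    marked \<open>False\<close> leads to the target and is sent to \<open>amap D a\<close>.\<close>
  define om where "om x = (case x of Inl j \<Rightarrow> omap D j | Inr a \<Rightarrow> omap D (src J a))" for x
  define D' where "D' = \<lparr>omap = om,
    amap = (\<lambda>x. case x of Inl y \<Rightarrow> idn C (om y) |
      Inr (a, b) \<Rightarrow> if b then idn C (omap D (src J a)) else amap D a)\<rparr>"
  have D1: "\<And>j. j \<in> ob J \<Longrightarrow> omap D j \<in> ob C"
    and D2: "\<And>a. a \<in> ar J \<Longrightarrow> src J a \<in> ob J \<and> tgt J a \<in> ob J \<and> amap D a \<in> ar C \<and>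
      src C (amap D a) = omap D (src J a) \<and> tgt C (amap D a) = omap D (tgt J a)"
    using D by (auto simp: diagram_def homset_def)
  note [simp] = D1 D2
  have "category J'"
    by unfold_locales
      (auto simp: J'_def homset_def ob'_def s_def t_def split: sum.splits prod.splits if_splits)
  then have "is_functor J' C D'"
    unfolding is_functor_def
    by (auto simp: \<open>category C\<close> J'_def D'_def homset_def ob'_def s_def t_def om_def split: sum.splits prod.splits if_splits)
  moreover have "small U (ob J')" "small U (ar J')"
    using J small_countable[OF U, of "UNIV :: bool set"]
    by (simp_all add: J'_def ob'_def small_Un[OF U] small_image small_Sigma[OF U])
  ultimately obtain z k where zk: "is_colimit J' C D' z k"
    using small_category_colimit[OF U C] by blast
  \<comment> \<open>The identity leg to the source forces the component at an edge vertex, so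
    cocones on the graph and on the category determine each other.\<close>
  define ext where "ext c x = (case x of Inl j \<Rightarrow> c j | Inr a \<Rightarrow> c (src J a))" for c :: "'j \<Rightarrow> 'c" and x :: "'j + 'k"
  have cocone: "is_cocone J' C D' w (ext c)" if "is_cocone J C D w c" for w c
    using that
    by (auto simp: is_cocone_def J'_def D'_def ob'_def s_def t_def om_def ext_def homset_def)
  have k: "is_cocone J' C D' z k"
    using zk by (simp add: is_colimit_def)
  have edge: "k (Inr a) = k (Inl (src J a))" if "a \<in> ar J" for a
    using is_coconeD(3)[OF k, of "Inr (a, True)"] is_coconeD(2)[OF k, of "Inl (src J a)"] that
    by (auto simp: J'_def D'_def s_def t_def ob'_def om_def homset_def)
  have "is_colimit J C D z (k \<circ> Inl)"
    unfolding is_colimit_def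
  proof (intro conjI allI impI)
    show "is_cocone J C D z (k \<circ> Inl)"
      unfolding is_cocone_def
    proof (intro conjI ballI)
      show "z \<in> ob C" by (rule is_coconeD[OF k])
      show "(k \<circ> Inl) j \<in> homset C (omap D j) z" if "j \<in> ob J" for j
        using is_coconeD(2)[OF k, of "Inl j"] that by (simp add: J'_def ob'_def D'_def om_def)
      show "(k \<circ> Inl) (tgt J a) \<cdot>\<^bsub>C\<^esub> amap D a = (k \<circ> Inl) (src J a)" if "a \<in> ar J" for a
        using is_coconeD(3)[OF k, of "Inr (a, False)"] that edge[OF that]
        by (simp add: J'_def ob'_def D'_def om_def s_def t_def)
    qed
    fix w c assume c: "is_cocone J C D w c"
    have "\<exists>!u. u \<in> homset C z w \<and> (\<forall>x\<in>ob J'. u \<cdot>\<^bsub>C\<^esub> k x = ext c x)"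
      using zk cocone[OF c] unfolding is_colimit_def by blast
    moreover have "(\<forall>x\<in>ob J'. u \<cdot>\<^bsub>C\<^esub> k x = ext c x) \<longleftrightarrow> (\<forall>j\<in>ob J. u \<cdot>\<^bsub>C\<^esub> (k \<circ> Inl) j = c j)" for u
      using edge by (auto simp: J'_def ob'_def ext_def)
    ultimately show "\<exists>!u. u \<in> homset C z w \<and> (\<forall>j\<in>ob J. u \<cdot>\<^bsub>C\<^esub> (k \<circ> Inl) j = c j)"
      by simp
  qed
  then show ?thesis by blast
qed

text \<open>After numbering its vertices, a countable diagram in \<open>G\<close> is given by
  subsets of \<open>nat\<close> and of \<open>nat \<times> nat\<close> with labels in
  \<open>G\<close> and in the set of arrows between members of \<open>G\<close>. Only a small set of
  such data exists, whatever the index type \<open>'j\<close> is, and one colimit object is chosen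
  for each.\<close>

lemma small_countable_colimits:
  fixes U :: "'u rel" and C :: "('o, 'm, 'z) cat_scheme" and G :: "'o set"
  assumes U: "inaccessible U" and "category C" and C: "cocomplete U C" "locally_small U C"
    and G: "small U G" "G \<subseteq> ob C"
  shows "\<exists>R. small U R \<and> (\<forall>(J :: 'j set) s D. countable J \<and> J \<noteq> {} \<and> s \<subseteq> J \<times> J \<and>
    diagram (graph J s fst snd) C D \<and> omap D ` J \<subseteq> G \<longrightarrow> (\<exists>z\<in>R. \<exists>k. is_colimit (graph J s fst snd) C D z k))"
proof -
  interpret category C by fact
  define A where "A = (\<Union>x\<in>G. \<Union>y\<in>G. homset C x y)"
  define P where "P = (UNIV :: nat set set) \<times> (UNIV :: (nat \<times> nat) set set) \<times>
    {X :: nat \<Rightarrow> 'o. range X \<subseteq> G} \<times> {h :: nat \<times> nat \<Rightarrow> 'm. range h \<subseteq> A}"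
  \<comment> \<open>For labellings that are not diagrams the chosen value is arbitrary; the size of
    the image is bounded by that of \<open>P\<close> all the same.\<close>
  define col where "col = (\<lambda>(N :: nat set, E, X, h). SOME z. \<exists>k.
    is_colimit (graph N E fst snd) C \<lparr>omap = X, amap = h\<rparr> z k)"
  have "small U A"
    unfolding A_def using C(2) G by (intro small_UN[OF U]) (auto simp: locally_small_def)
  then have "small U P"
    unfolding P_def Pow_UNIV[symmetric] using G(1)
    by (intro small_Sigma[OF U] small_funs[OF U] small_Pow[OF U])
      (assumption | rule small_countable[OF U countableI_type])+
  then have "small U (col ` P)"
    by (rule small_image)
  moreover have "\<exists>z\<in>col ` P. \<exists>k. is_colimit (graph J s fst snd) C D z k"
    if J: "countable J" "J \<noteq> {}" "s \<subseteq> J \<times> J" and D: "diagram (graph J s fst snd) C D" "omap D ` J \<subseteq> G"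
    for J :: "'j set" and s D
  proof -
    obtain j0 where j0: "j0 \<in> J" using J by blast
    obtain p :: "'j \<Rightarrow> nat" where p: "inj_on p J" using J(1) by (rule countableE)
    define q where "q = inv_into J p"
    have q [simp]: "j \<in> J \<Longrightarrow> q (p j) = j" for j using p by (simp add: q_def)
    \<comment> \<open>Labels outside the numbered diagram are padded with \<open>omap D j0\<close>
      and its identity, so that the total functions \<open>X\<close> and \<open>h\<close> take
      values in \<open>G\<close> and \<open>A\<close>. Nonemptiness of \<open>J\<close> supplies
      \<open>j0\<close>.\<close>
    define X where "X n = (if n \<in> p ` J then omap D (q n) else omap D j0)" for n
    define h where "h e = (if e \<in> map_prod p p ` s then amap D (map_prod q q e) else idn C (omap D j0))" for e
    let ?N = "graph (p ` J) (map_prod p p ` s) fst snd"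
    let ?D = "\<lparr>omap = X, amap = h\<rparr>"
    have DJ: "omap D j \<in> G" "omap D j \<in> ob C" if "j \<in> J" for j
      using D that G by auto
    have Ds: "x \<in> J" "y \<in> J" "amap D (x, y) \<in> homset C (omap D x) (omap D y)" if "(x, y) \<in> s" for x y
      using D(1) J that by (auto simp: diagram_def)
    have X: "X (p j) = omap D j" if "j \<in> J" for j
      using that by (simp add: X_def)
    have h: "h (p x, p y) = amap D (x, y)" if "(x, y) \<in> s" for x y
    proof -
      have "(p x, p y) \<in> map_prod p p ` s" using that by force
      then show ?thesis using Ds[OF that] by (simp add: h_def)
    qed
    have "range X \<subseteq> G"
      using DJ j0 by (auto simp: X_def)
    moreover have "h e \<in> A" for e
    proof (cases "e \<in> map_prod p p ` s")
      case True
      then obtain x y where "(x, y) \<in> s" "e = (p x, p y)" by auto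
      then show ?thesis unfolding A_def using h[of x y] Ds[of x y] DJ by simp blast
    next
      case False
      then show ?thesis using DJ[OF j0] idn_hom by (auto simp: h_def A_def)
    qed
    ultimately have P: "(p ` J, map_prod p p ` s, X, h) \<in> P"
      by (auto simp: P_def)
    have "diagram ?N C ?D"
      using DJ Ds by (auto simp: diagram_def X h)
    then have "\<exists>z k. is_colimit ?N C ?D z k"
      by (intro graph_colimit[OF U \<open>category C\<close> C(1)] small_countable[OF U]) simp_all
    then have "\<exists>k. is_colimit ?N C ?D (col (p ` J, map_prod p p ` s, X, h)) k"
      unfolding col_def prod.case by (rule someI_ex)
    then obtain k where k: "is_colimit ?N C ?D (col (p ` J, map_prod p p ` s, X, h)) k" ..
    have "is_colimit (graph J s fst snd) C D (col (p ` J, map_prod p p ` s, X, h)) (k \<circ> p)"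
      by (rule is_colimit_reindex[OF _ _ _ _ _ _ _ k, where q = "map_prod p p"]) (use p Ds X h in auto)
    then show ?thesis using P by blast
  qed
  ultimately show ?thesis by blast
qed

text \<open>Closing up omega times suffices, since any two elements of the union already occur
  together at a finite step. The demand \<open>W\<close> is binary because compatibility of lifts is
  a condition on pairs of stages.\<close>

lemma countable_closure:
  assumes J: "countable J" "J \<subseteq> I" and W: "\<And>x y. x \<in> I \<Longrightarrow> y \<in> I \<Longrightarrow> countable (W x y) \<and> W x y \<subseteq> I"
  shows "\<exists>K. countable K \<and> J \<subseteq> K \<and> K \<subseteq> I \<and> (\<forall>x\<in>K. \<forall>y\<in>K. W x y \<subseteq> K)"
proof -
  define S where "S = rec_nat J (\<lambda>_ X. X \<union> (\<Union>x\<in>X. \<Union>y\<in>X. W x y))"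
  have S: "S 0 = J" "S (Suc n) = S n \<union> (\<Union>x\<in>S n. \<Union>y\<in>S n. W x y)" for n
    by (simp_all add: S_def)
  have n: "countable (S n) \<and> S n \<subseteq> I" for n
  proof (induction n)
    case (Suc n)
    have "countable (W x y) \<and> W x y \<subseteq> I" if "x \<in> S n" "y \<in> S n" for x y
      using that Suc W by blast
    then show ?case
      using Suc by (auto simp: S)
  qed (use J S in auto)
  have mono: "S k \<subseteq> S n" if "k \<le> n" for k n
    using that by (rule lift_Suc_mono_le[rotated]) (auto simp: S)
  show ?thesis
  proof (intro exI[of _ "\<Union>n. S n"] conjI ballI)
    show "countable (\<Union>n. S n)" "(\<Union>n. S n) \<subseteq> I"
      using n by auto
    show "J \<subseteq> (\<Union>n. S n)"
      using S(1) by blast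
    fix x y assume "x \<in> (\<Union>n. S n)" "y \<in> (\<Union>n. S n)"
    then obtain k l where "x \<in> S k" "y \<in> S l" by auto
    then have "x \<in> S (max k l)" "y \<in> S (max k l)"
      using mono[of k "max k l"] mono[of l "max k l"] by auto
    then have "W x y \<subseteq> S (Suc (max k l))"
      by (auto simp: S(2))
    then show "W x y \<subseteq> (\<Union>n. S n)" by blast
  qed
qed

section \<open>Directed colimits and presentable objects\<close>

definition directed :: "'i set \<Rightarrow> 'i rel \<Rightarrow> bool" where
  "directed I r \<longleftrightarrow> I \<noteq> {} \<and> partial_order_on I r \<and> (\<forall>i\<in>I. \<forall>j\<in>I. \<exists>n\<in>I. (i, n) \<in> r \<and> (j, n) \<in> r)"

text \<open>The cardinal \<open>l\<close> is infinite, so finite sets fall below it: the empty set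
  gives nonemptiness, a pair gives an upper bound.\<close>

lemma directed_poset_directed:
  fixes I :: "'i set"
  assumes "directed_poset l I r" "small_regular_cardinal U l"
  shows "directed I r"
proof -
  have fin: "|A| <o l" if "finite A" for A :: "'i set"
    using assms(2) that card_order_on_well_order_on
    by (intro finite_ordLess_infinite[OF card_of_Well_order])
      (auto simp: small_regular_cardinal_def cinfinite_def Field_card_of)
  have ub: "\<exists>b\<in>I. \<forall>a\<in>A. (a, b) \<in> r" if "A \<subseteq> I" "finite A" for A
    using assms(1) that(1) fin[OF that(2)] by (simp add: directed_poset_def)
  show ?thesis
    unfolding directed_def
  proof (intro conjI ballI)
    show "I \<noteq> {}" using ub[of "{}"] by auto
    show "partial_order_on I r" using assms(1) by (simp add: directed_poset_def)
    show "\<exists>n\<in>I. (i, n) \<in> r \<and> (j, n) \<in> r" if "i \<in> I" "j \<in> I" for i j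
      using ub[of "{i, j}"] that by auto
  qed
qed

lemma posetcat_simps [simp]:
  "ob (posetcat I r) = I" "ar (posetcat I r) = r" "src (posetcat I r) = fst" "tgt (posetcat I r) = snd"
  by (simp_all add: posetcat_def)

section \<open>Directed diagrams and their colimits\<close>

locale directed_diagram = category C for C :: "('o, 'm, 'z) cat_scheme" (structure) +
  fixes I :: "'i set" and r :: "'i rel" and D :: "('i, 'i \<times> 'i, 'o, 'm) func"
  assumes D_functor: "is_functor (posetcat I r) C D"
    and directed: "directed I r"
begin

lemma le_in: "(i, j) \<in> r \<Longrightarrow> i \<in> I" "(i, j) \<in> r \<Longrightarrow> j \<in> I"
  using category.src_ob[of "posetcat I r" "(i, j)"] category.tgt_ob[of "posetcat I r" "(i, j)"] D_functor
  by (auto simp: is_functor_def)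

lemma le_refl [simp]: "i \<in> I \<Longrightarrow> (i, i) \<in> r"
  using directed by (auto simp: directed_def partial_order_on_def preorder_on_def refl_on_def)

lemma le_trans: "(i, j) \<in> r \<Longrightarrow> (j, n) \<in> r \<Longrightarrow> (i, n) \<in> r"
  using directed unfolding directed_def partial_order_on_def preorder_on_def trans_def by blast

lemma upper_bound:
  assumes "i \<in> I" "j \<in> I"
  obtains n where "n \<in> I" "(i, n) \<in> r" "(j, n) \<in> r"
  using directed assms unfolding directed_def by blast

lemma D_ob [simp]: "i \<in> I \<Longrightarrow> omap D i \<in> ob C"
  using D_functor by (simp add: is_functor_def)

lemma D_ar [simp]:
  assumes "(i, j) \<in> r"
  shows "amap D (i, j) \<in> ar C" "src C (amap D (i, j)) = omap D i" "tgt C (amap D (i, j)) = omap D j"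
proof -
  have "\<forall>f\<in>r. amap D f \<in> homset C (omap D (fst f)) (omap D (snd f))"
    using D_functor by (simp add: is_functor_def)
  from bspec[OF this assms]
  show "amap D (i, j) \<in> ar C" "src C (amap D (i, j)) = omap D i" "tgt C (amap D (i, j)) = omap D j"
    by (auto simp: homset_def)
qed

lemma D_idn [simp]: "i \<in> I \<Longrightarrow> amap D (i, i) = idn C (omap D i)"
  using D_functor by (auto simp: is_functor_def posetcat_def)

lemma D_cmp [simp]:
  assumes "(i, j) \<in> r" "(j, n) \<in> r"
  shows "amap D (j, n) \<cdot> amap D (i, j) = amap D (i, n)"
proof -
  have "\<forall>f\<in>r. \<forall>g\<in>r. fst g = snd f \<longrightarrow> amap D (fst f, snd g) = amap D g \<cdot> amap D f"
    using D_functor by (simp add: is_functor_def) (simp add: posetcat_def)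
  from bspec[OF bspec[OF this assms(1)] assms(2)] show ?thesis by simp
qed

lemma D_cmp_tail [simp]:
  assumes "(i, j) \<in> r" "(j, n) \<in> r" "f \<in> ar C" "tgt C f = omap D i"
  shows "amap D (j, n) \<cdot> amap D (i, j) \<cdot> f = amap D (i, n) \<cdot> f"
  using cmp_tail[OF D_cmp[OF assms(1,2)], of f] assms by simp

end

lemma is_functor_posetcatI:
  assumes P: "category (posetcat I r)" and "category C" and "\<And>i. i \<in> I \<Longrightarrow> omap D i \<in> ob C"
    and "\<And>i j. (i, j) \<in> r \<Longrightarrow> amap D (i, j) \<in> homset C (omap D i) (omap D j)"
    and "\<And>i. i \<in> I \<Longrightarrow> amap D (i, i) = idn C (omap D i)"
    and "\<And>i j n. (i, j) \<in> r \<Longrightarrow> (j, n) \<in> r \<Longrightarrow> amap D (i, n) = amap D (j, n) \<cdot>\<^bsub>C\<^esub> amap D (i, j)"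
  shows "is_functor (posetcat I r) C D"
  using assms unfolding is_functor_def by (auto simp: posetcat_def)

locale directed_colimit = directed_diagram C I r D
  for C :: "('o, 'm, 'z) cat_scheme" (structure) and I :: "'i set" and r and D +
  fixes z k
  assumes colimit: "is_colimit (posetcat I r) C D z k"
begin

lemma cocone: "is_cocone (posetcat I r) C D z k"
  using colimit by (simp add: is_colimit_def)

lemma z_ob [simp]: "z \<in> ob C"
  using is_coconeD[OF cocone] by simp

lemma k_ar [simp]: "i \<in> I \<Longrightarrow> k i \<in> ar C" "i \<in> I \<Longrightarrow> src C (k i) = omap D i" "i \<in> I \<Longrightarrow> tgt C (k i) = z"
  using is_coconeD(2)[OF cocone, of i] by (auto simp: homset_def)

lemma k_D [simp]: "(i, j) \<in> r \<Longrightarrow> k j \<cdot> amap D (i, j) = k i"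
  using is_coconeD(3)[OF cocone, of "(i, j)"] by simp

lemma k_D_tail [simp]:
  assumes "(i, j) \<in> r" "f \<in> ar C" "tgt C f = omap D i"
  shows "k j \<cdot> amap D (i, j) \<cdot> f = k i \<cdot> f"
  using cmp_tail[OF k_D[OF assms(1)], of f] assms le_in by simp

lemma k_eqI:
  assumes "u \<in> ar C" "v \<in> ar C" "src C u = z" "src C v = z" "tgt C u = tgt C v"
    and "\<And>i. i \<in> I \<Longrightarrow> u \<cdot> k i = v \<cdot> k i"
  shows "u = v"
  by (rule colimit_eqI[OF colimit category_axioms is_functor_diagram[OF D_functor]])
    (use assms in \<open>auto simp: homset_def\<close>)

lemma k_desc:
  assumes "w \<in> ob C" "\<And>i. i \<in> I \<Longrightarrow> c i \<in> homset C (omap D i) w"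
    and "\<And>i j. (i, j) \<in> r \<Longrightarrow> c j \<cdot> amap D (i, j) = c i"
  obtains u where "u \<in> ar C" "src C u = z" "tgt C u = w" "\<And>i. i \<in> I \<Longrightarrow> u \<cdot> k i = c i"
proof -
  have "is_cocone (posetcat I r) C D w c"
    using assms by (auto simp: is_cocone_def)
  from colimit_desc[OF colimit this] that show ?thesis
    unfolding homset_def by auto
qed

text \<open>If \<open>x\<close> is presentable, then \<open>C(x, z)\<close> is the colimit of the sets \<open>C(x, D i)\<close>; comparing it with
  the union of their images shows that every arrow factors, and comparing it with a two-element set
  shows that arrows that become equal in the colimit become equal at some stage.\<close>

context
  fixes U :: "'i rel" and l x
  assumes U: "inaccessible U" and small_homs: "locally_small U C"
    and small_I: "small U I" and dir: "directed_poset l I r" and x: "presentable U l C x"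
begin

private definition "H i = homset C x (omap D i)"
private definition "Z = homset C x z"
private definition "kk i = (H i, restrict (\<lambda>g. k i \<cdot> g) (H i), Z)"
private definition "DD = fcomp (hom_functor C x) D"

private lemma x_ob: "x \<in> ob C"
  using x by (simp add: presentable_def)

private lemma DD: "omap DD i = H i"
  "(i, j) \<in> r \<Longrightarrow> amap DD (i, j) = (H i, restrict (\<lambda>g. amap D (i, j) \<cdot> g) (H i), H j)"
  by (simp_all add: DD_def fcomp_def hom_functor_def H_def)

private lemma set_colimit: "is_colimit (posetcat I r) (setcat U) DD Z kk"
proof -
  have "is_colimit (posetcat I r) (setcat U) DD (omap (hom_functor C x) z) (\<lambda>i. amap (hom_functor C x) (k i))"
    unfolding DD_def using small_I dir D_functor colimit
    by (intro x[unfolded presentable_def, THEN conjunct2, rule_format]) simp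
  moreover have "omap (hom_functor C x) z = Z"
    by (simp add: hom_functor_def Z_def)
  moreover have "i \<in> I \<Longrightarrow> amap (hom_functor C x) (k i) = kk i" for i
    by (simp add: hom_functor_def Z_def kk_def H_def)
  ultimately show ?thesis
    unfolding is_colimit_def is_cocone_def by (simp add: le_in cong: ball_cong) (auto simp: le_in)
qed

private lemma small_H: "i \<in> I \<Longrightarrow> small U (H i)" and small_Z: "small U Z"
  using small_homs x_ob by (simp_all add: locally_small_def H_def Z_def)

private lemma H_D: "(i, j) \<in> r \<Longrightarrow> f \<in> H i \<Longrightarrow> amap D (i, j) \<cdot> f \<in> H j"
  by (auto simp: H_def homset_def)

private lemma H_k: "i \<in> I \<Longrightarrow> f \<in> H i \<Longrightarrow> k i \<cdot> f \<in> Z"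
  by (auto simp: H_def Z_def homset_def)

private lemma set_cocone:
  fixes W :: "'m set"
  assumes W: "small U W" and p: "\<And>i f. i \<in> I \<Longrightarrow> f \<in> H i \<Longrightarrow> p i f \<in> W"
    and eq: "\<And>i j f. (i, j) \<in> r \<Longrightarrow> f \<in> H i \<Longrightarrow> p j (amap D (i, j) \<cdot> f) = p i f"
  shows "is_cocone (posetcat I r) (setcat U) DD W (\<lambda>i. (H i, restrict (p i) (H i), W))"
  unfolding is_cocone_def
proof (intro conjI ballI)
  show "W \<in> ob (setcat U)" using W by (simp add: setcat_def)
  show "(H i, restrict (p i) (H i), W) \<in> homset (setcat U) (omap DD i) W" if "i \<in> ob (posetcat I r)" for i
    using W p that small_H by (auto simp: setcat_def homset_def DD)
  fix a assume "a \<in> ar (posetcat I r)"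
  then obtain i j where a: "a = (i, j)" "(i, j) \<in> r" by (cases a) auto
  show "(H (tgt (posetcat I r) a), restrict (p (tgt (posetcat I r) a)) (H (tgt (posetcat I r) a)), W)
      \<cdot>\<^bsub>setcat U\<^esub> amap DD a =
      (H (src (posetcat I r) a), restrict (p (src (posetcat I r) a)) (H (src (posetcat I r) a)), W)"
    using a H_D eq by (auto simp: DD setcat_def compose_def fun_eq_iff restrict_def)
qed

private lemma set_desc:
  fixes W :: "'m set"
  assumes W: "small U W" and p: "\<And>i f. i \<in> I \<Longrightarrow> f \<in> H i \<Longrightarrow> p i f \<in> W"
    and eq: "\<And>i j f. (i, j) \<in> r \<Longrightarrow> f \<in> H i \<Longrightarrow> p j (amap D (i, j) \<cdot> f) = p i f"
  shows "\<exists>u\<in>Z \<rightarrow>\<^sub>E W. \<forall>i\<in>I. \<forall>f\<in>H i. u (k i \<cdot> f) = p i f"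
proof -
  obtain v where v: "v \<in> homset (setcat U) Z W"
    "\<And>i. i \<in> I \<Longrightarrow> v \<cdot>\<^bsub>setcat U\<^esub> kk i = (H i, restrict (p i) (H i), W)"
    using colimit_desc[OF set_colimit set_cocone[OF W p eq]] by auto
  then obtain u where u: "v = (Z, u, W)" "u \<in> Z \<rightarrow>\<^sub>E W"
    by (auto simp: setcat_def homset_def)
  have "u (k i \<cdot> f) = p i f" if "i \<in> I" "f \<in> H i" for i f
  proof -
    have "compose (H i) u (restrict (\<lambda>g. k i \<cdot> g) (H i)) f = restrict (p i) (H i) f"
      using v(2)[OF that(1)] by (simp add: u setcat_def kk_def)
    then show ?thesis
      using that by (simp add: compose_def)
  qed
  then show ?thesis using u by blast
qed

lemma presentable_factor:
  assumes "f \<in> homset C x z"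
  obtains i g where "i \<in> I" "g \<in> homset C x (omap D i)" "k i \<cdot> g = f"
proof -
  define M where "M = (\<Union>i\<in>I. (\<lambda>g. k i \<cdot> g) ` H i)"
  have MZ: "M \<subseteq> Z" by (auto simp: M_def H_k)
  have M: "small U M" by (rule small_subset[OF small_Z MZ])
  have Dk: "k j \<cdot> amap D (i, j) \<cdot> f = k i \<cdot> f" if "(i, j) \<in> r" "f \<in> H i" for i j f
    using that by (simp add: H_def homset_def)
  have in_M: "k i \<cdot> f \<in> M" if "i \<in> I" "f \<in> H i" for i f
    using that by (auto simp: M_def)
  obtain u where u: "u \<in> Z \<rightarrow>\<^sub>E M" "\<And>i f. i \<in> I \<Longrightarrow> f \<in> H i \<Longrightarrow> u (k i \<cdot> f) = k i \<cdot> f"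
    using set_desc[OF M in_M Dk] by blast
  have P: "is_cocone (posetcat I r) (setcat U) DD Z kk"
    using set_colimit by (simp add: is_colimit_def)
  \<comment> \<open>Both \<open>u\<close>, seen as a map into \<open>Z\<close>, and the identity of
    \<open>Z\<close> mediate from the colimit cocone to itself. Uniqueness makes them equal, so
    \<open>Z\<close> is contained in \<open>M\<close>.\<close>
  then have "\<exists>!v. v \<in> homset (setcat U) Z Z \<and> (\<forall>i\<in>I. v \<cdot>\<^bsub>setcat U\<^esub> kk i = kk i)"
    using set_colimit by (simp add: is_colimit_def)
  moreover have "(Z, u, Z) \<in> homset (setcat U) Z Z" "(Z, restrict (\<lambda>a. a) Z, Z) \<in> homset (setcat U) Z Z"
    using u(1) MZ small_Z by (auto simp: setcat_def homset_def PiE_iff)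
  moreover have "\<forall>i\<in>I. (Z, u, Z) \<cdot>\<^bsub>setcat U\<^esub> kk i = kk i"
    using u by (auto simp: setcat_def kk_def compose_def fun_eq_iff restrict_def)
  moreover have "\<forall>i\<in>I. (Z, restrict (\<lambda>a. a) Z, Z) \<cdot>\<^bsub>setcat U\<^esub> kk i = kk i"
    using H_k by (auto simp: setcat_def kk_def compose_def fun_eq_iff restrict_def)
  ultimately have "u = restrict (\<lambda>a. a) Z"
    by blast
  then have "f \<in> M"
    using u(1) assms by (auto simp: Z_def[symmetric] PiE_iff)
  then show ?thesis
    using that by (auto simp: M_def H_def)
qed

lemma presentable_merge:
  assumes i: "i \<in> I" and g: "g \<in> homset C x (omap D i)" and h: "h \<in> homset C x (omap D i)"
    and eq: "k i \<cdot> g = k i \<cdot> h"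
  obtains n where "(i, n) \<in> r" "amap D (i, n) \<cdot> g = amap D (i, n) \<cdot> h"
proof (cases "g = h")
  case True
  then show ?thesis using that[of i] i by simp
next
  case False
  \<comment> \<open>\<open>P j f\<close> says that \<open>f\<close> and \<open>g\<close> represent
    the same element of the colimit of sets. It is invariant under the transition maps, so its
    characteristic function is a cocone.\<close>
  define P where "P j f \<longleftrightarrow> (\<exists>n. (i, n) \<in> r \<and> (j, n) \<in> r \<and> amap D (j, n) \<cdot> f = amap D (i, n) \<cdot> g)" for j f
  have g': "g \<in> ar C" "src C g = x" "tgt C g = omap D i"
    using g by (auto simp: homset_def)
  have P: "P j' (amap D (j, j') \<cdot> f) \<longleftrightarrow> P j f" if jj: "(j, j') \<in> r" and f: "f \<in> H j" for j j' f
  proof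
    have f': "f \<in> ar C" "tgt C f = omap D j"
      using f by (auto simp: H_def homset_def)
    show "P j f" if "P j' (amap D (j, j') \<cdot> f)"
      using that jj f' unfolding P_def by (metis D_cmp_tail le_trans)
    assume "P j f"
    then obtain n where n: "(i, n) \<in> r" "(j, n) \<in> r" "amap D (j, n) \<cdot> f = amap D (i, n) \<cdot> g"
      by (auto simp: P_def)
    obtain n' where n': "(n, n') \<in> r" "(j', n') \<in> r"
      using upper_bound[of n j'] n jj le_in by metis
    have "amap D (j', n') \<cdot> amap D (j, j') \<cdot> f = amap D (n, n') \<cdot> amap D (j, n) \<cdot> f"
      using n(1,2) n' jj f' by simp
    also have "\<dots> = amap D (i, n') \<cdot> g"
      unfolding n(3) using n(1) n' g' by simp
    finally show "P j' (amap D (j, j') \<cdot> f)"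
      unfolding P_def using n' le_trans[OF n(1) n'(1)] by blast
  qed
  \<comment> \<open>The sets of \<open>setcat\<close> here consist of arrows, so the distinct arrows
    \<open>g\<close> and \<open>h\<close> serve as the two truth values.\<close>
  let ?p = "\<lambda>j f. if P j f then g else h"
  have small: "small U {g, h}"
    by (rule small_countable[OF U]) simp
  have "\<exists>u\<in>Z \<rightarrow>\<^sub>E {g, h}. \<forall>j\<in>I. \<forall>f\<in>H j. u (k j \<cdot> f) = ?p j f"
    by (rule set_desc[OF small]) (simp_all add: P)
  then obtain u where u: "\<And>j f. j \<in> I \<Longrightarrow> f \<in> H j \<Longrightarrow> u (k j \<cdot> f) = ?p j f"
    by blast
  have "P i g"
    unfolding P_def using i by (intro exI[of _ i]) simp
  then have "g = u (k i \<cdot> g)"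
    using u[of i g] i g by (simp add: H_def)
  also have "\<dots> = ?p i h"
    unfolding eq using u[of i h] i h by (simp add: H_def)
  finally have "P i h"
    using False by (auto split: if_splits)
  then show ?thesis
    using that unfolding P_def by metis
qed

end

end

section \<open>Adjunctions from universal arrows\<close>

text \<open>The right adjoint is assembled from chosen universal arrows \<open>u y\<close>. The
  identities required of \<open>G\<close> and \<phi> rest on uniqueness of factorizations through
  them, isolated as \<open>\<phi>_eq\<close>.\<close>

lemma adjunction_universal:
  assumes F: "is_functor C D F"
    and univ: "\<And>y. y \<in> ob D \<Longrightarrow> \<exists>x\<in>ob C. \<exists>u\<in>homset D (omap F x) y.
      \<forall>x'\<in>ob C. \<forall>g\<in>homset D (omap F x') y. \<exists>!h. h \<in> homset C x' x \<and> u \<cdot>\<^bsub>D\<^esub> amap F h = g"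
  shows "\<exists>G \<phi>. adjunction C D F G \<phi>"
proof -
  interpret C: category C using F by (simp add: is_functor_def)
  interpret D: category D using F by (simp add: is_functor_def)
  obtain R u where R: "\<And>y. y \<in> ob D \<Longrightarrow> R y \<in> ob C"
    and u: "\<And>y. y \<in> ob D \<Longrightarrow> u y \<in> homset D (omap F (R y)) y"
    and ex1: "\<And>y x g. y \<in> ob D \<Longrightarrow> x \<in> ob C \<Longrightarrow> g \<in> homset D (omap F x) y \<Longrightarrow>
      \<exists>!h. h \<in> homset C x (R y) \<and> u y \<cdot>\<^bsub>D\<^esub> amap F h = g"
    using univ by metis
  define \<phi> where "\<phi> x y g = (THE h. h \<in> homset C x (R y) \<and> u y \<cdot>\<^bsub>D\<^esub> amap F h = g)" for x y g
  have \<phi>: "\<phi> x y g \<in> homset C x (R y)" "u y \<cdot>\<^bsub>D\<^esub> amap F (\<phi> x y g) = g"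
    if "y \<in> ob D" "x \<in> ob C" "g \<in> homset D (omap F x) y" for x y g
    using theI'[OF ex1[OF that]] by (simp_all add: \<phi>_def)
  have \<phi>_eq: "\<phi> x y g = h" if "y \<in> ob D" "h \<in> homset C x (R y)" "u y \<cdot>\<^bsub>D\<^esub> amap F h = g"
    "g \<in> homset D (omap F x) y" for x y g h
    unfolding \<phi>_def using that ex1[OF that(1) C.homset_arD(4)[OF that(2)] that(4)] by (intro the1_equality) auto
  have F_ob: "omap F x \<in> ob D" if "x \<in> ob C" for x
    using F that by (simp add: is_functor_def)
  have F_hom: "amap F h \<in> homset D (omap F x) (omap F x')" if "h \<in> homset C x x'" for h x x'
    using F that by (auto simp: is_functor_def homset_def)
  have F_cmp: "amap F (h' \<cdot>\<^bsub>C\<^esub> h) = amap F h' \<cdot>\<^bsub>D\<^esub> amap F h" if "h \<in> homset C x x'" "h' \<in> homset C x' x''" for h h' x x' x''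
    using F that by (auto simp: is_functor_def homset_def)
  define G where "G = \<lparr>omap = R, amap = (\<lambda>k. \<phi> (R (src D k)) (tgt D k) (k \<cdot>\<^bsub>D\<^esub> u (src D k)))\<rparr>"
  have G: "amap G k \<in> homset C (R y) (R y')" "u y' \<cdot>\<^bsub>D\<^esub> amap F (amap G k) = k \<cdot>\<^bsub>D\<^esub> u y"
    if k: "k \<in> homset D y y'" for k y y'
  proof -
    note y = D.homset_arD[OF k]
    have ku: "k \<cdot>\<^bsub>D\<^esub> u y \<in> homset D (omap F (R y)) y'"
      by (rule D.cmp_hom[OF u[OF y(4)] k])
    show "amap G k \<in> homset C (R y) (R y')" "u y' \<cdot>\<^bsub>D\<^esub> amap F (amap G k) = k \<cdot>\<^bsub>D\<^esub> u y"
      using \<phi>[OF y(5) R[OF y(4)] ku] y by (simp_all add: G_def)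
  qed
  have nat: "\<phi> x' y' (k \<cdot>\<^bsub>D\<^esub> g \<cdot>\<^bsub>D\<^esub> amap F h) = amap G k \<cdot>\<^bsub>C\<^esub> \<phi> x y g \<cdot>\<^bsub>C\<^esub> h"
    if h: "h \<in> homset C x' x" and g: "g \<in> homset D (omap F x) y" and k: "k \<in> homset D y y'" for x x' y y' h g k
  proof -
    note ob = C.homset_arD[OF h] D.homset_arD[OF g] D.homset_arD[OF k]
    have x: "x \<in> ob C" "x' \<in> ob C" and y: "y \<in> ob D" "y' \<in> ob D" using ob by auto
    note p = \<phi>[OF y(1) x(1) g]
    have ph: "\<phi> x y g \<cdot>\<^bsub>C\<^esub> h \<in> homset C x' (R y)"
      by (rule C.cmp_hom[OF h p(1)])
    have "u y' \<cdot>\<^bsub>D\<^esub> amap F (amap G k \<cdot>\<^bsub>C\<^esub> \<phi> x y g \<cdot>\<^bsub>C\<^esub> h) =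
        u y' \<cdot>\<^bsub>D\<^esub> amap F (amap G k) \<cdot>\<^bsub>D\<^esub> amap F (\<phi> x y g) \<cdot>\<^bsub>D\<^esub> amap F h"
      by (simp add: F_cmp[OF ph G(1)[OF k]] F_cmp[OF h p(1)])
    also have "\<dots> = (k \<cdot>\<^bsub>D\<^esub> u y) \<cdot>\<^bsub>D\<^esub> amap F (\<phi> x y g) \<cdot>\<^bsub>D\<^esub> amap F h"
      using D.cmp_assoc[OF D.cmp_hom[OF F_hom[OF h] F_hom[OF p(1)]] F_hom[OF G(1)[OF k]] u[OF y(2)]] G(2)[OF k]
      by simp
    also have "\<dots> = k \<cdot>\<^bsub>D\<^esub> (u y \<cdot>\<^bsub>D\<^esub> amap F (\<phi> x y g)) \<cdot>\<^bsub>D\<^esub> amap F h"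
      using D.cmp_assoc[OF D.cmp_hom[OF F_hom[OF h] F_hom[OF p(1)]] u[OF y(1)] k]
        D.cmp_assoc[OF F_hom[OF h] F_hom[OF p(1)] u[OF y(1)]] by simp
    finally have "u y' \<cdot>\<^bsub>D\<^esub> amap F (amap G k \<cdot>\<^bsub>C\<^esub> \<phi> x y g \<cdot>\<^bsub>C\<^esub> h) = k \<cdot>\<^bsub>D\<^esub> g \<cdot>\<^bsub>D\<^esub> amap F h"
      by (simp add: p(2))
    moreover have "k \<cdot>\<^bsub>D\<^esub> g \<cdot>\<^bsub>D\<^esub> amap F h \<in> homset D (omap F x') y'"
      by (rule D.cmp_hom[OF D.cmp_hom[OF F_hom[OF h] g] k])
    ultimately show ?thesis
      by (intro \<phi>_eq[OF y(2) C.cmp_hom[OF ph G(1)[OF k]]]) simp_all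
  qed
  have "is_functor D C G"
    unfolding is_functor_def
  proof (intro conjI ballI impI)
    show "category D" "category C" by unfold_locales
    show "\<And>y. y \<in> ob D \<Longrightarrow> omap G y \<in> ob C" using R by (simp add: G_def)
    show "\<And>k. k \<in> ar D \<Longrightarrow> amap G k \<in> homset C (omap G (src D k)) (omap G (tgt D k))"
      using G(1) D.ar_homset by (simp add: G_def)
    fix y assume y: "y \<in> ob D"
    have "\<phi> (R y) y (u y) = idn C (R y)"
      using F R[OF y] u[OF y] y
      by (intro \<phi>_eq C.idn_hom) (auto simp: is_functor_def homset_def)
    then show "amap G (idn D y) = idn C (omap G y)"
      using y u[OF y] by (simp add: G_def homset_def)
  next
    fix f g assume f: "f \<in> ar D" and g: "g \<in> ar D" and fg: "src D g = tgt D f"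
    let ?y = "src D f"
    have y: "?y \<in> ob D" using D.src_ob[OF f] .
    have gf: "g \<in> homset D (tgt D f) (tgt D g)" using g fg by (simp add: homset_def)
    have fu: "f \<cdot>\<^bsub>D\<^esub> u ?y \<in> homset D (omap F (R ?y)) (tgt D f)"
      by (rule D.cmp_hom[OF u[OF y] D.ar_homset[OF f]])
    have "amap G (g \<cdot>\<^bsub>D\<^esub> f) = \<phi> (R ?y) (tgt D g) (g \<cdot>\<^bsub>D\<^esub> f \<cdot>\<^bsub>D\<^esub> u ?y)"
      using f g fg u[OF y] by (simp add: G_def homset_def)
    \<comment> \<open>An identity is inserted so that preservation of composition becomes an
      instance of the naturality statement \<open>nat\<close>.\<close>
    also have "\<dots> = \<phi> (R ?y) (tgt D g) (g \<cdot>\<^bsub>D\<^esub> (f \<cdot>\<^bsub>D\<^esub> u ?y) \<cdot>\<^bsub>D\<^esub> amap F (idn C (R ?y)))"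
    proof -
      have "amap F (idn C (R ?y)) = idn D (omap F (R ?y))"
        using F R[OF y] by (simp add: is_functor_def)
      then show ?thesis
        using fu by (simp add: homset_def)
    qed
    also have "\<dots> = amap G g \<cdot>\<^bsub>C\<^esub> \<phi> (R ?y) (tgt D f) (f \<cdot>\<^bsub>D\<^esub> u ?y) \<cdot>\<^bsub>C\<^esub> idn C (R ?y)"
      by (rule nat[OF C.idn_hom[OF R[OF y]] fu gf])
    also have "\<dots> = amap G g \<cdot>\<^bsub>C\<^esub> amap G f"
      using \<phi>(1)[OF D.tgt_ob[OF f] R[OF y] fu] by (simp add: G_def homset_def)
    finally show "amap G (g \<cdot>\<^bsub>D\<^esub> f) = amap G g \<cdot>\<^bsub>C\<^esub> amap G f" .
  qed
  moreover have "bij_betw (\<phi> x y) (homset D (omap F x) y) (homset C x (omap G y))"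
    if x: "x \<in> ob C" and y: "y \<in> ob D" for x y
  proof (rule bij_betw_byWitness[where f' = "\<lambda>h. u y \<cdot>\<^bsub>D\<^esub> amap F h"])
    have uh: "u y \<cdot>\<^bsub>D\<^esub> amap F h \<in> homset D (omap F x) y" if "h \<in> homset C x (R y)" for h
      by (rule D.cmp_hom[OF F_hom[OF that] u[OF y]])
    show "\<forall>g\<in>homset D (omap F x) y. u y \<cdot>\<^bsub>D\<^esub> amap F (\<phi> x y g) = g"
      using \<phi>(2)[OF y x] by blast
    show "\<forall>h\<in>homset C x (omap G y). \<phi> x y (u y \<cdot>\<^bsub>D\<^esub> amap F h) = h"
      using \<phi>_eq[OF y _ refl] uh by (simp add: G_def)
    show "\<phi> x y ` homset D (omap F x) y \<subseteq> homset C x (omap G y)"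
      using \<phi>(1)[OF y x] by (auto simp: G_def)
    show "(\<lambda>h. u y \<cdot>\<^bsub>D\<^esub> amap F h) ` homset C x (omap G y) \<subseteq> homset D (omap F x) y"
      using uh by (auto simp: G_def)
  qed
  ultimately have "adjunction C D F G \<phi>"
    unfolding adjunction_def using F nat by blast
  then show ?thesis by blast
qed

section \<open>Tensor products of colimits\<close>

context braided_monoidal_closed_category
begin

lemma transp_cmp:
  assumes [simp]: "x \<in> ob V" "f \<in> ar V" and f: "src V f = a \<otimes> x" "tgt V f = y"
    and h [simp]: "h \<in> ar V" and ha: "tgt V h = a" "src V h = a'"
  shows "transp V x a y f \<cdot> h = transp V x a' y (f \<cdot> (h \<rhd> x))"
proof -
  have [simp]: "a \<in> ob V" "a' \<in> ob V" "y \<in> ob V"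
    using src_ob[of h] tgt_ob[of h] tgt_ob[of f] ha f by simp_all
  note [simp] = f ha
  show ?thesis
  proof (rule ev_cancel[of x y])
    have "ev V x y \<cdot> ((transp V x a y f \<cdot> h) \<rhd> x) = f \<cdot> (h \<rhd> x)"
      using cmp_tail[OF ev_transp[of x a f y], of "h \<rhd> x"] by simp
    then show "ev V x y \<cdot> ((transp V x a y f \<cdot> h) \<rhd> x) =
        ev V x y \<cdot> (transp V x a' y (f \<cdot> (h \<rhd> x)) \<rhd> x)"
      by (simp add: ev_transp)
  qed simp_all
qed

context
  fixes J :: "('j, 'k, 'y) cat_scheme" and D z k
  assumes colim: "is_colimit J V D z k" and diag: "diagram J V D"
begin

private lemma k [simp]: "j \<in> ob J \<Longrightarrow> k j \<in> ar V" "j \<in> ob J \<Longrightarrow> src V (k j) = omap D j"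
  "j \<in> ob J \<Longrightarrow> tgt V (k j) = z" "z \<in> ob V"
  using colim by (auto simp: is_colimit_def is_cocone_def homset_def)

private lemma D [simp]: "j \<in> ob J \<Longrightarrow> omap D j \<in> ob V" "a \<in> ar J \<Longrightarrow> amap D a \<in> ar V"
  "a \<in> ar J \<Longrightarrow> src V (amap D a) = omap D (src J a)" "a \<in> ar J \<Longrightarrow> tgt V (amap D a) = omap D (tgt J a)"
  "a \<in> ar J \<Longrightarrow> src J a \<in> ob J" "a \<in> ar J \<Longrightarrow> tgt J a \<in> ob J"
  using diag by (auto simp: diagram_def homset_def)

text \<open>As a left adjoint, tensoring with \<open>x\<close> on the right preserves colimits. This
  is the uniqueness half: transposing turns the claim into one about arrows out of
  \<open>z\<close>.\<close>

lemma tensor_right_eqI: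
  assumes [simp]: "x \<in> ob V" "u \<in> ar V" "v \<in> ar V" and t: "src V u = z \<otimes> x" "src V v = z \<otimes> x"
    "tgt V u = w" "tgt V v = w"
    and eq: "\<And>j. j \<in> ob J \<Longrightarrow> u \<cdot> (k j \<rhd> x) = v \<cdot> (k j \<rhd> x)"
  shows "u = v"
proof -
  note [simp] = t
  have "transp V x z w u = transp V x z w v"
  proof (rule colimit_eqI[OF colim category_axioms diag])
    show "transp V x z w u \<cdot> k j = transp V x z w v \<cdot> k j" if "j \<in> ob J" for j
      using that by (simp add: transp_cmp eq)
  qed (simp_all add: homset_def)
  from arg_cong[OF this, of "\<lambda>f. ev V x w \<cdot> (f \<rhd> x)"] show ?thesis
    by (simp add: ev_transp)
qed

lemma tensor_right_desc:
  assumes [simp]: "x \<in> ob V" and w [simp]: "w \<in> ob V"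
    and c: "\<And>j. j \<in> ob J \<Longrightarrow> c j \<in> homset V (omap D j \<otimes> x) w"
    and eq: "\<And>a. a \<in> ar J \<Longrightarrow> c (tgt J a) \<cdot> (amap D a \<rhd> x) = c (src J a)"
  obtains u where "u \<in> ar V" "src V u = z \<otimes> x" "tgt V u = w"
    "\<And>j. j \<in> ob J \<Longrightarrow> u \<cdot> (k j \<rhd> x) = c j"
proof -
  have [simp]: "c j \<in> ar V" "src V (c j) = omap D j \<otimes> x" "tgt V (c j) = w" if "j \<in> ob J" for j
    using c[OF that] by (simp_all add: homset_def)
  have "is_cocone J V D (hm x w) (\<lambda>j. transp V x (omap D j) w (c j))"
    by (simp add: is_cocone_def homset_def transp_cmp eq)
  then obtain v where v: "v \<in> homset V z (hm x w)" "\<And>j. j \<in> ob J \<Longrightarrow> v \<cdot> k j = transp V x (omap D j) w (c j)"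
    using colimit_desc[OF colim] by blast
  have [simp]: "v \<in> ar V" "src V v = z" "tgt V v = hm x w"
    using v(1) by (simp_all add: homset_def)
  show ?thesis
  proof (rule that[of "ev V x w \<cdot> (v \<rhd> x)"])
    show "(ev V x w \<cdot> (v \<rhd> x)) \<cdot> (k j \<rhd> x) = c j" if "j \<in> ob J" for j
      using that by (simp add: v(2) ev_transp)
  qed simp_all
qed

text \<open>Closedness is given for the right factor only; the braiding identifies x \<otimes> -
  with - \<otimes> x and so transfers preservation of colimits to the left factor.\<close>

lemma tensor_left_eqI:
  assumes [simp]: "x \<in> ob V" "u \<in> ar V" "v \<in> ar V" and t: "src V u = x \<otimes> z" "src V v = x \<otimes> z"
    "tgt V u = w" "tgt V v = w"
    and eq: "\<And>j. j \<in> ob J \<Longrightarrow> u \<cdot> (x \<lhd> k j) = v \<cdot> (x \<lhd> k j)"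
  shows "u = v"
proof (rule iso_epi[of "braid V z x"])
  note [simp] = t
  show "u \<cdot> braid V z x = v \<cdot> braid V z x"
  proof (rule tensor_right_eqI[of x])
    fix j assume j: "j \<in> ob J"
    have "(u \<cdot> braid V z x) \<cdot> (k j \<rhd> x) = u \<cdot> (x \<lhd> k j) \<cdot> braid V (omap D j) x"
      using j by (simp add: braid_nat)
    also have "\<dots> = v \<cdot> (x \<lhd> k j) \<cdot> braid V (omap D j) x"
      using j cmp_tail[OF eq[OF j], of "braid V (omap D j) x"] by simp
    also have "\<dots> = (v \<cdot> braid V z x) \<cdot> (k j \<rhd> x)"
      using j by (simp add: braid_nat)
    finally show "(u \<cdot> braid V z x) \<cdot> (k j \<rhd> x) = (v \<cdot> braid V z x) \<cdot> (k j \<rhd> x)" .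
  qed simp_all
qed (use t in simp_all)

lemma tensor_left_desc:
  assumes [simp]: "x \<in> ob V" and w [simp]: "w \<in> ob V"
    and c: "\<And>j. j \<in> ob J \<Longrightarrow> c j \<in> homset V (x \<otimes> omap D j) w"
    and eq: "\<And>a. a \<in> ar J \<Longrightarrow> c (tgt J a) \<cdot> (x \<lhd> amap D a) = c (src J a)"
  obtains u where "u \<in> ar V" "src V u = x \<otimes> z" "tgt V u = w"
    "\<And>j. j \<in> ob J \<Longrightarrow> u \<cdot> (x \<lhd> k j) = c j"
proof -
  have [simp]: "c j \<in> ar V" "src V (c j) = x \<otimes> omap D j" "tgt V (c j) = w" if "j \<in> ob J" for j
    using c[OF that] by (simp_all add: homset_def)
  have eq': "(c (tgt J a) \<cdot> braid V (omap D (tgt J a)) x) \<cdot> (amap D a \<rhd> x) =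
      c (src J a) \<cdot> braid V (omap D (src J a)) x" if a: "a \<in> ar J" for a
    using a cmp_tail[OF eq[OF a], of "braid V (omap D (src J a)) x"] by (simp add: braid_nat)
  obtain v where v [simp]: "v \<in> ar V" "src V v = z \<otimes> x" "tgt V v = w"
    "\<And>j. j \<in> ob J \<Longrightarrow> v \<cdot> (k j \<rhd> x) = c j \<cdot> braid V (omap D j) x"
    using tensor_right_desc[of x w "\<lambda>j. c j \<cdot> braid V (omap D j) x", OF _ _ _ eq'] by (auto simp: homset_def)
  have br: "is_iso V (braid V z x)" by simp
  note [simp] = inv_ar_simps(1-6)[OF br]
  show ?thesis
  proof (rule that[of "v \<cdot> inv_ar V (braid V z x)"])
    fix j assume j: "j \<in> ob J"
    show "(v \<cdot> inv_ar V (braid V z x)) \<cdot> (x \<lhd> k j) = c j"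
    proof (rule iso_epi[of "braid V (omap D j) x"])
      have "((v \<cdot> inv_ar V (braid V z x)) \<cdot> (x \<lhd> k j)) \<cdot> braid V (omap D j) x =
          v \<cdot> inv_ar V (braid V z x) \<cdot> braid V z x \<cdot> (k j \<rhd> x)"
        using j by (simp add: braid_nat)
      also have "\<dots> = c j \<cdot> braid V (omap D j) x"
        using j by (simp add: inv_ar_simps(7)[OF br])
      finally show "((v \<cdot> inv_ar V (braid V z x)) \<cdot> (x \<lhd> k j)) \<cdot> braid V (omap D j) x =
          c j \<cdot> braid V (omap D j) x" .
    qed (use j in simp_all)
  qed simp_all
qed

end

text \<open>Preservation in each variable separately gives a colimit over pairs of stages, and in a
  directed poset the diagonal is cofinal among pairs. The proof carries out this cofinality argument
  directly.\<close>

lemma directed_colimit_tensor: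
  assumes E: "directed_colimit V I r E e p" and F: "directed_colimit V I r F f q"
  shows "directed_colimit V I r
    \<lparr>omap = \<lambda>i. omap E i \<otimes> omap F i, amap = \<lambda>a. amap E a \<boxtimes> amap F a\<rparr> (e \<otimes> f) (\<lambda>i. p i \<boxtimes> q i)"
proof -
  interpret E: directed_colimit V I r E e p by fact
  interpret F: directed_colimit V I r F f q by fact
  let ?D = "\<lparr>omap = \<lambda>i. omap E i \<otimes> omap F i, amap = \<lambda>a. amap E a \<boxtimes> amap F a\<rparr>"
  note [simp] = E.le_in
  note Ec = E.colimit is_functor_diagram[OF E.D_functor] and Fc = F.colimit is_functor_diagram[OF F.D_functor]
  have "is_functor (posetcat I r) V ?D"
    using E.D_functor by (intro is_functor_posetcatI category_axioms) (auto simp: is_functor_def homset_def)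
  then interpret D: directed_diagram V I r ?D
    by (intro directed_diagram.intro category_axioms directed_diagram_axioms.intro E.directed)
  \<comment> \<open>Arrows out of e \<otimes> f are tested on p i \<otimes> q j with independent i
    and j, and each of these factors through the diagonal at a common upper bound.\<close>
  have eqI: "u = v" if [simp]: "u \<in> ar V" "v \<in> ar V" "src V u = e \<otimes> f" "src V v = e \<otimes> f" "tgt V u = tgt V v"
    and eq: "\<And>i. i \<in> I \<Longrightarrow> u \<cdot> (p i \<boxtimes> q i) = v \<cdot> (p i \<boxtimes> q i)" for u v
  proof (rule tensor_right_eqI[OF Ec, of f])
    fix i assume "i \<in> ob (posetcat I r)"
    then have i [simp]: "i \<in> I" by simp
    show "u \<cdot> (p i \<rhd> f) = v \<cdot> (p i \<rhd> f)"
    proof (rule tensor_left_eqI[OF Fc, of "omap E i"])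
      fix j assume "j \<in> ob (posetcat I r)"
      then have j [simp]: "j \<in> I" by simp
      obtain n where [simp]: "n \<in> I" "(i, n) \<in> r" "(j, n) \<in> r"
        using E.upper_bound[OF i j] .
      have "p i \<boxtimes> q j = (p n \<boxtimes> q n) \<cdot> (amap E (i, n) \<boxtimes> amap F (j, n))"
        by simp
      then have "u \<cdot> (p i \<boxtimes> q j) = v \<cdot> (p i \<boxtimes> q j)"
        using cmp_tail[OF eq[of n], of "amap E (i, n) \<boxtimes> amap F (j, n)"] by simp
      then show "(u \<cdot> (p i \<rhd> f)) \<cdot> ((omap E i) \<lhd> q j) = (v \<cdot> (p i \<rhd> f)) \<cdot> ((omap E i) \<lhd> q j)"
        by simp
    qed simp_all
  qed simp_all
  have "is_colimit (posetcat I r) V ?D (e \<otimes> f) (\<lambda>i. p i \<boxtimes> q i)"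
    unfolding is_colimit_def
  proof (intro conjI allI impI)
    show "is_cocone (posetcat I r) V ?D (e \<otimes> f) (\<lambda>i. p i \<boxtimes> q i)"
      unfolding is_cocone_def by (auto simp: homset_def)
    fix w c assume c: "is_cocone (posetcat I r) V ?D w c"
    have w [simp]: "w \<in> ob V" using is_coconeD(1)[OF c] .
    have c_ar [simp]: "c i \<in> ar V" "src V (c i) = omap E i \<otimes> omap F i" "tgt V (c i) = w" if "i \<in> I" for i
      using is_coconeD(2)[OF c, of i] that by (auto simp: homset_def)
    have c_D: "c n \<cdot> (amap E (i, n) \<boxtimes> amap F (i, n)) = c i" if "(i, n) \<in> r" for i n
      using is_coconeD(3)[OF c, of "(i, n)"] that by simp
    define ub where "ub i j = (SOME n. (i, n) \<in> r \<and> (j, n) \<in> r)" for i j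
    have ub [simp]: "(i, ub i j) \<in> r" "(j, ub i j) \<in> r" if "i \<in> I" "j \<in> I" for i j
      using someI_ex[of "\<lambda>n. (i, n) \<in> r \<and> (j, n) \<in> r"] E.upper_bound[OF that] unfolding ub_def by metis+
    \<comment> \<open>The cocone \<open>c\<close> is given on the diagonal. Its extension to the
      pair (i, j) is computed at a chosen upper bound, and \<open>b_eq\<close> shows that any other
      upper bound gives the same arrow.\<close>
    define b where "b i j = c (ub i j) \<cdot> (amap E (i, ub i j) \<boxtimes> amap F (j, ub i j))" for i j
    have b_eq: "b i j = c n \<cdot> (amap E (i, n) \<boxtimes> amap F (j, n))" if ij [simp]: "(i, n) \<in> r" "(j, n) \<in> r" for i j n
    proof -
      have [simp]: "i \<in> I" "j \<in> I" using E.le_in ij by blast+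
      define l where "l = ub i j"
      have l [simp]: "(i, l) \<in> r" "(j, l) \<in> r" by (simp_all add: l_def)
      obtain n' where n' [simp]: "(n, n') \<in> r" "(l, n') \<in> r"
        using E.upper_bound[of n l] E.le_in ij l by metis
      have [simp]: "n \<in> I" "l \<in> I" "n' \<in> I"
        using E.le_in ij l n' by blast+
      have "c n \<cdot> (amap E (i, n) \<boxtimes> amap F (j, n)) =
          c n' \<cdot> (amap E (n, n') \<boxtimes> amap F (n, n')) \<cdot> (amap E (i, n) \<boxtimes> amap F (j, n))"
        using cmp_tail[OF c_D[of n n'], of "amap E (i, n) \<boxtimes> amap F (j, n)"] by (simp del: tensor_cmp)
      also have "\<dots> = c n' \<cdot> (amap E (l, n') \<boxtimes> amap F (l, n')) \<cdot> (amap E (i, l) \<boxtimes> amap F (j, l))"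
        by simp
      also have "\<dots> = c l \<cdot> (amap E (i, l) \<boxtimes> amap F (j, l))"
        using cmp_tail[OF c_D[of l n'], of "amap E (i, l) \<boxtimes> amap F (j, l)"] by (simp del: tensor_cmp)
      finally show ?thesis
        by (simp add: b_def l_def)
    qed
    have b_ar [simp]: "b i j \<in> ar V" "src V (b i j) = omap E i \<otimes> omap F j" "tgt V (b i j) = w"
      if [simp]: "i \<in> I" "j \<in> I" for i j
      using E.le_in[OF ub(1)[OF that]] by (simp_all add: b_def)
    have b_D: "b i' j' \<cdot> (amap E (i, i') \<boxtimes> amap F (j, j')) = b i j" if ii [simp]: "(i, i') \<in> r" "(j, j') \<in> r" for i i' j j'
    proof -
      obtain n where n: "(i', n) \<in> r" "(j', n) \<in> r"
        using E.upper_bound[of i' j'] E.le_in ii by metis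
      note [simp] = n E.le_in[OF n(1)] E.le_in[OF n(2)] E.le_in[OF ii(1)] E.le_in[OF ii(2)]
      show ?thesis
        using b_eq[OF n] b_eq[OF E.le_trans[OF ii(1) n(1)] E.le_trans[OF ii(2) n(2)]] by simp
    qed
    \<comment> \<open>The colimit is taken in the second variable for each fixed i; the resulting
      arrows \<open>g i\<close> form a cocone in the first variable.\<close>
    have "\<exists>u. u \<in> ar V \<and> src V u = omap E i \<otimes> f \<and> tgt V u = w \<and>
        (\<forall>j\<in>I. u \<cdot> ((omap E i) \<lhd> q j) = b i j)" if [simp]: "i \<in> I" for i
    proof (rule tensor_left_desc[OF Fc, of "omap E i" w "b i"])
      show "b i (tgt (posetcat I r) a) \<cdot> ((omap E i) \<lhd> amap F a) = b i (src (posetcat I r) a)"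
        if "a \<in> ar (posetcat I r)" for a
        using b_D[of i i "fst a" "snd a"] that by simp
    qed (auto simp: homset_def)
    then obtain g where g [simp]: "\<And>i. i \<in> I \<Longrightarrow> g i \<in> ar V" "\<And>i. i \<in> I \<Longrightarrow> src V (g i) = omap E i \<otimes> f"
      "\<And>i. i \<in> I \<Longrightarrow> tgt V (g i) = w" "\<And>i j. i \<in> I \<Longrightarrow> j \<in> I \<Longrightarrow> g i \<cdot> ((omap E i) \<lhd> q j) = b i j"
      by metis
    have g_D: "g i' \<cdot> (amap E (i, i') \<rhd> f) = g i" if ii: "(i, i') \<in> r" for i i'
    proof (rule tensor_left_eqI[OF Fc, of "omap E i"])
      note [simp] = ii E.le_in[OF ii]
      fix j assume "j \<in> ob (posetcat I r)"
      then have [simp]: "j \<in> I" by simp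
      have "(g i' \<cdot> (amap E (i, i') \<rhd> f)) \<cdot> ((omap E i) \<lhd> q j) =
          g i' \<cdot> ((omap E i') \<lhd> q j) \<cdot> (amap E (i, i') \<rhd> (omap F j))"
        by simp
      also have "\<dots> = b i' j \<cdot> (amap E (i, i') \<rhd> (omap F j))"
        using cmp_tail[OF g(4)[of i' j], of "amap E (i, i') \<rhd> (omap F j)"] by (simp del: tensor_cmp)
      also have "\<dots> = b i j"
        using b_D[of i i' j j] by simp
      finally show "(g i' \<cdot> (amap E (i, i') \<rhd> f)) \<cdot> ((omap E i) \<lhd> q j) =
          g i \<cdot> ((omap E i) \<lhd> q j)"
        by simp
    qed (use ii E.le_in[OF ii] in simp_all)
    have "\<exists>u. u \<in> ar V \<and> src V u = e \<otimes> f \<and> tgt V u = w \<and> (\<forall>i\<in>I. u \<cdot> (p i \<rhd> f) = g i)"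
      by (rule tensor_right_desc[OF Ec, of f w g]) (auto simp: homset_def g_D)
    then obtain u where u [simp]: "u \<in> ar V" "src V u = e \<otimes> f" "tgt V u = w"
      "\<And>i. i \<in> I \<Longrightarrow> u \<cdot> (p i \<rhd> f) = g i"
      by blast
    have uc: "u \<cdot> (p i \<boxtimes> q i) = c i" if [simp]: "i \<in> I" for i
    proof -
      have "u \<cdot> (p i \<boxtimes> q i) = u \<cdot> (p i \<rhd> f) \<cdot> ((omap E i) \<lhd> q i)"
        by simp
      also have "\<dots> = b i i"
        using cmp_tail[OF u(4)[of i], of "(omap E i) \<lhd> q i"] by (simp del: tensor_cmp)
      also have "\<dots> = c i"
        using b_eq[of i i i] by simp
      finally show ?thesis .
    qed
    show "\<exists>!u. u \<in> homset V (e \<otimes> f) w \<and> (\<forall>j\<in>ob (posetcat I r). u \<cdot> (p j \<boxtimes> q j) = c j)"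
      using uc by (intro ex1I[of _ u]) (auto simp: homset_def intro: eqI)
  qed
  then show ?thesis
    by (intro directed_colimit.intro D.directed_diagram_axioms directed_colimit_axioms.intro)
qed

end

section \<open>Colimits of measuring comonoids\<close>

locale measurings = braided_monoidal_closed_category V
  for V :: "('o, 'm, 'z) brccat_scheme" (structure) +
  fixes a ma ia b mb ib
  assumes A: "is_monoid V (a, ma, ia)" and B: "is_monoid V (b, mb, ib)"
begin

abbreviation "meas \<equiv> measuring (a, ma, ia) (b, mb, ib)"

lemmas A_simps [simp] = monoidD(1-7)[OF A]
lemmas B_simps [simp] = monoidD(1-7)[OF B]

text \<open>With \<open>meas_hom\<close>, this is the category of elements of C |-> Mon(A, [C, B]).
  It gets no \<open>cat\<close> record of its own, since the colimits below are formed in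
  \<open>V\<close> on the underlying objects.\<close>

definition meas_ob where
  "meas_ob X \<longleftrightarrow> (case X of (c, d, e, f) \<Rightarrow> is_comonoid V (c, d, e) \<and> meas (c, d, e) f)"

definition meas_hom where
  "meas_hom X Y h \<longleftrightarrow> (case X of (c, d, e, f) \<Rightarrow> case Y of (c', d', e', f') \<Rightarrow>
    is_comonoid_hom V (c, d, e) (c', d', e') h \<and> f' \<cdot> (a \<lhd> h) = f)"

lemma meas_obD:
  assumes "meas_ob (c, d, e, f)"
  shows "is_comonoid V (c, d, e)" "meas (c, d, e) f"
    "c \<in> ob V" "d \<in> ar V" "src V d = c" "tgt V d = c \<otimes> c" "e \<in> ar V" "src V e = c" "tgt V e = \<I>"
    "f \<in> ar V" "src V f = a \<otimes> c" "tgt V f = b"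
proof -
  show c: "is_comonoid V (c, d, e)" and f: "meas (c, d, e) f"
    using assms by (auto simp: meas_ob_def)
  show "c \<in> ob V" "d \<in> ar V" "src V d = c" "tgt V d = c \<otimes> c" "e \<in> ar V" "src V e = c" "tgt V e = \<I>"
    "f \<in> ar V" "src V f = a \<otimes> c" "tgt V f = b"
    using comonoidD[OF c] measuringD[OF f] by simp_all
qed

lemma meas_homD:
  assumes "meas_hom (c, d, e, f) (c', d', e', f') h"
  shows "is_comonoid_hom V (c, d, e) (c', d', e') h" "h \<in> ar V" "src V h = c" "tgt V h = c'"
    "d' \<cdot> h = (h \<boxtimes> h) \<cdot> d" "e' \<cdot> h = e" "f' \<cdot> (a \<lhd> h) = f"
  using assms comonoid_homD[of c d e c' d' e' h] by (auto simp: meas_hom_def)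

lemma meas_homI:
  assumes "h \<in> ar V" "src V h = c" "tgt V h = c'"
    "d' \<cdot> h = (h \<boxtimes> h) \<cdot> d" "e' \<cdot> h = e" "f' \<cdot> (a \<lhd> h) = f"
  shows "meas_hom (c, d, e, f) (c', d', e', f') h"
  using assms by (auto simp: meas_hom_def intro: comonoid_homI)

lemma meas_hom_cmp:
  assumes X: "meas_ob X" "meas_ob Y" "meas_ob Z" and h: "meas_hom X Y h" and h': "meas_hom Y Z h'"
  shows "meas_hom X Z (h' \<cdot> h)"
proof -
  obtain c d e f c' d' e' f' c'' d'' e'' f'' where
    eq: "X = (c, d, e, f)" "Y = (c', d', e', f')" "Z = (c'', d'', e'', f'')"
    by (metis prod_cases4)
  note X = X[unfolded eq] and h = h[unfolded eq] and h' = h'[unfolded eq]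
  note [simp] = meas_obD(3-)[OF X(1)] meas_obD(3-)[OF X(2)] meas_obD(3-)[OF X(3)]
    meas_homD(2-4)[OF h] meas_homD(2-4)[OF h']
  have "f'' \<cdot> (a \<lhd> (h' \<cdot> h)) = (f'' \<cdot> (a \<lhd> h')) \<cdot> (a \<lhd> h)"
    by simp
  then have "f'' \<cdot> (a \<lhd> (h' \<cdot> h)) = f"
    unfolding meas_homD(7)[OF h'] meas_homD(7)[OF h] .
  then show ?thesis
    using comonoid_hom_cmp[OF meas_obD(1)[OF X(1)] meas_obD(1)[OF X(2)] meas_obD(1)[OF X(3)]
        meas_homD(1)[OF h] meas_homD(1)[OF h']]
    unfolding eq by (simp add: meas_hom_def)
qed

lemma meas_hom_ar:
  assumes "meas_hom X Y h"
  shows "h \<in> ar V" "src V h = fst X" "tgt V h = fst Y" "h \<in> homset V (fst X) (fst Y)"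
  using assms by (auto simp: meas_hom_def is_comonoid_hom_def homset_def split: prod.splits)

lemma meas_ob_ob: "meas_ob X \<Longrightarrow> fst X \<in> ob V"
  by (auto simp: meas_ob_def is_comonoid_def)

text \<open>Comultiplication and counit are induced on the colimit \<open>z\<close>, the measuring
  on a \<otimes> z, which is again a colimit. Every law equates arrows out of \<open>z\<close> or of
  \<open>z\<close> tensored with a fixed object, so it may be checked on the legs, where it is the
  law of \<open>X j\<close>.\<close>

lemma meas_colimit:
  assumes colim: "is_colimit J V D z k"
    and J: "\<And>g. g \<in> ar J \<Longrightarrow> src J g \<in> ob J" "\<And>g. g \<in> ar J \<Longrightarrow> tgt J g \<in> ob J"
    and X: "\<And>j. j \<in> ob J \<Longrightarrow> meas_ob (X j)" "\<And>j. j \<in> ob J \<Longrightarrow> omap D j = fst (X j)"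
    and h: "\<And>g. g \<in> ar J \<Longrightarrow> meas_hom (X (src J g)) (X (tgt J g)) (amap D g)"
  obtains d e f where "meas_ob (z, d, e, f)" "\<And>j. j \<in> ob J \<Longrightarrow> meas_hom (X j) (z, d, e, f) (k j)"
proof -
  define C where "C j = fst (X j)" for j
  define d where "d j = fst (snd (X j))" for j
  define e where "e j = fst (snd (snd (X j)))" for j
  define f where "f j = snd (snd (snd (X j)))" for j
  have X_eq: "X j = (C j, d j, e j, f j)" for j
    by (simp add: C_def d_def e_def f_def)
  note X = X[unfolded X_eq] and h = h[unfolded X_eq]
  have diag: "diagram J V D"
    using J X(2) meas_obD(3)[OF X(1)] meas_homD(2-4)[OF h] by (simp add: diagram_def homset_def)
  note Dj = X(2)[unfolded fst_conv]
  note [simp] = meas_obD(3-)[OF X(1)] meas_homD(2-4)[OF h] J Dj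
  have k [simp]: "j \<in> ob J \<Longrightarrow> k j \<in> ar V" "j \<in> ob J \<Longrightarrow> src V (k j) = C j"
    "j \<in> ob J \<Longrightarrow> tgt V (k j) = z" "z \<in> ob V" for j
    using is_coconeD(1,2)[OF colimit_cocone[OF colim]] by (simp_all add: homset_def)
  have kD: "k (tgt J g) \<cdot> amap D g = k (src J g)" if "g \<in> ar J" for g
    using is_coconeD(3)[OF colimit_cocone[OF colim] that] .
  have "is_cocone J V D (z \<otimes> z) (\<lambda>j. (k j \<boxtimes> k j) \<cdot> d j)"
    by (simp add: is_cocone_def homset_def meas_homD(5)[OF h] kD)
  then obtain dz where "dz \<in> homset V z (z \<otimes> z)" and dz: "\<And>j. j \<in> ob J \<Longrightarrow> dz \<cdot> k j = (k j \<boxtimes> k j) \<cdot> d j"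
    using colimit_desc[OF colim] by blast
  then have [simp]: "dz \<in> ar V" "src V dz = z" "tgt V dz = z \<otimes> z"
    by (simp_all add: homset_def)
  have "is_cocone J V D \<I> e"
    by (simp add: is_cocone_def homset_def meas_homD(6)[OF h])
  then obtain ez where "ez \<in> homset V z \<I>" and ez: "\<And>j. j \<in> ob J \<Longrightarrow> ez \<cdot> k j = e j"
    using colimit_desc[OF colim] by blast
  then have [simp]: "ez \<in> ar V" "src V ez = z" "tgt V ez = \<I>"
    by (simp_all add: homset_def)
  have "\<exists>fz. fz \<in> ar V \<and> src V fz = a \<otimes> z \<and> tgt V fz = b \<and> (\<forall>j\<in>ob J. fz \<cdot> (a \<lhd> k j) = f j)"
    by (rule tensor_left_desc[OF colim diag, of a b f]) (auto simp: homset_def meas_homD(7)[OF h])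
  then obtain fz where [simp]: "fz \<in> ar V" "src V fz = a \<otimes> z" "tgt V fz = b"
    and fz: "\<And>j. j \<in> ob J \<Longrightarrow> fz \<cdot> (a \<lhd> k j) = f j"
    by blast
  have eqI: "u = v" if "u \<in> ar V" "v \<in> ar V" "src V u = z" "src V v = z" "tgt V u = tgt V v"
    "\<And>j. j \<in> ob J \<Longrightarrow> u \<cdot> k j = v \<cdot> k j" for u v
    by (rule colimit_eqI[OF colim category_axioms diag]) (use that in \<open>simp_all add: homset_def\<close>)
  have com: "is_comonoid V (z, dz, ez)"
  proof (rule comonoidI)
    show "\<alpha> z z z \<cdot> (dz \<rhd> z) \<cdot> dz = (z \<lhd> dz) \<cdot> dz"
    proof (rule eqI)
      fix j assume [simp]: "j \<in> ob J"
      have "(\<alpha> z z z \<cdot> (dz \<rhd> z) \<cdot> dz) \<cdot> k j = \<alpha> z z z \<cdot> ((k j \<boxtimes> k j) \<boxtimes> k j) \<cdot> (d j \<rhd> (C j)) \<cdot> d j"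
        by (simp add: dz)
      also have "\<dots> = (k j \<boxtimes> (k j \<boxtimes> k j)) \<cdot> \<alpha> (C j) (C j) (C j) \<cdot> (d j \<rhd> (C j)) \<cdot> d j"
        using cmp_tail[OF assoc_nat[of "k j" "k j" "k j" z z z], of "(d j \<rhd> (C j)) \<cdot> d j"]
        by (simp del: tensor_cmp_tail)
      also have "\<dots> = ((z \<lhd> dz) \<cdot> dz) \<cdot> k j"
        by (simp add: comonoidD(8)[OF meas_obD(1)[OF X(1)]] dz)
      finally show "(\<alpha> z z z \<cdot> (dz \<rhd> z) \<cdot> dz) \<cdot> k j = ((z \<lhd> dz) \<cdot> dz) \<cdot> k j" .
    qed simp_all
    show "lunit V z \<cdot> (ez \<rhd> z) \<cdot> dz = idn V z"
    proof (rule eqI)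
      fix j assume [simp]: "j \<in> ob J"
      have "(lunit V z \<cdot> (ez \<rhd> z) \<cdot> dz) \<cdot> k j = lunit V z \<cdot> (\<I> \<lhd> k j) \<cdot> (e j \<rhd> (C j)) \<cdot> d j"
        by (simp add: dz ez)
      also have "\<dots> = k j \<cdot> lunit V (C j) \<cdot> (e j \<rhd> (C j)) \<cdot> d j"
        using cmp_tail[OF lunit_nat[of "k j" z], of "(e j \<rhd> (C j)) \<cdot> d j"] by (simp del: tensor_cmp_tail)
      finally show "(lunit V z \<cdot> (ez \<rhd> z) \<cdot> dz) \<cdot> k j = idn V z \<cdot> k j"
        by (simp add: comonoidD(9)[OF meas_obD(1)[OF X(1)]])
    qed simp_all
    show "runit V z \<cdot> (z \<lhd> ez) \<cdot> dz = idn V z"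
    proof (rule eqI)
      fix j assume [simp]: "j \<in> ob J"
      have "(runit V z \<cdot> (z \<lhd> ez) \<cdot> dz) \<cdot> k j = runit V z \<cdot> (k j \<rhd> \<I>) \<cdot> ((C j) \<lhd> e j) \<cdot> d j"
        by (simp add: dz ez)
      also have "\<dots> = k j \<cdot> runit V (C j) \<cdot> ((C j) \<lhd> e j) \<cdot> d j"
        using cmp_tail[OF runit_nat[of "k j" z], of "((C j) \<lhd> e j) \<cdot> d j"] by (simp del: tensor_cmp_tail)
      finally show "(runit V z \<cdot> (z \<lhd> ez) \<cdot> dz) \<cdot> k j = idn V z \<cdot> k j"
        by (simp add: comonoidD(10)[OF meas_obD(1)[OF X(1)]])
    qed simp_all
  qed simp_all
  have hom: "is_comonoid_hom V (C j, d j, e j) (z, dz, ez) (k j)" if "j \<in> ob J" for j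
    using that by (intro comonoid_homI) (simp_all add: dz ez)
  have "meas (z, dz, ez) fz"
  proof (rule measuringI)
    note [simp] = conv_ar[OF B com, of a a fz fz]
    show "fz \<cdot> (ma \<rhd> z) = conv mb dz z a a fz fz"
    \<comment> \<open>The legs are already known to be comonoid morphisms, so
      \<open>conv_comonoid_hom\<close> computes the convolution product along each of them.\<close>
    proof (rule tensor_left_eqI[OF colim diag, of "a \<otimes> a"])
      fix j assume j [simp]: "j \<in> ob J"
      have "(fz \<cdot> (ma \<rhd> z)) \<cdot> ((a \<otimes> a) \<lhd> k j) = fz \<cdot> (a \<lhd> k j) \<cdot> (ma \<rhd> (C j))"
        by simp
      also have "\<dots> = conv mb (d j) (C j) a a (f j) (f j)"
        using cmp_tail[OF fz[OF j], of "ma \<rhd> (C j)"] measuringD(4)[OF meas_obD(2)[OF X(1)[OF j]]]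
        by (simp del: tensor_cmp)
      also have "\<dots> = conv mb dz z a a fz fz \<cdot> ((a \<otimes> a) \<lhd> k j)"
        using conv_comonoid_hom[OF B com meas_obD(1)[OF X(1)[OF j]] hom[OF j], of fz a fz a] by (simp add: fz)
      finally show "(fz \<cdot> (ma \<rhd> z)) \<cdot> ((a \<otimes> a) \<lhd> k j) =
          conv mb dz z a a fz fz \<cdot> ((a \<otimes> a) \<lhd> k j)" .
    qed simp_all
    show "fz \<cdot> (ia \<rhd> z) = ib \<cdot> ez \<cdot> lunit V z"
    proof (rule tensor_left_eqI[OF colim diag, of \<I>])
      fix j assume j [simp]: "j \<in> ob J"
      have "(fz \<cdot> (ia \<rhd> z)) \<cdot> (\<I> \<lhd> k j) = fz \<cdot> (a \<lhd> k j) \<cdot> (ia \<rhd> (C j))"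
        by simp
      also have "\<dots> = ib \<cdot> e j \<cdot> lunit V (C j)"
        using cmp_tail[OF fz[OF j], of "ia \<rhd> (C j)"] measuringD(5)[OF meas_obD(2)[OF X(1)[OF j]]]
        by (simp del: tensor_cmp)
      also have "\<dots> = (ib \<cdot> ez \<cdot> lunit V z) \<cdot> (\<I> \<lhd> k j)"
        using cmp_tail[OF ez[OF j], of "lunit V (C j)"] by (simp add: lunit_nat)
      finally show "(fz \<cdot> (ia \<rhd> z)) \<cdot> (\<I> \<lhd> k j) = (ib \<cdot> ez \<cdot> lunit V z) \<cdot> (\<I> \<lhd> k j)" .
    qed simp_all
  qed simp_all
  with com have "meas_ob (z, dz, ez, fz)"
    by (simp add: meas_ob_def)
  moreover have "meas_hom (X j) (z, dz, ez, fz) (k j)" if "j \<in> ob J" for j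
    unfolding X_eq using that by (intro meas_homI) (simp_all add: dz ez fz)
  ultimately show ?thesis using that by blast
qed

lemma meas_colimit_exists:
  assumes U: "inaccessible U" "cocomplete U V" and J: "small U (ob J)" "small U (ar J)"
      "\<And>g. g \<in> ar J \<Longrightarrow> src J g \<in> ob J" "\<And>g. g \<in> ar J \<Longrightarrow> tgt J g \<in> ob J"
    and X: "\<And>j. j \<in> ob J \<Longrightarrow> meas_ob (X j)"
    and h: "\<And>g. g \<in> ar J \<Longrightarrow> meas_hom (X (src J g)) (X (tgt J g)) (h g)"
  obtains Z k where "meas_ob Z" "\<And>j. j \<in> ob J \<Longrightarrow> meas_hom (X j) Z (k j)"
    "is_colimit J V \<lparr>omap = fst \<circ> X, amap = h\<rparr> (fst Z) k" "diagram J V \<lparr>omap = fst \<circ> X, amap = h\<rparr>"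
proof -
  let ?D = "\<lparr>omap = fst \<circ> X, amap = h\<rparr>"
  have diag: "diagram J V ?D"
    using X J(3,4) meas_hom_ar(4)[OF h] meas_ob_ob by (auto simp: diagram_def)
  then obtain z k where zk: "is_colimit J V ?D z k"
    using graph_colimit[OF U(1) category_axioms U(2) J(1,2)] by blast
  obtain d e f where "meas_ob (z, d, e, f)" "\<And>j. j \<in> ob J \<Longrightarrow> meas_hom (X j) (z, d, e, f) (k j)"
    by (rule meas_colimit[OF zk J(3,4) X]) (use h in auto)
  then show ?thesis
    using that[of "(z, d, e, f)" k] zk diag by simp
qed

text \<open>Freyd's argument: the joint coequalizer of the endomorphisms of a weakly terminal object is terminal.\<close>

lemma terminal_if_weakly_terminal:
  assumes U: "inaccessible U" "cocomplete U V" "locally_small U V"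
    and T: "meas_ob T" and weak: "\<And>X. meas_ob X \<Longrightarrow> \<exists>h. meas_hom X T h"
  shows "\<exists>Q. meas_ob Q \<and> (\<forall>X. meas_ob X \<longrightarrow> (\<exists>!h. meas_hom X Q h))"
proof -
  let ?E = "{h. meas_hom T T h}"
  have small: "small U ?E"
  proof (rule small_subset)
    show "small U (homset V (fst T) (fst T))"
      using U(3) meas_ob_ob[OF T] by (simp add: locally_small_def)
    show "?E \<subseteq> homset V (fst T) (fst T)"
      using meas_hom_ar(4) by blast
  qed
  \<comment> \<open>A graph with a single vertex and the endomorphisms of \<open>T\<close> as its
    edges: the cocone condition says that the leg absorbs every endomorphism.\<close>
  obtain Q k where Q: "meas_ob Q" and k: "meas_hom T Q (k ())"
    and colim: "is_colimit (graph {()} ?E (\<lambda>_. ()) (\<lambda>_. ())) V \<lparr>omap = fst \<circ> (\<lambda>_. T), amap = id\<rparr> (fst Q) k"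
      "diagram (graph {()} ?E (\<lambda>_. ()) (\<lambda>_. ())) V \<lparr>omap = fst \<circ> (\<lambda>_. T), amap = id\<rparr>"
    by (rule meas_colimit_exists[OF U(1,2), of "graph {()} ?E (\<lambda>_. ()) (\<lambda>_. ())" "\<lambda>_. T" id])
      (use small T small_countable[OF U(1), of "{()}"] in auto)
  define q where "q = k ()"
  have q: "meas_hom T Q q" using k by (simp add: q_def)
  note qa [simp] = meas_hom_ar(1-3)[OF q]
  have coeq: "q \<cdot> s = q" if "meas_hom T T s" for s
    using is_coconeD(3)[OF colimit_cocone[OF colim(1)], of s] that by (simp add: q_def)
  have epi: "u = v" if "u \<cdot> q = v \<cdot> q" "u \<in> homset V (fst Q) w" "v \<in> homset V (fst Q) w" for u v w
    by (rule colimit_eqI[OF colim(1) category_axioms colim(2)]) (use that in \<open>simp_all add: q_def\<close>)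
  have "g = h" if X: "meas_ob X" and g: "meas_hom X Q g" and h: "meas_hom X Q h" for X g h
  proof -
    \<comment> \<open>Vertex \<open>False\<close> carries \<open>X\<close>, vertex
      \<open>True\<close> carries \<open>Q\<close>, and the two edges from \<open>False\<close> to
      \<open>True\<close> carry \<open>g\<close> and \<open>h\<close>; the colimit is their
      coequalizer.\<close>
    let ?X = "\<lambda>b. if b then Q else X"
    let ?G = "graph UNIV UNIV (\<lambda>_ :: bool. False) (\<lambda>_ :: bool. True)"
    have "\<exists>E k'. meas_ob E \<and> (\<forall>j. meas_hom (?X j) E (k' j)) \<and>
        is_colimit ?G V \<lparr>omap = fst \<circ> ?X, amap = \<lambda>b. if b then g else h\<rparr> (fst E) k'"
    proof (rule meas_colimit_exists[OF U(1,2), of ?G ?X "\<lambda>b. if b then g else h"])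
      show "small U (ob ?G)" "small U (ar ?G)"
        by (rule small_countable[OF U(1)], simp)+
      fix E k'
      assume "meas_ob E" and "\<And>j. j \<in> ob ?G \<Longrightarrow> meas_hom (?X j) E (k' j)"
        and "is_colimit ?G V \<lparr>omap = fst \<circ> ?X, amap = \<lambda>b. if b then g else h\<rparr> (fst E) k'"
      then show "\<exists>E k'. meas_ob E \<and> (\<forall>j. meas_hom (?X j) E (k' j)) \<and>
        is_colimit ?G V \<lparr>omap = fst \<circ> ?X, amap = \<lambda>b. if b then g else h\<rparr> (fst E) k'"
        by (intro exI[of _ E] exI[of _ k']) simp
    qed (use X Q g h in simp_all)
    then obtain E k' where E: "meas_ob E" and k': "\<And>j. meas_hom (?X j) E (k' j)"
      and colim': "is_colimit ?G V \<lparr>omap = fst \<circ> ?X, amap = \<lambda>b. if b then g else h\<rparr> (fst E) k'"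
      by blast
    define e where "e = k' True"
    have e: "meas_hom Q E e" using k'[of True] by (simp add: e_def)
    have "k' True \<cdot> (if c then g else h) = k' False" for c
      using is_coconeD(3)[OF colimit_cocone[OF colim'], of c] by simp
    from this[of True] this[of False] have eq: "e \<cdot> g = e \<cdot> h"
      by (simp add: e_def)
    obtain s where s: "meas_hom E T s" using weak[OF E] by blast
    note [simp] = meas_hom_ar(1-3)[OF e] meas_hom_ar(1-3)[OF s] meas_hom_ar(1-3)[OF g] meas_hom_ar(1-3)[OF h]
      meas_ob_ob[OF Q]
    \<comment> \<open>Going from \<open>T\<close> through \<open>Q\<close> and the coequalizer
      \<open>E\<close> back to \<open>T\<close> is an endomorphism, hence absorbed by
      \<open>q\<close>. As \<open>q\<close> is epi, \<open>e\<close> has the left inverse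
      \<open>q \<cdot> s\<close>, and \<open>e \<cdot> g = e \<cdot> h\<close> yields
      \<open>g = h\<close>.\<close>
    have "meas_hom T T (s \<cdot> e \<cdot> q)"
      using meas_hom_cmp[OF T E T meas_hom_cmp[OF T Q E q e] s] .
    then have "q \<cdot> s \<cdot> e \<cdot> q = q"
      by (rule coeq)
    then have 1: "q \<cdot> s \<cdot> e = idn V (fst Q)"
      by - (rule epi[of _ _ "fst Q"], simp_all add: homset_def)
    have "(q \<cdot> s) \<cdot> e \<cdot> g = (q \<cdot> s) \<cdot> e \<cdot> h"
      unfolding eq ..
    then show ?thesis
      using cmp_tail[OF 1, of g] cmp_tail[OF 1, of h] by simp
  qed
  moreover have "\<exists>h. meas_hom X Q h" if X: "meas_ob X" for X
    using weak[OF X] meas_hom_cmp[OF X T Q _ q] by blast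
  ultimately show ?thesis using Q by blast
qed

end

section \<open>Countable subdiagrams of a presented comonoid\<close>

locale presented_comonoid = braided_monoidal_closed_category V + P: directed_colimit V I r D c k
  for V :: "('o, 'm, 'z) brccat_scheme" (structure) and I :: "'i set" and r D c k +
  fixes U :: "'i rel" and l d e
  assumes U: "inaccessible U" and small_homs: "locally_small U V"
    and small_I: "small U I" and dir: "directed_poset l I r"
    and presentable: "\<And>i. i \<in> I \<Longrightarrow> presentable U l V (omap D i)"
    and comonoid: "is_comonoid V (c, d, e)"
begin

lemmas c_simps [simp] = comonoidD(1-7)[OF comonoid]

abbreviation "D2 \<equiv> \<lparr>omap = \<lambda>i. omap D i \<otimes> omap D i, amap = \<lambda>a. amap D a \<boxtimes> amap D a\<rparr>"
abbreviation "D3 \<equiv> \<lparr>omap = \<lambda>i. omap D i \<otimes> omap D2 i, amap = \<lambda>a. amap D a \<boxtimes> amap D2 a\<rparr>"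

text \<open>The tensor square of the colimit is presented over the same poset, so that a presentable
  \<open>omap D i\<close> can be mapped into the tensor square of a single stage. The tensor cube
  plays the same role for coassociativity.\<close>

sublocale P2: directed_colimit V I r D2 "c \<otimes> c" "\<lambda>i. k i \<boxtimes> k i"
  by (rule directed_colimit_tensor) unfold_locales

sublocale P3: directed_colimit V I r D3 "c \<otimes> (c \<otimes> c)" "\<lambda>i. k i \<boxtimes> (k i \<boxtimes> k i)"
  by (rule directed_colimit_tensor) unfold_locales

text \<open>This and the next two lemmas turn laws that hold in the colimit into laws at a later
  stage: target \<open>c\<close> is for the counit laws, c \<otimes> c for compatibility of the
  lifts, c \<otimes> (c \<otimes> c) for coassociativity.\<close>

lemma merge:
  assumes "i \<in> I" "j \<in> I" "f \<in> homset V (omap D i) (omap D j)" "g \<in> homset V (omap D i) (omap D j)"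
    and "k j \<cdot> f = k j \<cdot> g"
  shows "\<exists>n. (j, n) \<in> r \<and> amap D (j, n) \<cdot> f = amap D (j, n) \<cdot> g"
  using P.presentable_merge[OF U small_homs small_I dir presentable[OF assms(1)] assms(2-5)] by blast

lemma merge2:
  assumes "i \<in> I" "j \<in> I" "f \<in> homset V (omap D i) (omap D j \<otimes> omap D j)"
    "g \<in> homset V (omap D i) (omap D j \<otimes> omap D j)" and "(k j \<boxtimes> k j) \<cdot> f = (k j \<boxtimes> k j) \<cdot> g"
  shows "\<exists>n. (j, n) \<in> r \<and>
    (amap D (j, n) \<boxtimes> amap D (j, n)) \<cdot> f = (amap D (j, n) \<boxtimes> amap D (j, n)) \<cdot> g"
proof (rule P2.presentable_merge[OF U small_homs small_I dir presentable[OF assms(1)] assms(2)])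
  show "f \<in> homset V (omap D i) (omap D2 j)" "g \<in> homset V (omap D i) (omap D2 j)"
    using assms by simp_all
qed (use assms in auto)

lemma merge3:
  assumes "i \<in> I" "j \<in> I" "f \<in> homset V (omap D i) (omap D j \<otimes> (omap D j \<otimes> omap D j))"
    "g \<in> homset V (omap D i) (omap D j \<otimes> (omap D j \<otimes> omap D j))"
    and "(k j \<boxtimes> (k j \<boxtimes> k j)) \<cdot> f = (k j \<boxtimes> (k j \<boxtimes> k j)) \<cdot> g"
  shows "\<exists>n. (j, n) \<in> r \<and> (amap D (j, n) \<boxtimes> (amap D (j, n) \<boxtimes> amap D (j, n))) \<cdot> f =
    (amap D (j, n) \<boxtimes> (amap D (j, n) \<boxtimes> amap D (j, n))) \<cdot> g"
proof (rule P3.presentable_merge[OF U small_homs small_I dir presentable[OF assms(1)] assms(2)])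
  show "f \<in> homset V (omap D i) (omap D3 j)" "g \<in> homset V (omap D i) (omap D3 j)"
    using assms by simp_all
qed (use assms in auto)

lemma le_I [simp]: "(i, j) \<in> r \<Longrightarrow> i \<in> I" "(i, j) \<in> r \<Longrightarrow> j \<in> I"
  using P.le_in by auto

section \<open>Lifts of the comultiplication and the stages at which their laws hold\<close>

lemma ex_lift:
  assumes i: "i \<in> I"
  shows "\<exists>s g. s \<in> I \<and> g \<in> homset V (omap D i) (omap D s \<otimes> omap D s) \<and> (k s \<boxtimes> k s) \<cdot> g = d \<cdot> k i"
proof (rule P2.presentable_factor[OF U small_homs small_I dir presentable[OF i]])
  show "d \<cdot> k i \<in> homset V (omap D i) (c \<otimes> c)"
    using i by (simp add: homset_def)
qed auto

text \<open>The choice is made separately for every \<open>i\<close>: \<open>stage i\<close> need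
  not lie above \<open>i\<close>, and the lifts need not be compatible with the arrows of the
  diagram. The predicates below record where such defects disappear.\<close>

definition stage where
  "stage i = (SOME s. \<exists>g. s \<in> I \<and> g \<in> homset V (omap D i) (omap D s \<otimes> omap D s) \<and> (k s \<boxtimes> k s) \<cdot> g = d \<cdot> k i)"

definition lift where
  "lift i = (SOME g. g \<in> homset V (omap D i) (omap D (stage i) \<otimes> omap D (stage i)) \<and>
    (k (stage i) \<boxtimes> k (stage i)) \<cdot> g = d \<cdot> k i)"

lemma stage_lift [simp]:
  assumes "i \<in> I"
  shows "stage i \<in> I" "lift i \<in> ar V" "src V (lift i) = omap D i"
    "tgt V (lift i) = omap D (stage i) \<otimes> omap D (stage i)"
    "(k (stage i) \<boxtimes> k (stage i)) \<cdot> lift i = d \<cdot> k i"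
proof -
  have s: "\<exists>g. stage i \<in> I \<and> g \<in> homset V (omap D i) (omap D (stage i) \<otimes> omap D (stage i)) \<and>
      (k (stage i) \<boxtimes> k (stage i)) \<cdot> g = d \<cdot> k i"
    using someI_ex[OF ex_lift[OF assms]] unfolding stage_def .
  then show "stage i \<in> I" by blast
  from s have "\<exists>g. g \<in> homset V (omap D i) (omap D (stage i) \<otimes> omap D (stage i)) \<and>
      (k (stage i) \<boxtimes> k (stage i)) \<cdot> g = d \<cdot> k i"
    by blast
  from someI_ex[OF this, folded lift_def]
  show "lift i \<in> ar V" "src V (lift i) = omap D i" "tgt V (lift i) = omap D (stage i) \<otimes> omap D (stage i)"
    "(k (stage i) \<boxtimes> k (stage i)) \<cdot> lift i = d \<cdot> k i"
    by (auto simp: homset_def)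
qed

lemma lift_tail:
  assumes [simp]: "i \<in> I" "f \<in> ar V" "tgt V f = omap D i"
  shows "(k (stage i) \<boxtimes> k (stage i)) \<cdot> lift i \<cdot> f = d \<cdot> k i \<cdot> f"
  using cmp_tail[OF stage_lift(5)[of i], of f] by simp

definition natural_at where
  "natural_at i j n \<longleftrightarrow> (stage i, n) \<in> r \<and> (stage j, n) \<in> r \<and>
    (amap D (stage j, n) \<boxtimes> amap D (stage j, n)) \<cdot> lift j \<cdot> amap D (i, j) =
    (amap D (stage i, n) \<boxtimes> amap D (stage i, n)) \<cdot> lift i"

text \<open>A second comultiplication leads from \<open>stage i\<close> on to
  \<open>stage (stage i)\<close>, while the untouched factor stays at \<open>stage i\<close>. All
  three factors are brought to the common stage \<open>n\<close>, where the associator compares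
  them.\<close>

definition coassoc_at where
  "coassoc_at i n \<longleftrightarrow> (stage i, n) \<in> r \<and> (stage (stage i), n) \<in> r \<and>
    \<alpha> (omap D n) (omap D n) (omap D n) \<cdot>
      (((amap D (stage (stage i), n) \<boxtimes> amap D (stage (stage i), n)) \<cdot> lift (stage i)) \<boxtimes> amap D (stage i, n)) \<cdot> lift i =
    (amap D (stage i, n) \<boxtimes> ((amap D (stage (stage i), n) \<boxtimes> amap D (stage (stage i), n)) \<cdot> lift (stage i))) \<cdot> lift i"

text \<open>The target \<I> of the counit is a fixed object, so \<open>e \<cdot> k (stage i)\<close>
  serves as counit at a stage without any lifting.\<close>

definition counit_at where
  "counit_at i n \<longleftrightarrow> (i, n) \<in> r \<and> (stage i, n) \<in> r \<and>
    amap D (stage i, n) \<cdot> lunit V (omap D (stage i)) \<cdot> ((e \<cdot> k (stage i)) \<rhd> (omap D (stage i))) \<cdot> lift i = amap D (i, n)"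

definition counit_at' where
  "counit_at' i n \<longleftrightarrow> (i, n) \<in> r \<and> (stage i, n) \<in> r \<and>
    amap D (stage i, n) \<cdot> runit V (omap D (stage i)) \<cdot> ((omap D (stage i)) \<lhd> (e \<cdot> k (stage i))) \<cdot> lift i = amap D (i, n)"

text \<open>In the colimit both sides become \<open>d \<cdot> k i\<close>, whatever lifts were
  chosen; presentability of \<open>omap D i\<close> makes them agree at some later stage.\<close>

lemma ex_natural_at:
  assumes ij [simp]: "(i, j) \<in> r"
  shows "\<exists>n. natural_at i j n"
proof -
  note [simp] = le_I[OF ij]
  obtain n where n [simp]: "(stage i, n) \<in> r" "(stage j, n) \<in> r"
    using P.upper_bound[of "stage i" "stage j"] by auto
  have nI [simp]: "n \<in> I" using le_I[OF n(1)] by simp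
  let ?f = "(amap D (stage j, n) \<boxtimes> amap D (stage j, n)) \<cdot> lift j \<cdot> amap D (i, j)"
  let ?g = "(amap D (stage i, n) \<boxtimes> amap D (stage i, n)) \<cdot> lift i"
  have fg: "?f \<in> homset V (omap D i) (omap D n \<otimes> omap D n)" "?g \<in> homset V (omap D i) (omap D n \<otimes> omap D n)"
    by (simp_all add: homset_def)
  have "(k n \<boxtimes> k n) \<cdot> ?f = (k n \<boxtimes> k n) \<cdot> ?g"
    by (simp add: lift_tail)
  from merge2[OF _ nI fg this] obtain n' where n' [simp]: "(n, n') \<in> r"
    and eq: "(amap D (n, n') \<boxtimes> amap D (n, n')) \<cdot> ?f = (amap D (n, n') \<boxtimes> amap D (n, n')) \<cdot> ?g"
    by auto
  have "(stage i, n') \<in> r" "(stage j, n') \<in> r"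
    using P.le_trans n n' by blast+
  then show ?thesis
    using eq unfolding natural_at_def by (intro exI[of _ n']) simp
qed

text \<open>Mapped to c \<otimes> (c \<otimes> c), the two sides are those of coassociativity of
  \<open>d\<close> applied to \<open>k i\<close>, by two uses of the defining property of the
  lifts.\<close>

lemma ex_coassoc_at:
  assumes i [simp]: "i \<in> I"
  shows "\<exists>n. coassoc_at i n"
proof -
  let ?s = "stage i"
  let ?t = "stage ?s"
  obtain n where n [simp]: "(?s, n) \<in> r" "(?t, n) \<in> r"
    using P.upper_bound[of ?s ?t] by auto
  have nI [simp]: "n \<in> I" using le_I[OF n(1)] by simp
  let ?h = "\<lambda>n. (amap D (?t, n) \<boxtimes> amap D (?t, n)) \<cdot> lift ?s"
  let ?f = "\<lambda>n. \<alpha> (omap D n) (omap D n) (omap D n) \<cdot> (?h n \<boxtimes> amap D (?s, n)) \<cdot> lift i"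
  let ?g = "\<lambda>n. (amap D (?s, n) \<boxtimes> ?h n) \<cdot> lift i"
  have h [simp]: "(k n \<boxtimes> k n) \<cdot> ?h n = d \<cdot> k ?s"
    by simp
  have "(k n \<boxtimes> (k n \<boxtimes> k n)) \<cdot> ?f n = \<alpha> c c c \<cdot> ((k n \<boxtimes> k n) \<boxtimes> k n) \<cdot> (?h n \<boxtimes> amap D (?s, n)) \<cdot> lift i"
    using cmp_tail[OF assoc_nat[of "k n" "k n" "k n" c c c], of "(?h n \<boxtimes> amap D (?s, n)) \<cdot> lift i"]
    by (simp del: tensor_cmp tensor_cmp_tail)
  also have "\<dots> = \<alpha> c c c \<cdot> (d \<rhd> c) \<cdot> (k ?s \<boxtimes> k ?s) \<cdot> lift i"
    by (simp del: stage_lift(5))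
  also have "\<dots> = \<alpha> c c c \<cdot> (d \<rhd> c) \<cdot> d \<cdot> k i"
    by (simp only: stage_lift(5)[OF i])
  also have "\<dots> = (c \<lhd> d) \<cdot> d \<cdot> k i"
    using cmp_tail[OF comonoidD(8)[OF comonoid], of "k i"] by simp
  also have "\<dots> = (c \<lhd> d) \<cdot> (k ?s \<boxtimes> k ?s) \<cdot> lift i"
    by (simp only: stage_lift(5)[OF i])
  also have "\<dots> = (k n \<boxtimes> (k n \<boxtimes> k n)) \<cdot> ?g n"
    by (simp del: stage_lift(5))
  finally have eq: "(k n \<boxtimes> (k n \<boxtimes> k n)) \<cdot> ?f n = (k n \<boxtimes> (k n \<boxtimes> k n)) \<cdot> ?g n" .
  have fg: "?f n \<in> homset V (omap D i) (omap D n \<otimes> (omap D n \<otimes> omap D n))"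
    "?g n \<in> homset V (omap D i) (omap D n \<otimes> (omap D n \<otimes> omap D n))"
    by (simp_all add: homset_def)
  from merge3[OF i nI fg eq] obtain n' where n' [simp]: "(n, n') \<in> r"
    and eq: "(amap D (n, n') \<boxtimes> (amap D (n, n') \<boxtimes> amap D (n, n'))) \<cdot> ?f n =
      (amap D (n, n') \<boxtimes> (amap D (n, n') \<boxtimes> amap D (n, n'))) \<cdot> ?g n"
    by blast
  have sn' [simp]: "(?s, n') \<in> r" "(?t, n') \<in> r"
    using P.le_trans n n' by blast+
  have [simp]: "n' \<in> I" using le_I[OF n'] by simp
  have h' [simp]: "(amap D (n, n') \<boxtimes> amap D (n, n')) \<cdot> ?h n = ?h n'"
    by simp
  have "?f n' = \<alpha> (omap D n') (omap D n') (omap D n') \<cdot> ((amap D (n, n') \<boxtimes> amap D (n, n')) \<boxtimes> amap D (n, n')) \<cdot>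
      (?h n \<boxtimes> amap D (?s, n)) \<cdot> lift i"
    by simp
  also have "\<dots> = (amap D (n, n') \<boxtimes> (amap D (n, n') \<boxtimes> amap D (n, n'))) \<cdot> ?f n"
    using cmp_tail[OF assoc_nat[of "amap D (n, n')" "amap D (n, n')" "amap D (n, n')"],
        of "omap D n'" "omap D n'" "omap D n'" "(?h n \<boxtimes> amap D (?s, n)) \<cdot> lift i"]
    by (simp del: tensor_cmp tensor_cmp_tail)
  also have "\<dots> = ?g n'"
    unfolding eq by simp
  finally show ?thesis
    using sn' unfolding coassoc_at_def by blast
qed

lemma ex_counit_at:
  assumes i [simp]: "i \<in> I"
  shows "\<exists>n. counit_at i n"
proof -
  let ?s = "stage i"
  obtain n where n [simp]: "(i, n) \<in> r" "(?s, n) \<in> r"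
    using P.upper_bound[of i ?s] by auto
  have nI [simp]: "n \<in> I" using le_I[OF n(1)] by simp
  let ?h = "lunit V (omap D ?s) \<cdot> ((e \<cdot> k ?s) \<rhd> (omap D ?s)) \<cdot> lift i"
  have "k n \<cdot> amap D (?s, n) \<cdot> ?h = k ?s \<cdot> lunit V (omap D ?s) \<cdot> ((e \<cdot> k ?s) \<rhd> (omap D ?s)) \<cdot> lift i"
    by simp
  also have "\<dots> = lunit V c \<cdot> (\<I> \<lhd> k ?s) \<cdot> ((e \<cdot> k ?s) \<rhd> (omap D ?s)) \<cdot> lift i"
    using cmp_tail[OF lunit_nat[of "k ?s" c], of "((e \<cdot> k ?s) \<rhd> (omap D ?s)) \<cdot> lift i"]
    by (simp del: tensor_cmp tensor_cmp_tail)
  also have "\<dots> = lunit V c \<cdot> (e \<rhd> c) \<cdot> (k ?s \<boxtimes> k ?s) \<cdot> lift i"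
    by (simp del: stage_lift(5))
  also have "\<dots> = lunit V c \<cdot> (e \<rhd> c) \<cdot> d \<cdot> k i"
    by (simp only: stage_lift(5)[OF i])
  also have "\<dots> = k n \<cdot> amap D (i, n)"
    using cmp_tail[OF comonoidD(9)[OF comonoid], of "k i"] by simp
  finally have eq: "k n \<cdot> amap D (?s, n) \<cdot> ?h = k n \<cdot> amap D (i, n)" .
  have fg: "amap D (?s, n) \<cdot> ?h \<in> homset V (omap D i) (omap D n)" "amap D (i, n) \<in> homset V (omap D i) (omap D n)"
    by (simp_all add: homset_def)
  from merge[OF i nI fg eq] obtain n' where n' [simp]: "(n, n') \<in> r"
    and eq: "amap D (n, n') \<cdot> amap D (?s, n) \<cdot> ?h = amap D (n, n') \<cdot> amap D (i, n)"
    by blast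
  have "(i, n') \<in> r" "(?s, n') \<in> r"
    using P.le_trans n n' by blast+
  then show ?thesis
    using eq unfolding counit_at_def by (intro exI[of _ n']) simp
qed

lemma ex_counit_at':
  assumes i [simp]: "i \<in> I"
  shows "\<exists>n. counit_at' i n"
proof -
  let ?s = "stage i"
  obtain n where n [simp]: "(i, n) \<in> r" "(?s, n) \<in> r"
    using P.upper_bound[of i ?s] by auto
  have nI [simp]: "n \<in> I" using le_I[OF n(1)] by simp
  let ?h = "runit V (omap D ?s) \<cdot> ((omap D ?s) \<lhd> (e \<cdot> k ?s)) \<cdot> lift i"
  have "k n \<cdot> amap D (?s, n) \<cdot> ?h = k ?s \<cdot> runit V (omap D ?s) \<cdot> ((omap D ?s) \<lhd> (e \<cdot> k ?s)) \<cdot> lift i"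
    by simp
  also have "\<dots> = runit V c \<cdot> (k ?s \<rhd> \<I>) \<cdot> ((omap D ?s) \<lhd> (e \<cdot> k ?s)) \<cdot> lift i"
    using cmp_tail[OF runit_nat[of "k ?s" c], of "((omap D ?s) \<lhd> (e \<cdot> k ?s)) \<cdot> lift i"]
    by (simp del: tensor_cmp tensor_cmp_tail)
  also have "\<dots> = runit V c \<cdot> (c \<lhd> e) \<cdot> (k ?s \<boxtimes> k ?s) \<cdot> lift i"
    by (simp del: stage_lift(5))
  also have "\<dots> = runit V c \<cdot> (c \<lhd> e) \<cdot> d \<cdot> k i"
    by (simp only: stage_lift(5)[OF i])
  also have "\<dots> = k n \<cdot> amap D (i, n)"
    using cmp_tail[OF comonoidD(10)[OF comonoid], of "k i"] by simp
  finally have eq: "k n \<cdot> amap D (?s, n) \<cdot> ?h = k n \<cdot> amap D (i, n)" .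
  have fg: "amap D (?s, n) \<cdot> ?h \<in> homset V (omap D i) (omap D n)" "amap D (i, n) \<in> homset V (omap D i) (omap D n)"
    by (simp_all add: homset_def)
  from merge[OF i nI fg eq] obtain n' where n' [simp]: "(n, n') \<in> r"
    and eq: "amap D (n, n') \<cdot> amap D (?s, n) \<cdot> ?h = amap D (n, n') \<cdot> amap D (i, n)"
    by blast
  have "(i, n') \<in> r" "(?s, n') \<in> r"
    using P.le_trans n n' by blast+
  then show ?thesis
    using eq unfolding counit_at'_def by (intro exI[of _ n']) simp
qed

text \<open>A set of stages is closed if it contains witnesses for everything that makes the colimit over it
  a comonoid.  It need not be directed.\<close>

definition closed_stages where
  "closed_stages J \<longleftrightarrow> J \<subseteq> I \<and> J \<noteq> {} \<and> (\<forall>i\<in>J. stage i \<in> J \<and> (\<exists>n\<in>J. coassoc_at i n) \<and>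
    (\<exists>n\<in>J. counit_at i n) \<and> (\<exists>n\<in>J. counit_at' i n)) \<and>
    (\<forall>i\<in>J. \<forall>j\<in>J. (i, j) \<in> r \<longrightarrow> (\<exists>n\<in>J. natural_at i j n))"

lemma closed_stagesD:
  assumes "closed_stages J"
  shows "J \<subseteq> I" "i \<in> J \<Longrightarrow> i \<in> I" "i \<in> J \<Longrightarrow> stage i \<in> J"
    "i \<in> J \<Longrightarrow> \<exists>n\<in>J. coassoc_at i n" "i \<in> J \<Longrightarrow> \<exists>n\<in>J. counit_at i n" "i \<in> J \<Longrightarrow> \<exists>n\<in>J. counit_at' i n"
    "i \<in> J \<Longrightarrow> j \<in> J \<Longrightarrow> (i, j) \<in> r \<Longrightarrow> \<exists>n\<in>J. natural_at i j n"
  using assms by (auto simp: closed_stages_def)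

lemma countable_closed_stages:
  assumes "countable J" "J \<subseteq> I" "J \<noteq> {}"
  obtains K where "countable K" "J \<subseteq> K" "closed_stages K"
proof -
  define w where "w i = {stage i, SOME n. coassoc_at i n, SOME n. counit_at i n, SOME n. counit_at' i n}" for i
  define w' where "w' i j = (if (i, j) \<in> r then {SOME n. natural_at i j n} else {})" for i j
  have sm: "coassoc_at i (SOME n. coassoc_at i n)" "counit_at i (SOME n. counit_at i n)"
    "counit_at' i (SOME n. counit_at' i n)" if "i \<in> I" for i
    using ex_coassoc_at[OF that] ex_counit_at[OF that] ex_counit_at'[OF that] by (blast intro: someI_ex)+
  have sm': "natural_at i j (SOME n. natural_at i j n)" if "(i, j) \<in> r" for i j
    using ex_natural_at[OF that] by (rule someI_ex)
  have in_I: "coassoc_at i n \<Longrightarrow> n \<in> I" "counit_at i n \<Longrightarrow> n \<in> I" "counit_at' i n \<Longrightarrow> n \<in> I"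
    "natural_at i j n \<Longrightarrow> n \<in> I" for i j n
    unfolding coassoc_at_def counit_at_def counit_at'_def natural_at_def using le_I(2) by blast+
  have *: "countable (w i \<union> w' i j) \<and> w i \<union> w' i j \<subseteq> I" if "i \<in> I" "j \<in> I" for i j
    using in_I(1)[OF sm(1)[OF that(1)]] in_I(2)[OF sm(2)[OF that(1)]] in_I(3)[OF sm(3)[OF that(1)]]
      in_I(4)[OF sm'] that
    by (auto simp: w_def w'_def)
  have "\<exists>K. countable K \<and> J \<subseteq> K \<and> K \<subseteq> I \<and> (\<forall>i\<in>K. \<forall>j\<in>K. w i \<union> w' i j \<subseteq> K)"
    by (rule countable_closure[OF assms(1,2) *])
  then obtain K where K: "countable K" "J \<subseteq> K" "K \<subseteq> I"
    and cl': "\<forall>i\<in>K. \<forall>j\<in>K. w i \<union> w' i j \<subseteq> K"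
    by (elim exE conjE) (rule that)
  have cl: "w i \<union> w' i j \<subseteq> K" if "i \<in> K" "j \<in> K" for i j
    using bspec[OF bspec[OF cl' that(1)] that(2)] .
  have "closed_stages K"
    unfolding closed_stages_def
  proof (intro conjI ballI impI)
    show "K \<subseteq> I" "K \<noteq> {}" using K assms by auto
    fix i assume i: "i \<in> K"
    have w: "w i \<subseteq> K" using cl[OF i i] by simp
    have iI: "i \<in> I" using i K by blast
    show "stage i \<in> K" using w by (simp add: w_def)
    show "\<exists>n\<in>K. coassoc_at i n" "\<exists>n\<in>K. counit_at i n" "\<exists>n\<in>K. counit_at' i n"
      using w sm[OF iI] unfolding w_def by blast+
    fix j assume "j \<in> K" "(i, j) \<in> r"
    then show "\<exists>n\<in>K. natural_at i j n"
      using cl[OF i, of j] sm' unfolding w'_def by auto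
  qed
  then show ?thesis using that K by blast
qed

abbreviation "sub J \<equiv> graph J (r \<inter> J \<times> J) fst snd"

context
  fixes J z q
  assumes J: "closed_stages J" and colim: "is_colimit (sub J) V D z q"
begin

private lemma J_I [simp]: "i \<in> J \<Longrightarrow> i \<in> I"
  using J by (auto simp: closed_stages_def)

private lemma stage_J [simp]: "i \<in> J \<Longrightarrow> stage i \<in> J"
  using J by (auto simp: closed_stages_def)

private lemma diag: "diagram (sub J) V D"
  by (auto simp: diagram_def homset_def)

private lemma q [simp]: "i \<in> J \<Longrightarrow> q i \<in> ar V" "i \<in> J \<Longrightarrow> src V (q i) = omap D i"
  "i \<in> J \<Longrightarrow> tgt V (q i) = z" "z \<in> ob V"
  using is_coconeD(1,2)[OF colimit_cocone[OF colim]] by (simp_all add: homset_def)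

private lemma q_D [simp]: "(i, j) \<in> r \<Longrightarrow> i \<in> J \<Longrightarrow> j \<in> J \<Longrightarrow> q j \<cdot> amap D (i, j) = q i"
  using is_coconeD(3)[OF colimit_cocone[OF colim], of "(i, j)"] by simp

private lemma q_D_tail [simp]:
  "(i, j) \<in> r \<Longrightarrow> i \<in> J \<Longrightarrow> j \<in> J \<Longrightarrow> f \<in> ar V \<Longrightarrow> tgt V f = omap D i \<Longrightarrow> q j \<cdot> amap D (i, j) \<cdot> f = q i \<cdot> f"
  using cmp_tail[OF q_D, of i j f] by simp

lemma sub_eqI:
  assumes "u \<in> ar V" "v \<in> ar V" "src V u = z" "src V v = z" "tgt V u = tgt V v"
    and "\<And>i. i \<in> J \<Longrightarrow> u \<cdot> q i = v \<cdot> q i"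
  shows "u = v"
  by (rule colimit_eqI[OF colim category_axioms diag]) (use assms in \<open>simp_all add: homset_def\<close>)

lemma sub_comonoid:
  obtains dz ez h where "is_comonoid V (z, dz, ez)" "is_comonoid_hom V (z, dz, ez) (c, d, e) h"
    "\<And>i. i \<in> J \<Longrightarrow> h \<cdot> q i = k i"
    "\<And>i. i \<in> J \<Longrightarrow> dz \<cdot> q i = (q (stage i) \<boxtimes> q (stage i)) \<cdot> lift i"
    "\<And>i. i \<in> J \<Longrightarrow> ez \<cdot> q i = e \<cdot> k i"
proof -
  have nat: "(q (stage j) \<boxtimes> q (stage j)) \<cdot> lift j \<cdot> amap D (i, j) = (q (stage i) \<boxtimes> q (stage i)) \<cdot> lift i"
    if ij [simp]: "(i, j) \<in> r" "i \<in> J" "j \<in> J" for i j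
  proof -
    obtain n where n [simp]: "n \<in> J" and "natural_at i j n"
      using closed_stagesD(7)[OF J ij(2,3,1)] by blast
    then have [simp]: "(stage i, n) \<in> r" "(stage j, n) \<in> r"
      and eq: "(amap D (stage j, n) \<boxtimes> amap D (stage j, n)) \<cdot> lift j \<cdot> amap D (i, j) =
        (amap D (stage i, n) \<boxtimes> amap D (stage i, n)) \<cdot> lift i"
      unfolding natural_at_def by blast+
    have "(q n \<boxtimes> q n) \<cdot> (amap D (stage j, n) \<boxtimes> amap D (stage j, n)) \<cdot> lift j \<cdot> amap D (i, j) =
        (q n \<boxtimes> q n) \<cdot> (amap D (stage i, n) \<boxtimes> amap D (stage i, n)) \<cdot> lift i"
      unfolding eq ..
    then show ?thesis by simp
  qed
  have "is_cocone (sub J) V D (z \<otimes> z) (\<lambda>i. (q (stage i) \<boxtimes> q (stage i)) \<cdot> lift i)"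
    by (auto simp: is_cocone_def homset_def nat)
  then obtain dz where "dz \<in> homset V z (z \<otimes> z)"
    and dz: "\<And>i. i \<in> J \<Longrightarrow> dz \<cdot> q i = (q (stage i) \<boxtimes> q (stage i)) \<cdot> lift i"
    using colimit_desc[OF colim, of "z \<otimes> z" "\<lambda>i. (q (stage i) \<boxtimes> q (stage i)) \<cdot> lift i"] unfolding graph_simps by blast
  then have [simp]: "dz \<in> ar V" "src V dz = z" "tgt V dz = z \<otimes> z"
    by (simp_all add: homset_def)
  have "is_cocone (sub J) V D c k"
    by (auto simp: is_cocone_def homset_def)
  then obtain h where "h \<in> homset V z c" and h: "\<And>i. i \<in> J \<Longrightarrow> h \<cdot> q i = k i"
    using colimit_desc[OF colim, of c k] unfolding graph_simps by blast
  then have [simp]: "h \<in> ar V" "src V h = z" "tgt V h = c"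
    by (simp_all add: homset_def)
  define ez where "ez = e \<cdot> h"
  have [simp]: "ez \<in> ar V" "src V ez = z" "tgt V ez = \<I>"
    by (simp_all add: ez_def)
  have ez: "ez \<cdot> q i = e \<cdot> k i" if "i \<in> J" for i
    using that by (simp add: ez_def h)
  have com: "is_comonoid V (z, dz, ez)"
  proof (rule comonoidI)
    show "\<alpha> z z z \<cdot> (dz \<rhd> z) \<cdot> dz = (z \<lhd> dz) \<cdot> dz"
    proof (rule sub_eqI)
      fix i assume i [simp]: "i \<in> J"
      let ?s = "stage i"
      let ?t = "stage ?s"
      obtain n where n [simp]: "n \<in> J" and "coassoc_at i n"
        using closed_stagesD(4)[OF J i] by blast
      then have [simp]: "(?s, n) \<in> r" "(?t, n) \<in> r"
        and eq: "\<alpha> (omap D n) (omap D n) (omap D n) \<cdot> (((amap D (?t, n) \<boxtimes> amap D (?t, n)) \<cdot> lift ?s) \<boxtimes> amap D (?s, n)) \<cdot> lift i =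
          (amap D (?s, n) \<boxtimes> ((amap D (?t, n) \<boxtimes> amap D (?t, n)) \<cdot> lift ?s)) \<cdot> lift i"
        unfolding coassoc_at_def by blast+
      let ?l = "(((amap D (?t, n) \<boxtimes> amap D (?t, n)) \<cdot> lift ?s) \<boxtimes> amap D (?s, n)) \<cdot> lift i"
      have "(\<alpha> z z z \<cdot> (dz \<rhd> z) \<cdot> dz) \<cdot> q i = \<alpha> z z z \<cdot> ((q n \<boxtimes> q n) \<boxtimes> q n) \<cdot> ?l"
        by (simp add: dz)
      also have "\<dots> = (q n \<boxtimes> (q n \<boxtimes> q n)) \<cdot> \<alpha> (omap D n) (omap D n) (omap D n) \<cdot> ?l"
        using cmp_tail[OF assoc_nat[of "q n" "q n" "q n" z z z], of ?l] by (simp del: tensor_cmp tensor_cmp_tail)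
      also have "\<dots> = ((z \<lhd> dz) \<cdot> dz) \<cdot> q i"
        unfolding eq by (simp add: dz)
      finally show "(\<alpha> z z z \<cdot> (dz \<rhd> z) \<cdot> dz) \<cdot> q i = ((z \<lhd> dz) \<cdot> dz) \<cdot> q i" .
    qed simp_all
    show "lunit V z \<cdot> (ez \<rhd> z) \<cdot> dz = idn V z"
    proof (rule sub_eqI)
      fix i assume i [simp]: "i \<in> J"
      let ?s = "stage i"
      obtain n where n [simp]: "n \<in> J" and "counit_at i n"
        using closed_stagesD(5)[OF J i] by blast
      then have [simp]: "(i, n) \<in> r" "(?s, n) \<in> r"
        and eq: "amap D (?s, n) \<cdot> lunit V (omap D ?s) \<cdot> ((e \<cdot> k ?s) \<rhd> (omap D ?s)) \<cdot> lift i = amap D (i, n)"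
        unfolding counit_at_def by blast+
      have "(lunit V z \<cdot> (ez \<rhd> z) \<cdot> dz) \<cdot> q i =
          lunit V z \<cdot> (\<I> \<lhd> q ?s) \<cdot> ((e \<cdot> k ?s) \<rhd> (omap D ?s)) \<cdot> lift i"
        by (simp add: dz ez)
      also have "\<dots> = q n \<cdot> amap D (?s, n) \<cdot> lunit V (omap D ?s) \<cdot> ((e \<cdot> k ?s) \<rhd> (omap D ?s)) \<cdot> lift i"
        using cmp_tail[OF lunit_nat[of "q ?s" z], of "((e \<cdot> k ?s) \<rhd> (omap D ?s)) \<cdot> lift i"]
        by (simp del: tensor_cmp tensor_cmp_tail)
      finally show "(lunit V z \<cdot> (ez \<rhd> z) \<cdot> dz) \<cdot> q i = idn V z \<cdot> q i"
        unfolding eq by simp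
    qed simp_all
    show "runit V z \<cdot> (z \<lhd> ez) \<cdot> dz = idn V z"
    proof (rule sub_eqI)
      fix i assume i [simp]: "i \<in> J"
      let ?s = "stage i"
      obtain n where n [simp]: "n \<in> J" and "counit_at' i n"
        using closed_stagesD(6)[OF J i] by blast
      then have [simp]: "(i, n) \<in> r" "(?s, n) \<in> r"
        and eq: "amap D (?s, n) \<cdot> runit V (omap D ?s) \<cdot> ((omap D ?s) \<lhd> (e \<cdot> k ?s)) \<cdot> lift i = amap D (i, n)"
        unfolding counit_at'_def by blast+
      have "(runit V z \<cdot> (z \<lhd> ez) \<cdot> dz) \<cdot> q i =
          runit V z \<cdot> (q ?s \<rhd> \<I>) \<cdot> ((omap D ?s) \<lhd> (e \<cdot> k ?s)) \<cdot> lift i"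
        by (simp add: dz ez)
      also have "\<dots> = q n \<cdot> amap D (?s, n) \<cdot> runit V (omap D ?s) \<cdot> ((omap D ?s) \<lhd> (e \<cdot> k ?s)) \<cdot> lift i"
        using cmp_tail[OF runit_nat[of "q ?s" z], of "((omap D ?s) \<lhd> (e \<cdot> k ?s)) \<cdot> lift i"]
        by (simp del: tensor_cmp tensor_cmp_tail)
      finally show "(runit V z \<cdot> (z \<lhd> ez) \<cdot> dz) \<cdot> q i = idn V z \<cdot> q i"
        unfolding eq by simp
    qed simp_all
  qed simp_all
  have "d \<cdot> h = (h \<boxtimes> h) \<cdot> dz"
    by (rule sub_eqI) (simp_all add: h dz)
  then have "is_comonoid_hom V (z, dz, ez) (c, d, e) h"
    by (intro comonoid_homI) (simp_all add: ez_def)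
  then show ?thesis
    using that[OF com _ h dz ez] by blast
qed

end

lemma sub_comonoid_mono:
  assumes J: "closed_stages J" "closed_stages J'" "J \<subseteq> J'"
    and colim: "is_colimit (sub J) V D z q" "is_colimit (sub J') V D z' q'"
    and com: "is_comonoid V (z, dz, ez)" "is_comonoid V (z', dz', ez')"
    and d: "\<And>i. i \<in> J \<Longrightarrow> dz \<cdot> q i = (q (stage i) \<boxtimes> q (stage i)) \<cdot> lift i"
      "\<And>i. i \<in> J' \<Longrightarrow> dz' \<cdot> q' i = (q' (stage i) \<boxtimes> q' (stage i)) \<cdot> lift i"
    and e: "\<And>i. i \<in> J \<Longrightarrow> ez \<cdot> q i = e \<cdot> k i" "\<And>i. i \<in> J' \<Longrightarrow> ez' \<cdot> q' i = e \<cdot> k i"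
  shows "\<exists>t. is_comonoid_hom V (z, dz, ez) (z', dz', ez') t \<and> (\<forall>i\<in>J. t \<cdot> q i = q' i)"
proof -
  note [simp] = comonoidD(1-7)[OF com(1)] comonoidD(1-7)[OF com(2)]
  have JI [simp]: "i \<in> I" "stage i \<in> J" if "i \<in> J" for i
    using J that by (auto simp: closed_stages_def)
  have JJ [simp]: "i \<in> J'" if "i \<in> J" for i
    using J that by blast
  have q [simp]: "i \<in> J \<Longrightarrow> q i \<in> ar V" "i \<in> J \<Longrightarrow> src V (q i) = omap D i" "i \<in> J \<Longrightarrow> tgt V (q i) = z" for i
    using is_coconeD(1,2)[OF colimit_cocone[OF colim(1)]] by (simp_all add: homset_def)
  have q' [simp]: "i \<in> J' \<Longrightarrow> q' i \<in> ar V" "i \<in> J' \<Longrightarrow> src V (q' i) = omap D i" "i \<in> J' \<Longrightarrow> tgt V (q' i) = z'" for i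
    using is_coconeD(1,2)[OF colimit_cocone[OF colim(2)]] by (simp_all add: homset_def)
  have "is_cocone (sub J) V D z' q'"
    using is_coconeD(3)[OF colimit_cocone[OF colim(2)]] by (auto simp: is_cocone_def homset_def)
  then obtain t where "t \<in> homset V z z'" and t: "\<And>i. i \<in> J \<Longrightarrow> t \<cdot> q i = q' i"
    using colimit_desc[OF colim(1), of z' q'] unfolding graph_simps by blast
  then have [simp]: "t \<in> ar V" "src V t = z" "tgt V t = z'"
    by (simp_all add: homset_def)
  have "is_comonoid_hom V (z, dz, ez) (z', dz', ez') t"
  proof (rule comonoid_homI)
    show "dz' \<cdot> t = (t \<boxtimes> t) \<cdot> dz"
      by (rule sub_eqI[OF J(1) colim(1)]) (simp_all add: t d)
    show "ez' \<cdot> t = ez"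
      by (rule sub_eqI[OF J(1) colim(1)]) (simp_all add: t e)
  qed simp_all
  then show ?thesis using t by blast
qed

end

section \<open>The universal measuring comonoid\<close>

context measurings
begin

lemma small_measuring_comonoids:
  assumes U: "inaccessible U" "locally_small U V" and R: "small U R" "R \<subseteq> ob V"
  shows "small U {X. meas_ob X \<and> fst X \<in> R}"
proof (rule small_subset)
  let ?S = "Sigma R (\<lambda>z. homset V z (z \<otimes> z) \<times> homset V z \<I> \<times> homset V (a \<otimes> z) b)"
  show "small U ?S"
    using U(2) R by (intro small_Sigma[OF U(1)]) (auto simp: locally_small_def)
  show "{X. meas_ob X \<and> fst X \<in> R} \<subseteq> ?S"
    by (auto simp: homset_def dest: meas_obD)
qed

lemma weakly_terminal:
  fixes U :: "'u rel"
  assumes U: "inaccessible U" and lp: "locally_presentable U V"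
  shows "\<exists>T. meas_ob T \<and> (\<forall>X. meas_ob X \<longrightarrow> (\<exists>h. meas_hom X T h))"
proof -
  have ls: "locally_small U V" and cc: "cocomplete U V"
    using lp by (auto simp: locally_presentable_def)
  obtain l G where l: "small_regular_cardinal U l" and G: "small U G" "\<And>x. x \<in> G \<Longrightarrow> presentable U l V x"
    and gen: "\<And>y. y \<in> ob V \<Longrightarrow> \<exists>(I :: 'u set) r D k. small U I \<and> directed_poset l I r \<and>
      is_functor (posetcat I r) V D \<and> (\<forall>i\<in>I. omap D i \<in> G) \<and> is_colimit (posetcat I r) V D y k"
    using lp unfolding locally_presentable_def by blast
  have GV: "G \<subseteq> ob V"
    using G(2) by (auto simp: presentable_def)
  obtain R0 where R0: "small U R0" and R0': "\<forall>(J :: 'u set) s D. countable J \<and> J \<noteq> {} \<and> s \<subseteq> J \<times> J \<and>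
    diagram (graph J s fst snd) V D \<and> omap D ` J \<subseteq> G \<longrightarrow> (\<exists>z\<in>R0. \<exists>k. is_colimit (graph J s fst snd) V D z k)"
    using small_countable_colimits[OF U category_axioms cc ls G(1) GV] by (elim exE conjE) (rule that)
  define S where "S = {X. meas_ob X \<and> fst X \<in> R0 \<inter> ob V}"
  have S: "small U S"
    unfolding S_def using R0 by (intro small_measuring_comonoids[OF U ls]) (auto intro: small_subset)
  define E where "E = Sigma S (\<lambda>X. Sigma S (\<lambda>Y. {h. meas_hom X Y h}))"
  have "small U (Sigma S (\<lambda>X. Sigma S (\<lambda>Y. homset V (fst X) (fst Y))))"
    using S ls by (intro small_Sigma[OF U]) (auto simp: S_def locally_small_def)
  then have E: "small U E"
    by (rule small_subset) (use meas_hom_ar(4) in \<open>auto simp: E_def\<close>)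
  let ?J = "graph S E fst (fst \<circ> snd)"
  have "\<exists>T \<tau>. meas_ob T \<and> (\<forall>X\<in>S. meas_hom X T (\<tau> X)) \<and>
      (\<forall>X\<in>S. \<forall>Y\<in>S. \<forall>h. meas_hom X Y h \<longrightarrow> \<tau> Y \<cdot> h = \<tau> X)"
  proof (rule meas_colimit_exists[OF U cc, of ?J "\<lambda>X. X" "snd \<circ> snd"])
    fix T \<tau>
    assume T: "meas_ob T" and \<tau>: "\<And>X. X \<in> ob ?J \<Longrightarrow> meas_hom X T (\<tau> X)"
      and colim: "is_colimit ?J V \<lparr>omap = fst \<circ> (\<lambda>X. X), amap = snd \<circ> snd\<rparr> (fst T) \<tau>"
    have "\<tau> Y \<cdot> h = \<tau> X" if "X \<in> S" "Y \<in> S" "meas_hom X Y h" for X Y h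
      using is_coconeD(3)[OF colimit_cocone[OF colim], of "(X, Y, h)"] that by (simp add: E_def)
    then show "\<exists>T \<tau>. meas_ob T \<and> (\<forall>X\<in>S. meas_hom X T (\<tau> X)) \<and>
        (\<forall>X\<in>S. \<forall>Y\<in>S. \<forall>h. meas_hom X Y h \<longrightarrow> \<tau> Y \<cdot> h = \<tau> X)"
      using T \<tau> by (intro exI[of _ T] exI[of _ \<tau>]) simp
  qed (use S E in \<open>auto simp: E_def S_def\<close>)
  then obtain T \<tau> where T: "meas_ob T" and \<tau>: "\<And>X. X \<in> S \<Longrightarrow> meas_hom X T (\<tau> X)"
    and \<tau>_hom: "\<And>X Y h. X \<in> S \<Longrightarrow> Y \<in> S \<Longrightarrow> meas_hom X Y h \<Longrightarrow> \<tau> Y \<cdot> h = \<tau> X"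
    by blast
  obtain zt dt et ft where T_eq: "T = (zt, dt, et, ft)"
    by (metis prod_cases4)
  note T' [simp] = meas_obD(3-)[OF T[unfolded T_eq]]
  have "\<exists>t. meas_hom C T t" if C: "meas_ob C" for C
  proof -
    obtain c d e f where C_eq: "C = (c, d, e, f)"
      by (metis prod_cases4)
    note C = C[unfolded C_eq]
    note C' [simp] = meas_obD(3-)[OF C]
    obtain I :: "'u set" and r D k where I: "small U I" "directed_poset l I r"
      and D: "is_functor (posetcat I r) V D" "\<forall>i\<in>I. omap D i \<in> G"
      and k: "is_colimit (posetcat I r) V D c k"
      using gen[OF C'(1)] by blast
    interpret PC: presented_comonoid V I r D c k U l d e
    proof (intro presented_comonoid.intro presented_comonoid_axioms.intro directed_colimit.intro
        directed_diagram.intro directed_diagram_axioms.intro directed_colimit_axioms.intro)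
      show "braided_monoidal_closed_category V" "category V" by unfold_locales
      show "directed I r" by (rule directed_poset_directed[OF I(2) l])
    qed (use U ls I D k G meas_obD(1)[OF C] in auto)
    define P where "P J x \<longleftrightarrow> (case x of (z, q, dz, ez, h) \<Rightarrow> z \<in> R0 \<and> is_colimit (PC.sub J) V D z q \<and>
      is_comonoid V (z, dz, ez) \<and> is_comonoid_hom V (z, dz, ez) (c, d, e) h \<and>
      (\<forall>i\<in>J. h \<cdot> q i = k i \<and> dz \<cdot> q i = (q (PC.stage i) \<boxtimes> q (PC.stage i)) \<cdot> PC.lift i \<and> ez \<cdot> q i = e \<cdot> k i))" for J x
    define \<J> where "\<J> = {J. countable J \<and> PC.closed_stages J}"
    have ex: "\<exists>x. P J x" if "J \<in> \<J>" for J
    proof -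
      have J: "countable J" "PC.closed_stages J" using that by (auto simp: \<J>_def)
      have JI: "J \<subseteq> I" "J \<noteq> {}" using J(2) by (auto simp: PC.closed_stages_def)
      have "diagram (PC.sub J) V D"
        using JI by (auto simp: diagram_def homset_def)
      then obtain z q where z: "z \<in> R0" and q: "is_colimit (PC.sub J) V D z q"
        using R0'[rule_format, of J "r \<inter> J \<times> J" D] J(1) D(2) JI by blast
      show ?thesis
        by (rule PC.sub_comonoid[OF J(2) q]) (use z q in \<open>unfold P_def, blast\<close>)
    qed
    define g where "g J = (SOME x. P J x)" for J
    define z where "z J = fst (g J)" for J
    define q where "q J = fst (snd (g J))" for J
    define dz where "dz J = fst (snd (snd (g J)))" for J
    define ez where "ez J = fst (snd (snd (snd (g J))))" for J
    define h where "h J = snd (snd (snd (snd (g J))))" for J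
    have g_eq: "g J = (z J, q J, dz J, ez J, h J)" for J
      by (simp add: z_def q_def dz_def ez_def h_def)
    have P: "P J (z J, q J, dz J, ez J, h J)" if "J \<in> \<J>" for J
      using someI_ex[OF ex[OF that]] unfolding g_eq[symmetric] g_def .
    have zR: "z J \<in> R0" and colim: "is_colimit (PC.sub J) V D (z J) (q J)"
      and com: "is_comonoid V (z J, dz J, ez J)" and hom: "is_comonoid_hom V (z J, dz J, ez J) (c, d, e) (h J)"
      and hq: "i \<in> J \<Longrightarrow> h J \<cdot> q J i = k i"
      and dq: "i \<in> J \<Longrightarrow> dz J \<cdot> q J i = (q J (PC.stage i) \<boxtimes> q J (PC.stage i)) \<cdot> PC.lift i"
      and eq: "i \<in> J \<Longrightarrow> ez J \<cdot> q J i = e \<cdot> k i" if "J \<in> \<J>" for J i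
      using P[OF that] unfolding P_def by auto
    have cl: "PC.closed_stages J" if "J \<in> \<J>" for J
      using that by (simp add: \<J>_def)
    have JI: "i \<in> I" if "J \<in> \<J>" "i \<in> J" for i J
      using PC.closed_stagesD(2)[OF cl[OF that(1)] that(2)] .
    note [simp] = comonoidD(1-7)[OF com] comonoid_homD(1-3)[OF hom]
    have q [simp]: "q J i \<in> ar V" "src V (q J i) = omap D i" "tgt V (q J i) = z J" if "J \<in> \<J>" "i \<in> J" for J i
      using is_coconeD(2)[OF colimit_cocone[OF colim[OF that(1)]], of i] that by (simp_all add: homset_def)
    define fz where "fz J = f \<cdot> (a \<lhd> h J)" for J
    define X where "X J = (z J, dz J, ez J, fz J)" for J
    have X: "meas_ob (X J)" if "J \<in> \<J>" for J
      using measuring_comonoid_hom[OF A B meas_obD(1)[OF C] com[OF that] hom[OF that] meas_obD(2)[OF C]] com[OF that]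
      by (simp add: X_def meas_ob_def fz_def)
    have XS: "X J \<in> S" if "J \<in> \<J>" for J
      using X[OF that] zR[OF that] that by (simp add: S_def X_def)
    note \<tau>X = \<tau>[OF XS]
    have \<tau>X' [simp]: "\<tau> (X J) \<in> ar V" "src V (\<tau> (X J)) = z J" "tgt V (\<tau> (X J)) = zt" if "J \<in> \<J>" for J
      using meas_hom_ar(1-3)[OF \<tau>X[OF that]] by (simp_all add: X_def T_eq)
    define v where "v J i = \<tau> (X J) \<cdot> q J i" for J i
    have v_mono: "v J i = v J' i" if J: "J \<in> \<J>" "J' \<in> \<J>" "J \<subseteq> J'" and i: "i \<in> J" for J J' i
    proof -
      have JJ [simp]: "j \<in> J'" if "j \<in> J" for j using J that by blast
      have "\<exists>t. is_comonoid_hom V (z J, dz J, ez J) (z J', dz J', ez J') t \<and> (\<forall>i\<in>J. t \<cdot> q J i = q J' i)"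
        by (rule PC.sub_comonoid_mono[OF cl[OF J(1)] cl[OF J(2)] J(3) colim[OF J(1)] colim[OF J(2)]
              com[OF J(1)] com[OF J(2)] dq[OF J(1)] dq[OF J(2)] eq[OF J(1)] eq[OF J(2)]])
      then obtain t where t: "is_comonoid_hom V (z J, dz J, ez J) (z J', dz J', ez J') t"
        and tq: "\<And>i. i \<in> J \<Longrightarrow> t \<cdot> q J i = q J' i"
        by blast
      note [simp] = comonoid_homD(1-3)[OF t] J
      have "h J' \<cdot> t = h J"
        by (rule PC.sub_eqI[OF cl[OF J(1)] colim[OF J(1)]]) (simp_all add: tq hq)
      then have "meas_hom (X J) (X J') t"
        using t by (simp add: meas_hom_def X_def fz_def)
      from \<tau>_hom[OF XS XS this] have "\<tau> (X J') \<cdot> t = \<tau> (X J)" by simp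
      from cmp_tail[OF this, of "q J i"] show ?thesis
        using i by (simp add: v_def tq)
    qed
    have ex_J: "\<exists>J\<in>\<J>. K \<subseteq> J" if K: "countable K" "K \<subseteq> I" "K \<noteq> {}" for K
      by (rule PC.countable_closed_stages[OF K]) (auto simp: \<J>_def)
    have v_eq: "v J i = v J' i" if J: "J \<in> \<J>" "J' \<in> \<J>" "i \<in> J" "i \<in> J'" for J J' i
    proof -
      obtain K where "K \<in> \<J>" "J \<union> J' \<subseteq> K"
        using ex_J[of "J \<union> J'"] J JI by (auto simp: \<J>_def)
      then show ?thesis
        using v_mono[of J K i] v_mono[of J' K i] J by simp
    qed
    define p where "p i = v (SOME J. J \<in> \<J> \<and> i \<in> J) i" for i
    have p: "p i = v J i" if "J \<in> \<J>" "i \<in> J" for i J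
      using someI[of "\<lambda>J. J \<in> \<J> \<and> i \<in> J" J] v_eq that unfolding p_def by blast
    have ex2: "\<exists>J\<in>\<J>. i \<in> J \<and> j \<in> J" if "i \<in> I" "j \<in> I" for i j
      using ex_J[of "{i, j}"] that by auto
    have p_hom: "p i \<in> homset V (omap D i) zt" if i: "i \<in> I" for i
    proof -
      obtain J where J: "J \<in> \<J>" "i \<in> J" using ex2[OF i i] by blast
      show ?thesis
        unfolding p[OF J] using J by (simp add: v_def homset_def)
    qed
    have p_D: "p j \<cdot> amap D (i, j) = p i" if ij: "(i, j) \<in> r" for i j
    proof -
      have ijI: "i \<in> I" "j \<in> I" using ij by simp_all
      obtain J where J: "J \<in> \<J>" "i \<in> J" "j \<in> J" using ex2[OF ijI] by blast
      have "q J j \<cdot> amap D (i, j) = q J i"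
        using is_coconeD(3)[OF colimit_cocone[OF colim[OF J(1)]], of "(i, j)"] J ij by simp
      then show ?thesis
        unfolding p[OF J(1,2)] p[OF J(1,3)] using J ij by (simp add: v_def)
    qed
    obtain t where t [simp]: "t \<in> ar V" "src V t = c" "tgt V t = zt" and tk: "\<And>i. i \<in> I \<Longrightarrow> t \<cdot> k i = p i"
      using PC.P.k_desc[OF T'(1) p_hom p_D] by blast
    have th: "t \<cdot> h J = \<tau> (X J)" if J [simp]: "J \<in> \<J>" for J
    proof (rule PC.sub_eqI[OF cl[OF J] colim[OF J]])
      fix i assume i [simp]: "i \<in> J"
      have "i \<in> I" using JI[OF J i] .
      then show "(t \<cdot> h J) \<cdot> q J i = \<tau> (X J) \<cdot> q J i"
        using p[OF J i] by (simp add: hq tk v_def)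
    qed simp_all
    have t_hom: "t \<cdot> k i = \<tau> (X J) \<cdot> q J i" "k i = h J \<cdot> q J i" if "J \<in> \<J>" "i \<in> J" for J i
      using that JI[OF that] p[OF that] by (simp_all add: tk v_def hq)
    note \<tau>_eq = meas_homD(5-7)[OF \<tau>X[unfolded X_def T_eq], folded X_def]
    have "meas_hom (c, d, e, f) (zt, dt, et, ft) t"
    proof (rule meas_homI)
      show "dt \<cdot> t = (t \<boxtimes> t) \<cdot> d"
      proof (rule PC.P.k_eqI)
        fix i assume i [simp]: "i \<in> I"
        obtain J where J [simp]: "J \<in> \<J>" "i \<in> J" using ex2[OF i i] by blast
        have "(dt \<cdot> t) \<cdot> k i = dt \<cdot> \<tau> (X J) \<cdot> q J i"
          by (simp add: t_hom(1)[OF J])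
        also have "\<dots> = (\<tau> (X J) \<boxtimes> \<tau> (X J)) \<cdot> dz J \<cdot> q J i"
          using cmp_tail[OF \<tau>_eq(1)[OF J(1)], of "q J i"] by simp
        also have "\<dots> = (t \<boxtimes> t) \<cdot> (h J \<boxtimes> h J) \<cdot> dz J \<cdot> q J i"
          by (simp add: th)
        also have "\<dots> = (t \<boxtimes> t) \<cdot> d \<cdot> h J \<cdot> q J i"
          using cmp_tail[OF comonoid_homD(4)[OF hom[OF J(1)]], of "q J i"] by (simp del: tensor_cmp_tail)
        finally show "(dt \<cdot> t) \<cdot> k i = ((t \<boxtimes> t) \<cdot> d) \<cdot> k i"
          by (simp add: hq)
      qed simp_all
      show "et \<cdot> t = e"
      proof (rule PC.P.k_eqI)
        fix i assume i [simp]: "i \<in> I"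
        obtain J where J [simp]: "J \<in> \<J>" "i \<in> J" using ex2[OF i i] by blast
        have "(et \<cdot> t) \<cdot> k i = et \<cdot> \<tau> (X J) \<cdot> q J i"
          by (simp add: t_hom(1)[OF J])
        also have "\<dots> = e \<cdot> k i"
          using cmp_tail[OF \<tau>_eq(2)[OF J(1)], of "q J i"] by (simp add: eq)
        finally show "(et \<cdot> t) \<cdot> k i = e \<cdot> k i" .
      qed simp_all
      show "ft \<cdot> (a \<lhd> t) = f"
      proof (rule tensor_left_eqI[OF k is_functor_diagram[OF D(1)], of a])
        fix i assume "i \<in> ob (posetcat I r)"
        then have i [simp]: "i \<in> I" by simp
        obtain J where J [simp]: "J \<in> \<J>" "i \<in> J" using ex2[OF i i] by blast
        have "(ft \<cdot> (a \<lhd> t)) \<cdot> (a \<lhd> k i) = ft \<cdot> (a \<lhd> \<tau> (X J)) \<cdot> (a \<lhd> q J i)"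
          by (simp add: t_hom(1)[OF J])
        also have "\<dots> = f \<cdot> (a \<lhd> k i)"
          using cmp_tail[OF \<tau>_eq(3)[OF J(1)], of "a \<lhd> q J i"] by (simp add: fz_def hq)
        finally show "(ft \<cdot> (a \<lhd> t)) \<cdot> (a \<lhd> k i) = f \<cdot> (a \<lhd> k i)" .
      qed simp_all
    qed simp_all
    then show ?thesis
      unfolding C_eq T_eq by blast
  qed
  then show ?thesis
    using T by blast
qed

lemma terminal_measuring:
  assumes "inaccessible U" "locally_presentable U V"
  shows "\<exists>Q. meas_ob Q \<and> (\<forall>X. meas_ob X \<longrightarrow> (\<exists>!h. meas_hom X Q h))"
proof -
  obtain T where "meas_ob T" "\<And>X. meas_ob X \<Longrightarrow> \<exists>h. meas_hom X T h"
    using weakly_terminal[OF assms] by blast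
  moreover have "cocomplete U V" "locally_small U V"
    using assms(2) by (simp_all add: locally_presentable_def)
  ultimately show ?thesis
    using terminal_if_weakly_terminal[OF assms(1)] by blast
qed

lemma universal_arrow:
  assumes "inaccessible U" "locally_presentable U V"
  shows "\<exists>x\<in>ob (Comon V). \<exists>u\<in>homset (opcat (Mon V)) (omap (conv_functor V (b, mb, ib)) x) (a, ma, ia).
    \<forall>x'\<in>ob (Comon V). \<forall>g\<in>homset (opcat (Mon V)) (omap (conv_functor V (b, mb, ib)) x') (a, ma, ia).
      \<exists>!h. h \<in> homset (Comon V) x' x \<and> u \<cdot>\<^bsub>opcat (Mon V)\<^esub> amap (conv_functor V (b, mb, ib)) h = g"
proof -
  let ?H = "\<lambda>C. convolution V C (b, mb, ib)"
  have comon_ob: "C \<in> ob (Comon V) \<longleftrightarrow> is_comonoid V C" for C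
    by (simp add: Comon_def structured_cat_def)
  have comon_hom: "homset (Comon V) C C' = {(C, C', h) |h. is_comonoid V C \<and> is_comonoid V C' \<and> is_comonoid_hom V C C' h}" for C C'
    by (auto simp: Comon_def structured_cat_def homset_def)
  have mon_hom: "homset (opcat (Mon V)) (?H C) (a, ma, ia) =
      {((a, ma, ia), ?H C, g) |g. is_monoid V (?H C) \<and> is_monoid_hom V (a, ma, ia) (?H C) g}" for C
    using A by (auto simp: opcat_def Mon_def structured_cat_def homset_def)
  obtain Q where Q: "meas_ob Q" "\<forall>X. meas_ob X \<longrightarrow> (\<exists>!h. meas_hom X Q h)"
    using terminal_measuring[OF assms] by (elim exE conjE) (rule that)
  obtain c d e f where Q_eq: "Q = (c, d, e, f)"
    by (metis prod_cases4)
  note Q' [simp] = meas_obD(3-)[OF Q(1)[unfolded Q_eq]] and com = meas_obD(1)[OF Q(1)[unfolded Q_eq]]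
  define u where "u = transp V c a b f"
  have [simp]: "u \<in> ar V" "src V u = a" "tgt V u = hm c b" and ev_u: "ev V c b \<cdot> (u \<rhd> c) = f"
    by (simp_all add: u_def ev_transp)
  have u: "is_monoid_hom V (a, ma, ia) (?H (c, d, e)) u"
    using measuring_transp[OF A B com, of u] meas_obD(2)[OF Q(1)[unfolded Q_eq]] by (simp add: ev_u)
  show ?thesis
  proof (intro bexI[of _ "(c, d, e)"] bexI[of _ "((a, ma, ia), ?H (c, d, e), u)"] ballI)
    show "(c, d, e) \<in> ob (Comon V)"
      using com by (simp add: comon_ob)
    show "((a, ma, ia), ?H (c, d, e), u) \<in> homset (opcat (Mon V)) (omap (conv_functor V (b, mb, ib)) (c, d, e)) (a, ma, ia)"
      using u is_monoid_convolution[OF B com] unfolding conv_functor_def by (simp add: mon_hom del: convolution.simps)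
    fix x' g
    assume "x' \<in> ob (Comon V)" and g: "g \<in> homset (opcat (Mon V)) (omap (conv_functor V (b, mb, ib)) x') (a, ma, ia)"
    then obtain c' d' e' where x': "x' = (c', d', e')" and com': "is_comonoid V (c', d', e')"
      unfolding comon_ob by (metis prod_cases3)
    note [simp] = comonoidD(1-7)[OF com']
    obtain g' where g_eq: "g = ((a, ma, ia), ?H x', g')" and g': "is_monoid_hom V (a, ma, ia) (?H x') g'"
      using g unfolding conv_functor_def by (auto simp: mon_hom simp del: convolution.simps)
    have ga [simp]: "g' \<in> ar V" "src V g' = a" "tgt V g' = hm c' b"
      using g' by (auto simp: x' is_monoid_hom_def homset_def Let_def)
    define f' where "f' = ev V c' b \<cdot> (g' \<rhd> c')"
    have "meas (c', d', e') f'"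
      using measuring_transp[OF A B com' ga] g' unfolding f'_def x' by simp
    then have "meas_ob (c', d', e', f')"
      using com' by (simp add: meas_ob_def)
    then have ex1: "\<exists>!h. meas_hom (c', d', e', f') (c, d, e, f) h"
      using Q(2) unfolding Q_eq by blast
    have iff: "meas_hom (c', d', e', f') (c, d, e, f) h \<longleftrightarrow>
        is_comonoid_hom V (c', d', e') (c, d, e) h \<and> ihom_pre V h b \<cdot> u = g'" for h
    proof (cases "is_comonoid_hom V (c', d', e') (c, d, e) h")
      case True
      note [simp] = comonoid_homD(1-3)[OF True]
      have pre [simp]: "ihom_pre V h b \<in> ar V" "src V (ihom_pre V h b) = hm c b" "tgt V (ihom_pre V h b) = hm c' b"
        and ev_pre: "ev V c' b \<cdot> (ihom_pre V h b \<rhd> c') = ev V c b \<cdot> ((hm c b) \<lhd> h)"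
        using ihom_pre_ar[of h b] by simp_all
      have "ihom_pre V h b \<cdot> u = g' \<longleftrightarrow> ev V c' b \<cdot> ((ihom_pre V h b \<cdot> u) \<rhd> c') = f'"
        unfolding f'_def by (auto intro: ev_cancel[of c' b])
      also have "ev V c' b \<cdot> ((ihom_pre V h b \<cdot> u) \<rhd> c') = ev V c b \<cdot> (u \<rhd> c) \<cdot> (a \<lhd> h)"
        using cmp_tail[OF ev_pre, of "u \<rhd> c'"] by simp
      also have "\<dots> = f \<cdot> (a \<lhd> h)"
        using cmp_tail[OF ev_u, of "a \<lhd> h"] by (simp del: tensor_cmp)
      finally show ?thesis
        using True by (simp add: meas_hom_def)
    qed (simp add: meas_hom_def)
    have "h \<in> homset (Comon V) x' (c, d, e) \<and>
        ((a, ma, ia), ?H (c, d, e), u) \<cdot>\<^bsub>opcat (Mon V)\<^esub> amap (conv_functor V (b, mb, ib)) h = g \<longleftrightarrow>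
        (\<exists>h'. h = (x', (c, d, e), h') \<and> meas_hom (c', d', e', f') (c, d, e, f) h')" for h
      unfolding comon_hom iff using com com'
      by (auto simp: x' g_eq conv_functor_def opcat_def Mon_def structured_cat_def simp del: convolution.simps)
    then show "\<exists>!h. h \<in> homset (Comon V) x' (c, d, e) \<and>
        ((a, ma, ia), ?H (c, d, e), u) \<cdot>\<^bsub>opcat (Mon V)\<^esub> amap (conv_functor V (b, mb, ib)) h = g"
      using ex1 by auto
  qed
qed

end

theorem theorem4p1:
  fixes U :: "'u rel"
    and V :: "('o, 'm, 'z) brccat_scheme"
    and B :: "('o, 'm) structured"
  assumes "inaccessible U"
    and "braided_monoidal_closed_category V"
    and "locally_presentable U V"
    and "B \<in> ob (Mon V)"
  shows "\<exists>P \<phi>. adjunction (Comon V) (opcat (Mon V)) (conv_functor V B) P \<phi>"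
proof (rule adjunction_universal)
  interpret V: braided_monoidal_closed_category V by fact
  have B: "is_monoid V B"
    using assms(4) by (simp add: Mon_def structured_cat_def)
  then show "is_functor (Comon V) (opcat (Mon V)) (conv_functor V B)"
    by (rule V.is_functor_conv)
  fix A assume "A \<in> ob (opcat (Mon V))"
  then have A: "is_monoid V A"
    by (simp add: opcat_def Mon_def structured_cat_def)
  obtain a ma ia b mb ib where eq: "A = (a, ma, ia)" "B = (b, mb, ib)"
    by (metis prod_cases3)
  interpret measurings V a ma ia b mb ib
    using A B unfolding eq by unfold_locales
  show "\<exists>x\<in>ob (Comon V). \<exists>u\<in>homset (opcat (Mon V)) (omap (conv_functor V B) x) A.
      \<forall>x'\<in>ob (Comon V). \<forall>g\<in>homset (opcat (Mon V)) (omap (conv_functor V B) x') A.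
        \<exists>!h. h \<in> homset (Comon V) x' x \<and> u \<cdot>\<^bsub>opcat (Mon V)\<^esub> amap (conv_functor V B) h = g"
    unfolding eq by (rule universal_arrow[OF assms(1,3)])
qed

end
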